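(* Let $N\geq 10$, let $B_1$ be the open unit ball of $\mathbb{R}^N$, and let $0\leq C_1\leq C_2$, where $C_2\in[2(N-2),(N-2)^2/4]$. Then there exists $f\in C^\infty([0,+\infty))$ which is nondecreasing and convex with $f(0)>0$ and $\lim_{t\to+\infty} f(t)/t=+\infty$, such that, for the problem $-\Delta u=\lambda f(u)$ in $B_1$, $u>0$ in $B_1$, $u=0$ on $\partial B_1$, the extremal solution $u^\ast$ is unbounded, the extremal parameter is $\lambda^\ast=1$, and $$\liminf_{r\to 0} r^2 f'(u^\ast(r))=C_1,\qquad \limsup_{r\to 0} r^2 f'(u^\ast(r))=C_2.$$
   Context: For $f:[0,\infty)\to\mathbb{R}$ which is $C^1$, nondecreasing and convex with $f(0)>0$ and $\lim_{t\to+\infty}f(t)/t=+\infty$, consider for $\lambda\ge 0$ the problem $(P_\lambda)$: $-\Delta u=\lambda f(u)$ in $B_1$, $u>0$ in $B_1$, $u=0$ on $\partial B_1$. It is well known that there is a finite number $\lambda^\ast>0$ (the extremal parameter) such that for $0<\lambda<\lambda^\ast$ the problem $(P_\lambda)$ has a minimal (i.e. pointwise smallest) classical solution $u_\lambda\in C^0(\overline{B_1})\cap C^2(B_1)$, while for $\lambda>\lambda^\ast$ there is no solution, even in the weak sense. The functions $u_\lambda$ are increasing in $\lambda$, and the extremal solution is the pointwise limit $u^\ast(x):=\lim_{\lambda\uparrow\lambda^\ast}u_\lambda(x)$, a weak solution of $(P_{\lambda^\ast})$. On the ball, $u^\ast$ is radially symmetric and radially decreasing; $u^\ast(r)$ denotes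 its value at points with $|x|=r$. *)

theory Defs
  imports "HOL-Analysis.Analysis"
begin

text \<open>One-sided derivatives at \<open>0\<close>, so that only the values of \<open>f\<close> on \<open>[0,\<infinity>)\<close> matter.\<close>

definition smooth_on_nonneg :: "(real \<Rightarrow> real) \<Rightarrow> bool" where
  "smooth_on_nonneg f \<longleftrightarrow>
     (\<exists>F :: nat \<Rightarrow> real \<Rightarrow> real. F 0 = f \<and>
        (\<forall>k. \<forall>t\<ge>0. (F k has_real_derivative F (Suc k) t) (at t within {0..})))"

text \<open>
  For open \<open>S\<close> this is \<open>C\<^sup>2(S)\<close>. For \<open>S = closure \<Omega>\<close> with \<open>\<Omega> = interior S\<close> (as for a ball) it is
  the class of functions in \<open>C\<^sup>2(\<Omega>)\<close> which extend continuously to \<open>S\<close> together with their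
  derivatives up to order two.
\<close>

definition C2_on :: "'a::euclidean_space set \<Rightarrow> ('a \<Rightarrow> real) \<Rightarrow> bool" where
  "C2_on S u \<longleftrightarrow>
     (\<exists>(Du :: 'a \<Rightarrow> 'a) (D2u :: 'a \<Rightarrow> 'a \<Rightarrow>\<^sub>L 'a).
        continuous_on S u \<and> continuous_on S Du \<and> continuous_on S D2u \<and>
        (\<forall>x\<in>interior S. (u has_derivative (\<lambda>h. Du x \<bullet> h)) (at x)) \<and>
        (\<forall>x\<in>interior S. (Du has_derivative blinfun_apply (D2u x)) (at x)))"

definition partial_deriv :: "'a::euclidean_space \<Rightarrow> ('a \<Rightarrow> real) \<Rightarrow> 'a \<Rightarrow> real" where
  "partial_deriv b u x = deriv (\<lambda>t. u (x + t *\<^sub>R b)) 0"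

definition laplacian :: "('a::euclidean_space \<Rightarrow> real) \<Rightarrow> 'a \<Rightarrow> real" where
  "laplacian u x = (\<Sum>b\<in>Basis. partial_deriv b (partial_deriv b u) x)"

text \<open>The problem \<open>-\<Delta>u = \<lambda> f(u)\<close>, \<open>u > 0\<close> in \<open>\<Omega>\<close>, \<open>u = 0\<close> on the boundary of \<open>\<Omega>\<close>.\<close>

definition classical_solution ::
    "'a::euclidean_space set \<Rightarrow> (real \<Rightarrow> real) \<Rightarrow> real \<Rightarrow> ('a \<Rightarrow> real) \<Rightarrow> bool" where
  "classical_solution \<Omega> f l u \<longleftrightarrow>
     continuous_on (closure \<Omega>) u \<and> C2_on \<Omega> u \<and>
     (\<forall>x\<in>\<Omega>. - laplacian u x = l * f (u x)) \<and>
     (\<forall>x\<in>\<Omega>. 0 < u x) \<and> (\<forall>x\<in>frontier \<Omega>. u x = 0)"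

text \<open>
  Weak solutions in the sense of Brezis, Cazenave, Martel and Ramiandrisoana: \<open>u \<ge> 0\<close> a.e.,
  \<open>u \<in> L\<^sup>1(\<Omega>)\<close>, \<open>f(u) \<delta> \<in> L\<^sup>1(\<Omega>)\<close> with \<open>\<delta>\<close> the distance to the boundary, and the equation holds
  against every \<open>\<zeta> \<in> C\<^sup>2(closure \<Omega>)\<close> vanishing on the boundary.
\<close>

definition weak_solution ::
    "'a::euclidean_space set \<Rightarrow> (real \<Rightarrow> real) \<Rightarrow> real \<Rightarrow> ('a \<Rightarrow> real) \<Rightarrow> bool" where
  "weak_solution \<Omega> f l u \<longleftrightarrow>
     (AE x in lebesgue_on \<Omega>. 0 \<le> u x) \<and>
     integrable (lebesgue_on \<Omega>) u \<and>
     integrable (lebesgue_on \<Omega>) (\<lambda>x. f (u x) * infdist x (frontier \<Omega>)) \<and>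
     (\<forall>\<zeta>. C2_on (closure \<Omega>) \<zeta> \<and> (\<forall>x\<in>frontier \<Omega>. \<zeta> x = 0) \<longrightarrow>
        (LINT x|lebesgue_on \<Omega>. u x * (- laplacian \<zeta> x)) =
        l * (LINT x|lebesgue_on \<Omega>. f (u x) * \<zeta> x))"

definition minimal_solution ::
    "'a::euclidean_space set \<Rightarrow> (real \<Rightarrow> real) \<Rightarrow> real \<Rightarrow> ('a \<Rightarrow> real) \<Rightarrow> bool" where
  "minimal_solution \<Omega> f l u \<longleftrightarrow>
     classical_solution \<Omega> f l u \<and>
     (\<forall>v. classical_solution \<Omega> f l v \<longrightarrow> (\<forall>x\<in>closure \<Omega>. u x \<le> v x))"

text \<open>There is at most one such \<open>L\<close>.\<close>

definition extremal_parameter ::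
    "'a::euclidean_space set \<Rightarrow> (real \<Rightarrow> real) \<Rightarrow> real \<Rightarrow> bool" where
  "extremal_parameter \<Omega> f L \<longleftrightarrow>
     0 < L \<and>
     (\<forall>l. 0 < l \<and> l < L \<longrightarrow> (\<exists>u. minimal_solution \<Omega> f l u)) \<and>
     (\<forall>l>L. \<not> (\<exists>u. classical_solution \<Omega> f l u) \<and> \<not> (\<exists>u. weak_solution \<Omega> f l u))"

text \<open>
  The pointwise limit of the minimal solutions as the parameter increases to the extremal parameter
  \<open>L\<close>. It takes values in the extended reals because the limit may be \<open>\<infinity>\<close> at some points (for a
  singular extremal solution on a ball, at the centre); it is determined uniquely on \<open>\<Omega>\<close>.
\<close>

definition extremal_solution ::
    "'a::euclidean_space set \<Rightarrow> (real \<Rightarrow> real) \<Rightarrow> ('a \<Rightarrow> ereal) \<Rightarrow> bool" where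
  "extremal_solution \<Omega> f ustar \<longleftrightarrow>
     (\<exists>L u. extremal_parameter \<Omega> f L \<and>
        (\<forall>l. 0 < l \<and> l < L \<longrightarrow> minimal_solution \<Omega> f l (u l)) \<and>
        (\<forall>x\<in>\<Omega>. ((\<lambda>l. ereal (u l x)) \<longlongrightarrow> ustar x) (at_left L)))"

text \<open>Unbounded in the sense of not belonging to \<open>L\<^sup>\<infinity>(\<Omega>)\<close>, for a nonnegative function.\<close>

definition ess_unbounded_on :: "'a::euclidean_space set \<Rightarrow> ('a \<Rightarrow> ereal) \<Rightarrow> bool" where
  "ess_unbounded_on \<Omega> u \<longleftrightarrow> \<not> (\<exists>M::real. AE x in lebesgue_on \<Omega>. u x \<le> ereal M)"

end

theory Submission
  imports Defs "HOL-Complex_Analysis.Conformal_Mappings"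
begin

text \<open>
  Put \<open>k = N - 1\<close> and \<open>s = - ln r\<close>. For a radial solution of \<open>-\<Delta>u = f(u)\<close> the function \<open>w = - u'\<close> solves
  the linearised equation; with \<open>p = (ln w)'\<close> (derivative in \<open>s\<close>) this reads
  \<open>r\<^sup>2 f'(u) = (k - p) (1 + p) - p'\<close> and \<open>f(u) = (k - p) w / r\<close>. So \<open>p\<close> can be prescribed: it rests at
  the value giving \<open>C2\<close> and makes sparse, ever slower dips towards the value giving \<open>C1\<close>. Slowness
  makes \<open>f'(u)\<close> monotone in \<open>r\<close>, hence \<open>f\<close> convex; sparsity makes \<open>u\<close> unbounded.

  That this \<open>u\<close> is the extremal solution for the parameter \<open>1\<close> follows from radial arguments. The
  minimal solution is the limit of the iterates \<open>u\<^sub>n\<^sub>+\<^sub>1 = (-\<Delta>)\<^sup>-\<^sup>1 (\<lambda> f(u\<^sub>n))\<close> started at \<open>0\<close>, which are radial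
  and lie below every solution, classical or weak. At \<open>\<lambda> = 1\<close> they converge to \<open>u\<close> by a Wronskian
  comparison with \<open>w r\<^sup>-\<^sup>m\<close>, where \<open>m\<^sup>2 = N\<^sup>2 / 4 - C2 \<ge> k\<close>. Since \<open>1 / f\<close> is integrable, a solution for one
  parameter yields a bounded supersolution for each smaller one; hence the iterates are bounded for
  \<open>\<lambda> < 1\<close>, and a solution for \<open>\<lambda> > 1\<close> would make \<open>u\<close> bounded.
\<close>

subsection \<open>Iterated differentiability and a smooth bump\<close>

text \<open>For constant \<open>p\<close> the smaller root of \<open>(k - p) * (1 + p) = C\<close>
  is \<open>p = (k - 1) / 2 - sqrt (N\<^sup>2 / 4 - C)\<close>, and each hypothesis on the constants
  is a condition on such roots. \<open>0 \<le> C1\<close> says that the lower value is at least -1.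
  \<open>2 * (N - 2) \<le> C2\<close> says that the rest value is at least 1, so that
  \<open>w * r\<close> does not decay towards the origin during a rest.
  \<open>C2 \<le> (N - 2)\<^sup>2 / 4\<close>, with the Hardy constant on the right, is
  \<open>k \<le> m\<^sup>2\<close>. The delicate case is \<open>C1 = 0\<close>. A nondecreasing
  \<open>f\<close> means \<open>p' \<le> (k - p) * (1 + p)\<close>, so once \<open>p\<close> has
  reached -1 it can never rise again. The dips therefore only approach the lower value, and their
  first two derivatives are kept below a small multiple of the gap that remains. Near the origin the
  radial equation is used as a first-order system whose flux tends to 0, which excludes a point mass
  there and admits singular solutions. The profile is built for radii up to 2, so that
  \<open>f\<close> is smooth on a half-line starting below 0 and its derivatives at 0 are
  two-sided.\<close>

fun times_differentiable :: "nat \<Rightarrow> real set \<Rightarrow> (real \<Rightarrow> real) \<Rightarrow> bool" where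
  "times_differentiable 0 S f = True"
| "times_differentiable (Suc n) S f =
     (\<exists>f'. (\<forall>x\<in>S. (f has_real_derivative f' x) (at x)) \<and> times_differentiable n S f')"

lemma times_differentiable_cong:
  assumes "open S" "times_differentiable n S f" "\<And>x. x \<in> S \<Longrightarrow> f x = g x"
  shows "times_differentiable n S g"
proof (cases n)
  case (Suc m)
  with assms(2) obtain f' where f': "\<And>x. x \<in> S \<Longrightarrow> (f has_real_derivative f' x) (at x)"
    and m: "times_differentiable m S f'"
    by auto
  have "(g has_real_derivative f' x) (at x)" if "x \<in> S" for x
    using f'[OF that] assms(1) that assms(3)
    by (rule has_field_derivative_transform_within_open)
  with m Suc show ?thesis
    by auto
qed simp

lemma times_differentiable_SucD: "times_differentiable (Suc n) S f \<Longrightarrow> times_differentiable n S f"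
proof (induction n arbitrary: f)
  case (Suc n)
  from Suc.prems obtain f' where "\<forall>x\<in>S. (f has_real_derivative f' x) (at x)"
    "times_differentiable (Suc n) S f'"
    unfolding times_differentiable.simps(2)[of "Suc n"] by blast
  with Suc.IH show ?case
    unfolding times_differentiable.simps(2)[of n] by blast
qed simp

lemma times_differentiable_subset:
  "times_differentiable n S f \<Longrightarrow> T \<subseteq> S \<Longrightarrow> times_differentiable n T f"
proof (induction n arbitrary: f)
  case (Suc n)
  then obtain f' where "\<forall>x\<in>S. (f has_real_derivative f' x) (at x)"
    "times_differentiable n S f'"
    unfolding times_differentiable.simps by blast
  with Suc show ?case
    unfolding times_differentiable.simps by (intro exI[of _ f']) auto
qed simp

lemma times_differentiable_const: "times_differentiable n S (\<lambda>x. c)"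
proof (induction n arbitrary: c)
  case (Suc n)
  then show ?case
    by (auto simp del: times_differentiable.simps(1) intro!: exI[of _ "\<lambda>x. 0"])
qed simp

lemma times_differentiable_ident: "times_differentiable n S (\<lambda>x. x)"
  by (cases n) (auto intro!: exI[of _ "\<lambda>x. 1"] times_differentiable_const)

lemma times_differentiable_add:
  "times_differentiable n S f \<Longrightarrow> times_differentiable n S g \<Longrightarrow>
   times_differentiable n S (\<lambda>x. f x + g x)"
proof (induction n arbitrary: f g)
  case (Suc n)
  obtain f' g' where
    "\<And>x. x \<in> S \<Longrightarrow> (f has_real_derivative f' x) (at x)" "times_differentiable n S f'"
    "\<And>x. x \<in> S \<Longrightarrow> (g has_real_derivative g' x) (at x)" "times_differentiable n S g'"
    using Suc.prems by auto
  then show ?case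
    unfolding times_differentiable.simps using Suc.IH[of f' g']
    by (intro exI[of _ "\<lambda>x. f' x + g' x"]) (simp add: DERIV_add)
qed simp

lemma times_differentiable_mult:
  "times_differentiable n S f \<Longrightarrow> times_differentiable n S g \<Longrightarrow>
   times_differentiable n S (\<lambda>x. f x * g x)"
proof (induction n arbitrary: f g)
  case (Suc n)
  obtain f' g' where *:
    "\<And>x. x \<in> S \<Longrightarrow> (f has_real_derivative f' x) (at x)" "times_differentiable n S f'"
    "\<And>x. x \<in> S \<Longrightarrow> (g has_real_derivative g' x) (at x)" "times_differentiable n S g'"
    using Suc.prems by auto
  have "times_differentiable n S (\<lambda>x. f' x * g x + g' x * f x)"
    using Suc * times_differentiable_SucD by (intro times_differentiable_add Suc.IH) auto
  then show ?case
    unfolding times_differentiable.simps using *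
    by (intro exI[of _ "\<lambda>x. f' x * g x + g' x * f x"]) (simp add: DERIV_mult)
qed simp

lemma times_differentiable_minus:
  "times_differentiable n S f \<Longrightarrow> times_differentiable n S (\<lambda>x. - f x)"
  using times_differentiable_mult[OF times_differentiable_const[of n S "-1"]] by simp

lemma times_differentiable_diff:
  "times_differentiable n S f \<Longrightarrow> times_differentiable n S g \<Longrightarrow>
   times_differentiable n S (\<lambda>x. f x - g x)"
  using times_differentiable_add[OF _ times_differentiable_minus] by fastforce

lemma times_differentiable_compose:
  "times_differentiable n T f \<Longrightarrow> times_differentiable n S g \<Longrightarrow> g ` S \<subseteq> T \<Longrightarrow>
   times_differentiable n S (\<lambda>x. f (g x))"
proof (induction n arbitrary: f g)
  case (Suc n)
  obtain f' where f': "\<And>x. x \<in> T \<Longrightarrow> (f has_real_derivative f' x) (at x)" "times_differentiable n T f'"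
    using Suc.prems(1) by auto
  obtain g' where g': "\<And>x. x \<in> S \<Longrightarrow> (g has_real_derivative g' x) (at x)" "times_differentiable n S g'"
    using Suc.prems(2) by auto
  have "times_differentiable n S (\<lambda>x. f' (g x) * g' x)"
    using Suc.IH[OF f'(2) times_differentiable_SucD[OF Suc.prems(2)] Suc.prems(3)] g'(2)
    by (rule times_differentiable_mult)
  moreover have "((\<lambda>x. f (g x)) has_real_derivative f' (g x) * g' x) (at x)" if "x \<in> S" for x
    using DERIV_chain2[OF f'(1) g'(1)[OF that]] Suc.prems(3) that by blast
  ultimately show ?case
    unfolding times_differentiable.simps by (intro exI[of _ "\<lambda>x. f' (g x) * g' x"]) simp
qed simp

lemma times_differentiable_inverse:
  "times_differentiable n (- {0}) (inverse :: real \<Rightarrow> real)"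
proof (induction n)
  case (Suc n)
  have "times_differentiable n (- {0}) (\<lambda>x. - (inverse x * inverse x :: real))"
    by (intro times_differentiable_minus times_differentiable_mult Suc)
  then show ?case
    by (auto intro!: exI[of _ "\<lambda>x. - (inverse x * inverse x)"] derivative_eq_intros)
qed simp

lemma times_differentiable_divide:
  assumes "times_differentiable n S f" "times_differentiable n S g" "\<And>x. x \<in> S \<Longrightarrow> g x \<noteq> 0"
  shows "times_differentiable n S (\<lambda>x. f x / g x)"
  unfolding divide_inverse
  using assms
  by (intro times_differentiable_mult times_differentiable_compose[OF times_differentiable_inverse])
     auto

lemma times_differentiable_exp: "times_differentiable n S (exp :: real \<Rightarrow> real)"
  by (induction n) (auto intro!: exI[of _ exp] derivative_eq_intros)

lemma times_differentiable_ln: "times_differentiable n {0<..} (ln :: real \<Rightarrow> real)"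
proof (cases n)
  case (Suc m)
  have "times_differentiable m {0<..} (\<lambda>x. 1 / x :: real)"
    by (intro times_differentiable_divide times_differentiable_const times_differentiable_ident) auto
  with Suc show ?thesis
    by (auto intro!: exI[of _ "\<lambda>x. 1 / x"] derivative_eq_intros)
qed simp

text \<open>Differentiability is local, and \<open>deriv f\<close> glues the local derivatives into
  one witness. This serves functions with a different formula near each point, such as an infinite
  sum of bumps with separated supports.\<close>

lemma times_differentiable_local:
  assumes "open S" "\<And>x. x \<in> S \<Longrightarrow> \<exists>g T. open T \<and> x \<in> T \<and> times_differentiable n T g \<and> (\<forall>y\<in>T. f y = g y)"
  shows "times_differentiable n S f"
  using assms(2)
proof (induction n arbitrary: f)
  case (Suc n)
  have *: "\<exists>g' T. open T \<and> x \<in> T \<and> times_differentiable n T g' \<and>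
             (\<forall>y\<in>T. (f has_real_derivative g' y) (at y))" if x: "x \<in> S" for x
  proof -
    obtain g T where gT: "open T" "x \<in> T" "times_differentiable (Suc n) T g" "\<And>y. y \<in> T \<Longrightarrow> f y = g y"
      using Suc.prems[OF x] by blast
    obtain g' where g': "\<And>y. y \<in> T \<Longrightarrow> (g has_real_derivative g' y) (at y)" "times_differentiable n T g'"
      using gT(3) by auto
    have "(f has_real_derivative g' y) (at y)" if "y \<in> T" for y
      using g'(1)[OF that] gT(1) that gT(4)[symmetric]
      by (rule has_field_derivative_transform_within_open)
    with gT(1,2) g'(2) show ?thesis
      by (intro exI[of _ g'] exI[of _ T]) simp
  qed
  have "(f has_real_derivative deriv f x) (at x)" if "x \<in> S" for x
  proof -
    obtain T g' where "x \<in> T" "\<forall>y\<in>T. (f has_real_derivative g' y) (at y)"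
      using *[OF \<open>x \<in> S\<close>] by blast
    then have "(f has_real_derivative g' x) (at x)"
      by blast
    then show ?thesis
      using DERIV_imp_deriv by fastforce
  qed
  moreover have "times_differentiable n S (deriv f)"
  proof (rule Suc.IH)
    fix x assume "x \<in> S"
    then obtain T g' where T: "open T" "x \<in> T" "times_differentiable n T g'"
      "\<forall>y\<in>T. (f has_real_derivative g' y) (at y)"
      using * by blast
    then have "\<forall>y\<in>T. deriv f y = g' y"
      using DERIV_imp_deriv by fast
    with T show "\<exists>g T. open T \<and> x \<in> T \<and> times_differentiable n T g \<and> (\<forall>y\<in>T. deriv f y = g y)"
      by (intro exI[of _ g'] exI[of _ T]) simp
  qed
  ultimately show ?case
    unfolding times_differentiable.simps by (intro exI[of _ "deriv f"]) simp
qed simp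

lemma times_differentiable_deriv:
  assumes "open S" "times_differentiable (Suc n) S f"
  shows "times_differentiable n S (deriv f)"
    and "x \<in> S \<Longrightarrow> (f has_real_derivative deriv f x) (at x)"
proof -
  obtain f' where f': "\<And>x. x \<in> S \<Longrightarrow> (f has_real_derivative f' x) (at x)"
    and m: "times_differentiable n S f'"
    using assms(2) by auto
  then show "times_differentiable n S (deriv f)"
    by (intro times_differentiable_cong[OF assms(1) m]) (metis DERIV_imp_deriv)
  show "x \<in> S \<Longrightarrow> (f has_real_derivative deriv f x) (at x)"
    using f'[of x] DERIV_imp_deriv by fastforce
qed

lemma times_differentiable_iterate_deriv:
  assumes "open S" "\<And>n. times_differentiable n S f"
  shows "times_differentiable n S ((deriv ^^ k) f)"
proof (induction k arbitrary: n)
  case (Suc k)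
  then show ?case
    using times_differentiable_deriv(1)[OF assms(1) Suc.IH[of "Suc n"]] by simp
qed (use assms in simp)

lemma times_differentiable_imp_continuous_on:
  "times_differentiable (Suc n) S f \<Longrightarrow> continuous_on S f"
  by (auto intro: continuous_at_imp_continuous_on DERIV_isCont)

lemma smooth_on_nonneg_if_times_differentiable:
  assumes "A < 0" "\<And>n. times_differentiable n {A<..} f"
  shows "smooth_on_nonneg f"
  unfolding smooth_on_nonneg_def
proof (intro exI[of _ "\<lambda>k. (deriv ^^ k) f"] conjI allI impI)
  fix k and t :: real
  assume "0 \<le> t"
  then have "((deriv ^^ k) f has_real_derivative (deriv ^^ Suc k) f t) (at t)"
    using times_differentiable_deriv(2)[OF _ times_differentiable_iterate_deriv[OF _ assms(2)], of t k] assms(1)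
    by auto
  then show "((deriv ^^ k) f has_real_derivative (deriv ^^ Suc k) f t) (at t within {0..})"
    by (rule has_field_derivative_at_within)
qed simp

section \<open>A smooth bump supported in [1, 2]\<close>

definition flat :: "nat \<Rightarrow> real \<Rightarrow> real" where
  "flat j x = (if 0 < x then exp (- (1 / x)) * (1 / x) ^ j else 0)"

text \<open>Carrying the factor \<open>(1 / x) ^ j\<close> makes the family closed under
  differentiation, so smoothness follows by one induction for all \<open>j\<close>. At 0 the
  exponential beats every power in the right-hand difference quotient.\<close>

lemma has_real_derivative_flat:
  "(flat j has_real_derivative flat (j + 2) x - real j * flat (j + 1) x) (at x)"
proof -
  consider "x > 0" | "x < 0" | "x = 0" by linarith
  then show ?thesis
  proof cases
    case 1
    have inv: "((\<lambda>x. 1 / x) has_real_derivative - ((1 / x) ^ 2)) (at x)"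
      using 1 by (auto intro!: derivative_eq_intros simp: power2_eq_square)
    have "((\<lambda>x. (1 / x) ^ j) has_real_derivative - (real j * (1 / x) ^ (j + 1))) (at x)"
      using DERIV_power[OF inv, of j] by (cases j) (simp_all add: power2_eq_square mult_ac)
    moreover have "((\<lambda>x. exp (- (1 / x))) has_real_derivative exp (- (1 / x)) * (- (- ((1 / x) ^ 2)))) (at x)"
      by (rule DERIV_fun_exp[OF DERIV_minus[OF inv]])
    ultimately have "((\<lambda>x. exp (- (1 / x)) * (1 / x) ^ j) has_real_derivative
        flat (j + 2) x - real j * flat (j + 1) x) (at x)"
      using 1 by (auto intro!: DERIV_cong[OF DERIV_mult] simp: flat_def power2_eq_square algebra_simps)
    then show ?thesis
      by (rule has_field_derivative_transform_within_open[of _ _ _ "{0<..}"]) (use 1 in \<open>auto simp: flat_def\<close>)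
  next
    case 2
    have "((\<lambda>x. 0) has_real_derivative 0) (at x)"
      by simp
    then have "(flat j has_real_derivative 0) (at x)"
      by (rule has_field_derivative_transform_within_open[of _ _ _ "{..<0}"]) (use 2 in \<open>auto simp: flat_def\<close>)
    then show ?thesis
      using 2 by (simp add: flat_def)
  next
    case 3
    have "((\<lambda>y. flat j y / y) \<longlongrightarrow> 0) (at_left 0)"
      by (rule tendsto_eventually) (auto simp: flat_def eventually_at_filter)
    moreover have "((\<lambda>y::real. exp (- (1 / y)) * (1 / y) ^ Suc j) \<longlongrightarrow> 0) (at_right 0)"
    proof -
      have "((\<lambda>y::real. y ^ Suc j / exp y) \<longlongrightarrow> 0) at_top"
        by (rule tendsto_power_div_exp_0)
      then have "((\<lambda>y::real. inverse y ^ Suc j / exp (inverse y)) \<longlongrightarrow> 0) (at_right 0)"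
        by (rule filterlim_compose[OF _ filterlim_inverse_at_top_right])
      then show ?thesis
        by (simp add: exp_minus field_simps power_inverse)
    qed
    then have "((\<lambda>y. flat j y / y) \<longlongrightarrow> 0) (at_right 0)"
      by (rule Lim_transform_eventually) (auto simp: flat_def eventually_at_filter)
    ultimately have "((\<lambda>y. flat j y / y) \<longlongrightarrow> 0) (at 0)"
      by (simp add: filterlim_split_at)
    then show ?thesis
      using 3 by (simp add: has_field_derivative_iff flat_def)
  qed
qed

lemma times_differentiable_flat: "times_differentiable n S (flat j)"
proof (induction n arbitrary: j)
  case (Suc n)
  have "times_differentiable n S (\<lambda>x. flat (j + 2) x - real j * flat (j + 1) x)"
    by (intro times_differentiable_diff times_differentiable_mult times_differentiable_const Suc)
  then show ?case
    using has_real_derivative_flat by (auto intro!: exI[of _ "\<lambda>x. flat (j + 2) x - real j * flat (j + 1) x"])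
qed simp

text \<open>The factor \<open>exp 4\<close> normalises the peak at \<open>3 / 2\<close>, where both
  flat factors equal \<open>exp (-2)\<close>.\<close>

definition bump :: "real \<Rightarrow> real" where
  "bump x = exp 4 * (flat 0 (x - 1) * flat 0 (2 - x))"

lemma times_differentiable_bump: "times_differentiable n S bump"
  unfolding bump_def
  by (intro times_differentiable_mult times_differentiable_const
      times_differentiable_compose[OF times_differentiable_flat[of _ UNIV]] times_differentiable_diff
      times_differentiable_ident subset_UNIV)

lemma bump_eq_0: "x \<le> 1 \<or> 2 \<le> x \<Longrightarrow> bump x = 0"
  by (auto simp: bump_def flat_def)

lemma bump_nonneg: "0 \<le> bump x"
  by (simp add: bump_def flat_def)

lemma bump_le_1: "bump x \<le> 1"
proof (cases "1 < x \<and> x < 2")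
  case True
  \<comment> \<open>The two factors sum to 1, so their product is at most 1/4.\<close>
  have "4 * ((x - 1) * (2 - x)) \<le> 1"
    using zero_le_power2[of "2 * x - 3"] by (simp add: power2_eq_square algebra_simps)
  then have "4 \<le> 1 / (x - 1) + 1 / (2 - x)"
    using True by (simp add: add_frac_eq pos_le_divide_eq)
  then show ?thesis
    using True by (simp add: bump_def flat_def flip: exp_add)
qed (use bump_eq_0[of x] in auto)

lemma bump_half: "bump (3 / 2) = 1"
  by (simp add: bump_def flat_def flip: exp_add)

lemma bump_derivs:
  obtains B1 B2 M where
    "\<And>x. (bump has_real_derivative B1 x) (at x)" "\<And>x. (B1 has_real_derivative B2 x) (at x)"
    "\<And>x. \<bar>B1 x\<bar> \<le> M" "\<And>x. \<bar>B2 x\<bar> \<le> M" "\<And>x. x < 1 \<or> 2 < x \<Longrightarrow> B1 x = 0"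
    "B1 1 = 0" "1 \<le> M"
proof -
  have td: "times_differentiable (Suc (Suc (Suc 0))) UNIV bump"
    by (rule times_differentiable_bump)
  then obtain B1 where B1: "\<And>x. (bump has_real_derivative B1 x) (at x)"
    "times_differentiable (Suc (Suc 0)) UNIV B1"
    unfolding times_differentiable.simps(2)[of "Suc (Suc 0)"] by blast
  then obtain B2 where "\<And>x. (B1 has_real_derivative B2 x) (at x)" "times_differentiable (Suc 0) UNIV B2"
    unfolding times_differentiable.simps(2)[of "Suc 0"] by blast
  note B = B1(1) this
  have z1: "B1 x = 0" if "x < 1 \<or> 2 < x" for x
  proof -
    have "((\<lambda>x. 0) has_real_derivative 0) (at x)"
      by simp
    then have "(bump has_real_derivative 0) (at x)"
      by (rule has_field_derivative_transform_within_open[of _ _ _ "{..<1} \<union> {2<..}"])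
         (use that in \<open>auto simp: bump_eq_0\<close>)
    then show ?thesis
      using B(1) DERIV_unique by blast
  qed
  have z2: "B2 x = 0" if "x < 1 \<or> 2 < x" for x
  proof -
    have "((\<lambda>x. 0) has_real_derivative 0) (at x)"
      by simp
    then have "(B1 has_real_derivative 0) (at x)"
      by (rule has_field_derivative_transform_within_open[of _ _ _ "{..<1} \<union> {2<..}"])
         (use that in \<open>auto simp: z1\<close>)
    then show ?thesis
      using B(2) DERIV_unique by blast
  qed
  have "continuous_on {1..2} B1" "continuous_on {1..2} B2"
    using B(2) times_differentiable_imp_continuous_on[OF B(3)]
    by (auto intro: continuous_on_subset continuous_at_imp_continuous_on DERIV_isCont)
  then have "bounded (B1 ` {1..2})" "bounded (B2 ` {1..2})"
    by (auto intro: compact_imp_bounded compact_continuous_image)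
  then obtain M1 M2 where M: "\<And>x. x \<in> {1..2} \<Longrightarrow> \<bar>B1 x\<bar> \<le> M1" "\<And>x. x \<in> {1..2} \<Longrightarrow> \<bar>B2 x\<bar> \<le> M2"
    unfolding bounded_iff real_norm_def by (meson imageI)
  \<comment> \<open>The endpoint 1 is not covered by \<open>z1\<close>; there the bump attains its
    minimum 0.\<close>
  have "B1 1 = 0"
    by (rule DERIV_local_min[OF B(1), of 1 1]) (simp_all add: bump_eq_0 bump_nonneg)
  moreover have "\<bar>B1 x\<bar> \<le> max 1 (max M1 M2)" for x
    using M(1)[of x] z1[of x] by (cases "x \<in> {1..2}") (simp_all add: le_max_iff_disj not_le)
  moreover have "\<bar>B2 x\<bar> \<le> max 1 (max M1 M2)" for x
    using M(2)[of x] z2[of x] by (cases "x \<in> {1..2}") (simp_all add: le_max_iff_disj not_le)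
  moreover have "1 \<le> max 1 (max M1 M2)"
    by simp
  ultimately show thesis
    using B(1,2) z1 that[of B1 B2 "max 1 (max M1 M2)"] by blast
qed

subsection \<open>Sparse slow dips\<close>

text \<open>The gap \<open>exp (4 * s)\<close> after a dip on \<open>[s, 2 * s]\<close> is tuned to
  the growth of \<open>U\<close>: in the logarithmic variable \<open>U\<close> grows on the
  following plateau at rate at least \<open>exp (- 4 * s)\<close>, so each plateau contributes at
  least 1.\<close>

primrec dip_start :: "real \<Rightarrow> nat \<Rightarrow> real" where
  "dip_start K 0 = 2 * K"
| "dip_start K (Suc n) = 2 * dip_start K n + exp (4 * dip_start K n)"

lemma dip_start_ge: "1 \<le> K \<Longrightarrow> K * (real n + 2) \<le> dip_start K n"
proof (induction n)
  case (Suc n)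
  have "K * 1 \<le> K * (real n + 1)"
    using Suc.prems by (intro mult_left_mono) auto
  moreover have "K * (real n + 1) = K * real n + K"
    by (simp add: algebra_simps)
  ultimately have "K * (real (Suc n) + 2) \<le> 2 * (K * (real n + 2))"
    using Suc.prems by (simp add: algebra_simps)
  also have "\<dots> \<le> 2 * dip_start K n"
    using Suc by simp
  also have "\<dots> \<le> dip_start K (Suc n)"
    by simp
  finally show ?case .
qed simp

lemma dip_start_less: "1 \<le> K \<Longrightarrow> 2 * dip_start K n < dip_start K (Suc n)"
  by simp

lemma dip_start_ge_2:
  assumes "1 \<le> K"
  shows "2 \<le> dip_start K n"
proof -
  have "1 * 2 \<le> K * (real n + 2)"
    using assms by (intro mult_mono) auto
  then show ?thesis
    using dip_start_ge[OF assms, of n] by simp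
qed

lemma dip_start_mono:
  assumes "1 \<le> K" "i \<le> j"
  shows "dip_start K i \<le> dip_start K j"
proof (rule lift_Suc_mono_le[OF _ assms(2)])
  show "dip_start K n \<le> dip_start K (Suc n)" for n
    using dip_start_less[OF assms(1), of n] dip_start_ge_2[OF assms(1), of n] by linarith
qed

text \<open>
  Dips of height \<open>1 - 1 / (n + 2)\<close> supported in \<open>[s\<^sub>n, 2 s\<^sub>n]\<close> with \<open>s\<^sub>n = dip_start K n\<close>: slow, and
  separated by plateaus that are exponentially longer than everything before them.
\<close>

definition dips :: "real \<Rightarrow> real \<Rightarrow> real" where
  "dips K x = (\<Sum>n. (1 - 1 / (real n + 2)) * bump (x / dip_start K n))"

text \<open>The intervals carrying the dips are disjoint and locally finite, so near each point at
  most one term of the sum is nonzero. The last clause ties the index to the starts around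
  \<open>x\<close>, which gives access to values at prescribed points.\<close>

lemma dips_local:
  assumes K: "1 \<le> K"
  shows "\<exists>n T. open T \<and> x \<in> T \<and>
    (\<forall>y\<in>T. dips K y = (1 - 1 / (real n + 2)) * bump (y / dip_start K n)) \<and>
    (\<forall>j. dip_start K j \<le> x \<longrightarrow> x < dip_start K (Suc j) \<longrightarrow> n = j)"
proof -
  let ?s = "dip_start K"
  have pos: "0 < ?s n" for n
    using dip_start_ge_2[OF K, of n] by simp
  define n where "n = (LEAST n. x < ?s (Suc n))"
  have "x < ?s (Suc (nat \<lceil>x\<rceil>))"
  proof -
    have "x \<le> real (nat \<lceil>x\<rceil>)"
      by (rule real_nat_ceiling_ge)
    also have "\<dots> < 1 * (real (Suc (nat \<lceil>x\<rceil>)) + 2)"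
      by simp
    also have "\<dots> \<le> K * (real (Suc (nat \<lceil>x\<rceil>)) + 2)"
      using K by (intro mult_right_mono) auto
    also have "\<dots> \<le> ?s (Suc (nat \<lceil>x\<rceil>))"
      by (rule dip_start_ge[OF K])
    finally show ?thesis .
  qed
  then have n: "x < ?s (Suc n)"
    unfolding n_def by (rule LeastI)
  have n': "\<not> x < ?s (Suc j)" if "j < n" for j
    using not_less_Least that unfolding n_def by blast
  \<comment> \<open>The interval reaches from the end of the previous dip to the start of the next
    one, so only dip \<open>n\<close> can be active on it.\<close>
  define T where "T = (if n = 0 then {..<?s 1} else {2 * ?s (n - 1)<..<?s (Suc n)})"
  show ?thesis
  proof (intro exI[of _ n] exI[of _ T] conjI ballI allI impI)
    show "open T"
      by (simp add: T_def)
    show "x \<in> T"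
    proof (cases n)
      case (Suc j)
      then have "?s (Suc j) \<le> x"
        using n'[of j] by (simp del: dip_start.simps add: not_less)
      then have "2 * ?s j < x"
        using dip_start_less[OF K, of j] by linarith
      then show ?thesis
        using n Suc by (simp add: T_def del: dip_start.simps)
    qed (use n in \<open>simp add: T_def del: dip_start.simps\<close>)
    show "n = j" if "?s j \<le> x" "x < ?s (Suc j)" for j
    proof (rule linorder_cases[of n j])
      assume "n < j"
      then have "?s (Suc n) \<le> ?s j"
        by (intro dip_start_mono K) simp
      then show ?thesis
        using n that by linarith
    next
      assume "j < n"
      then show ?thesis
        using n'[of j] that by blast
    qed simp
    fix y assume y: "y \<in> T"
    have "bump (y / ?s j) = 0" if "j \<noteq> n" for j
    proof (cases "j < n")
      case True
      then have "?s j \<le> ?s (n - 1)"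
        by (intro dip_start_mono K) simp
      moreover have "2 * ?s (n - 1) < y"
        using y True by (simp add: T_def)
      ultimately have "2 \<le> y / ?s j"
        using pos[of j] by (simp add: pos_le_divide_eq)
      then show ?thesis
        by (intro bump_eq_0) simp
    next
      case False
      then have "?s (Suc n) \<le> ?s j"
        using that by (intro dip_start_mono K) simp
      moreover have "y < ?s (Suc n)"
        using y by (auto simp: T_def simp del: dip_start.simps split: if_splits)
      ultimately have "y / ?s j \<le> 1"
        using pos[of j] by (simp add: pos_divide_le_eq del: dip_start.simps)
      then show ?thesis
        by (intro bump_eq_0) simp
    qed
    then show "dips K y = (1 - 1 / (real n + 2)) * bump (y / ?s n)"
      unfolding dips_def by (subst suminf_finite[of "{n}"]) auto
  qed
qed

lemma times_differentiable_dips: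
  assumes "1 \<le> K"
  shows "times_differentiable n UNIV (dips K)"
proof (rule times_differentiable_local)
  fix x :: real
  obtain j T where T: "open T" "x \<in> T"
    "\<And>y. y \<in> T \<Longrightarrow> dips K y = (1 - 1 / (real j + 2)) * bump (y / dip_start K j)"
    using dips_local[OF assms, of x] by blast
  have "times_differentiable n T (\<lambda>y. (1 - 1 / (real j + 2)) * bump (y / dip_start K j))"
    using dip_start_ge_2[OF assms, of j]
    by (intro times_differentiable_mult times_differentiable_const
        times_differentiable_compose[OF times_differentiable_bump[of _ UNIV]]
        times_differentiable_divide times_differentiable_ident) auto
  with T show "\<exists>g T. open T \<and> x \<in> T \<and> times_differentiable n T g \<and> (\<forall>y\<in>T. dips K y = g y)"
    by (intro exI[of _ "\<lambda>y. (1 - 1 / (real j + 2)) * bump (y / dip_start K j)"] exI[of _ T]) simp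
qed simp

text \<open>The derivative bounds carry the factor \<open>1 - b x\<close>, the distance from full
  height, because the coefficient later built from \<open>b\<close> is bounded below only on this
  scale. The strict bound \<open>b x < 1\<close> keeps the scale positive although the peaks tend to
  1.\<close>

lemma sparse_dips:
  assumes "0 < \<epsilon>"
  obtains b b1 b2 s :: "_ \<Rightarrow> real" where
    "\<And>n. times_differentiable n UNIV b"
    "\<And>x. (b has_real_derivative b1 x) (at x)" "\<And>x. (b1 has_real_derivative b2 x) (at x)"
    "\<And>x. 0 \<le> b x" "\<And>x. b x < 1"
    "\<And>x. \<bar>b1 x\<bar> \<le> \<epsilon> * (1 - b x)" "\<And>x. \<bar>b2 x\<bar> \<le> \<epsilon> * (1 - b x)" "(b1 \<longlongrightarrow> 0) at_top"
    "\<And>n. b (s n) = 0 \<and> b1 (s n) = 0" "\<And>n. b (3 / 2 * s n) = 1 - 1 / (real n + 2)"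
    "\<And>n x. 2 * s n \<le> x \<Longrightarrow> x \<le> s (Suc n) \<Longrightarrow> b x = 0"
    "\<And>n::nat. real n \<le> s n" "\<And>n. s (Suc n) = 2 * s n + exp (4 * s n)"
proof -
  obtain B1 B2 M where B:
    "\<And>x. (bump has_real_derivative B1 x) (at x)" "\<And>x. (B1 has_real_derivative B2 x) (at x)"
    "\<And>x. \<bar>B1 x\<bar> \<le> M" "\<And>x. \<bar>B2 x\<bar> \<le> M" "\<And>x. x < 1 \<or> 2 < x \<Longrightarrow> B1 x = 0"
    "B1 1 = 0" "1 \<le> M"
    by (rule bump_derivs) (rule that)
  \<comment> \<open>The derivatives of dip \<open>n\<close> are at most \<open>M / s n\<close>, and
    \<open>s n \<ge> K * (n + 2)\<close>. This \<open>K\<close> makes them at most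
    \<open>\<epsilon> / (n + 2)\<close>, that is, \<open>\<epsilon>\<close> times the gap between
    the peak and 1.\<close>
  define K where "K = max 1 (M / \<epsilon>)"
  have K: "1 \<le> K" "M / \<epsilon> \<le> K"
    by (auto simp: K_def)
  define s where "s = dip_start K"
  define c where "c n = 1 - 1 / (real n + 2)" for n
  define b where "b = dips K"
  have s_ge: "K * (real n + 2) \<le> s n" "2 \<le> s n" for n
    using dip_start_ge[OF K(1)] dip_start_ge_2[OF K(1)] by (auto simp: s_def)
  have s_less: "2 * s n < s (Suc n)" for n
    unfolding s_def by (rule dip_start_less[OF K(1)])
  have c: "0 \<le> c n" "c n < 1" "1 - c n = 1 / (real n + 2)" for n
    by (auto simp: c_def)
  have M_s: "M / s n \<le> \<epsilon> * (1 - c n)" for n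
  proof -
    have "M / \<epsilon> * (real n + 2) \<le> s n"
      using s_ge(1)[of n] mult_right_mono[OF K(2), of "real n + 2"] by simp
    then have "M * (real n + 2) \<le> \<epsilon> * s n"
      using assms by (simp add: field_simps)
    then show ?thesis
      unfolding c(3) using s_ge(2)[of n] by (simp add: field_simps)
  qed
  have derivs: "\<exists>n. b x = c n * bump (x / s n) \<and> deriv b x = c n * (B1 (x / s n) / s n) \<and>
      (b has_real_derivative deriv b x) (at x) \<and>
      deriv (deriv b) x = c n * (B2 (x / s n) / s n / s n) \<and>
      (deriv b has_real_derivative deriv (deriv b) x) (at x) \<and> (\<forall>j. s j \<le> x \<longrightarrow> x < s (Suc j) \<longrightarrow> n = j)" for x
  proof -
    obtain n T where T: "open T" "x \<in> T" "\<And>y. y \<in> T \<Longrightarrow> b y = c n * bump (y / s n)"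
      "\<forall>j. s j \<le> x \<longrightarrow> x < s (Suc j) \<longrightarrow> n = j"
      using dips_local[OF K(1), of x] unfolding b_def c_def s_def by blast
    have d1: "(b has_real_derivative c n * (B1 (y / s n) / s n)) (at y)" if "y \<in> T" for y
    proof -
      have "((\<lambda>y. c n * bump (y / s n)) has_real_derivative c n * (B1 (y / s n) * (1 / s n))) (at y)"
        by (intro DERIV_cmult DERIV_chain2[OF B(1)] DERIV_cdivide DERIV_ident)
      then have "((\<lambda>y. c n * bump (y / s n)) has_real_derivative c n * (B1 (y / s n) / s n)) (at y)"
        by simp
      then show ?thesis
        by (rule has_field_derivative_transform_within_open[OF _ T(1) that]) (simp add: T(3))
    qed
    then have eq1: "deriv b y = c n * (B1 (y / s n) / s n)" if "y \<in> T" for y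
      using DERIV_imp_deriv that by blast
    have d2: "(deriv b has_real_derivative c n * (B2 (x / s n) / s n / s n)) (at x)"
    proof -
      have "((\<lambda>y. c n * (B1 (y / s n) / s n)) has_real_derivative c n * (B2 (x / s n) * (1 / s n) / s n)) (at x)"
        by (intro DERIV_cmult DERIV_cdivide DERIV_chain2[OF B(2)] DERIV_ident)
      then have "((\<lambda>y. c n * (B1 (y / s n) / s n)) has_real_derivative c n * (B2 (x / s n) / s n / s n)) (at x)"
        by simp
      then show ?thesis
        by (rule has_field_derivative_transform_within_open[OF _ T(1,2)]) (simp add: eq1)
    qed
    show ?thesis
      using T(4) T(3)[OF T(2)] eq1[OF T(2)] d1[OF T(2)] d2 DERIV_imp_deriv[OF d2]
      by (intro exI[of _ n]) simp
  qed
  have at: "b x = c j * bump (x / s j) \<and> deriv b x = c j * (B1 (x / s j) / s j)"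
    if "s j \<le> x" "x < s (Suc j)" for x j
    using derivs[of x] that by blast
  have bounds: "0 \<le> b x \<and> b x < 1 \<and> \<bar>deriv b x\<bar> \<le> \<epsilon> * (1 - b x) \<and> \<bar>deriv (deriv b) x\<bar> \<le> \<epsilon> * (1 - b x) \<and>
      (0 < x \<longrightarrow> \<bar>deriv b x\<bar> \<le> 2 * M / x)" for x
  proof -
    obtain n where n: "b x = c n * bump (x / s n)" "deriv b x = c n * (B1 (x / s n) / s n)"
      "deriv (deriv b) x = c n * (B2 (x / s n) / s n / s n)"
      using derivs[of x] by blast
    have b: "0 \<le> b x" "b x \<le> c n"
      unfolding n(1) using bump_nonneg bump_le_1 c[of n] by (auto intro: mult_nonneg_nonneg mult_left_le)
    have s: "2 \<le> s n"
      by (rule s_ge(2))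
    have scale: "\<bar>c n * y\<bar> \<le> \<bar>y\<bar>" for y
      using c[of n] mult_left_le_one_le[of "\<bar>y\<bar>" "c n"] by (simp add: abs_mult)
    have "\<bar>deriv b x\<bar> \<le> \<bar>B1 (x / s n)\<bar> / s n"
      unfolding n(2) using scale[of "B1 (x / s n) / s n"] s by simp
    also have "\<dots> \<le> M / s n"
      using B(3) s by (intro divide_right_mono) auto
    finally have d1: "\<bar>deriv b x\<bar> \<le> M / s n" .
    have "\<bar>deriv (deriv b) x\<bar> \<le> \<bar>B2 (x / s n)\<bar> / s n / s n"
      unfolding n(3) using scale[of "B2 (x / s n) / s n / s n"] s by simp
    also have "\<dots> \<le> \<bar>B2 (x / s n)\<bar> / s n / 1"
      using s by (intro divide_left_mono) auto
    also have "\<dots> \<le> M / s n"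
      using B(4) s by (simp add: divide_right_mono)
    finally have d2: "\<bar>deriv (deriv b) x\<bar> \<le> M / s n" .
    have le: "M / s n \<le> \<epsilon> * (1 - b x)"
      using M_s[of n] b(2) assms by (smt (verit) mult_left_mono)
    \<comment> \<open>The derivative vanishes where \<open>x > 2 * s n\<close>, so the bound
      \<open>M / s n\<close> is also a bound by \<open>2 * M / x\<close>, which decays at
      infinity.\<close>
    have "\<bar>deriv b x\<bar> \<le> 2 * M / x" if "0 < x"
    proof (cases "2 < x / s n")
      case True
      then have "deriv b x = 0"
        unfolding n(2) using B(5) by simp
      then show ?thesis
        using that B(7) by simp
    next
      case False
      then have "M / s n \<le> 2 * M / x"
        using that s B(7) by (simp add: field_simps)
      with d1 show ?thesis
        by simp
    qed
    then show ?thesis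
      using b c(2)[of n] d1 d2 le by auto
  qed
  show thesis
  proof (rule that[of b "deriv b" "deriv (deriv b)" s])
    show "times_differentiable n UNIV b" for n
      unfolding b_def by (rule times_differentiable_dips[OF K(1)])
    show "(b has_real_derivative deriv b x) (at x)" "(deriv b has_real_derivative deriv (deriv b) x) (at x)" for x
      using derivs[of x] by blast+
    show "0 \<le> b x" "b x < 1" "\<bar>deriv b x\<bar> \<le> \<epsilon> * (1 - b x)" "\<bar>deriv (deriv b) x\<bar> \<le> \<epsilon> * (1 - b x)" for x
      using bounds[of x] by blast+
    show "(deriv b \<longlongrightarrow> 0) at_top"
    proof (rule tendsto_rabs_zero_cancel, rule tendsto_sandwich[OF _ _ tendsto_const])
      have "((\<lambda>x. 2 * M / x) \<longlongrightarrow> 0) at_top"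
        by (intro tendsto_divide_0[OF tendsto_const] filterlim_at_top_imp_at_infinity filterlim_ident)
      then show "((\<lambda>x. 2 * M / x) \<longlongrightarrow> 0) at_top" .
      show "\<forall>\<^sub>F x in at_top. \<bar>deriv b x\<bar> \<le> 2 * M / x"
        using eventually_gt_at_top[of 0] by eventually_elim (use bounds in blast)
    qed simp
    have pos: "0 < s n" for n
      using s_ge(2)[of n] by simp
    show zero: "b (s n) = 0 \<and> deriv b (s n) = 0" for n
      using at[of n "s n"] s_less[of n] pos[of n] bump_eq_0[of 1] B(6) by auto
    show "b (3 / 2 * s n) = 1 - 1 / (real n + 2)" for n
      using at[of n "3 / 2 * s n"] s_less[of n] pos[of n] bump_half by (auto simp: c_def)
    show "b x = 0" if "2 * s n \<le> x" "x \<le> s (Suc n)" for n x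
    proof (cases "x = s (Suc n)")
      case False
      then have "b x = c n * bump (x / s n)"
        using at[of n x] that pos[of n] by auto
      moreover have "2 \<le> x / s n"
        using that pos[of n] by (simp add: pos_le_divide_eq)
      ultimately show ?thesis
        using bump_eq_0 by simp
    qed (use zero in simp)
    show "real n \<le> s n" for n
    proof -
      have "real n \<le> 1 * (real n + 2)"
        by simp
      also have "\<dots> \<le> K * (real n + 2)"
        using K(1) by (intro mult_right_mono) auto
      also have "\<dots> \<le> s n"
        by (rule s_ge(1))
      finally show ?thesis .
    qed
    show "s (Suc n) = 2 * s n + exp (4 * s n)" for n
      by (simp add: s_def)
  qed
qed

subsection \<open>The radial Green operator\<close>

lemma eventually_in_unit_interval: "\<forall>\<^sub>F r::real in at_right 0. 0 < r \<and> r < 1"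
  by (auto simp: eventually_at_right_field intro!: exI[of _ 1])

text \<open>Up to the area of the unit sphere, the total source inside the ball of radius
  \<open>r\<close> in dimension \<open>k + 1\<close>. By the divergence theorem it is
  \<open>- r ^ k * y'\<close> for a regular radial solution of
  \<open>-\<Delta>y = h\<close>.\<close>

definition flux :: "nat \<Rightarrow> (real \<Rightarrow> real) \<Rightarrow> real \<Rightarrow> real" where
  "flux k h r = integral {0..r} (\<lambda>t. t ^ k * h t)"

definition green :: "nat \<Rightarrow> (real \<Rightarrow> real) \<Rightarrow> real \<Rightarrow> real" where
  "green k h r = integral {r..1} (\<lambda>t. flux k h t / t ^ k)"

text \<open>First-order form of the radial equation \<open>-\<Delta>y = h\<close> with flux
  \<open>z\<close>. The function \<open>y\<close> may blow up at 0, while the vanishing flux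
  excludes a point mass there. The boundary value at 1 is left free, so that supersolutions are
  covered too.\<close>

definition radial_pair :: "nat \<Rightarrow> (real \<Rightarrow> real) \<Rightarrow> (real \<Rightarrow> real) \<Rightarrow> (real \<Rightarrow> real) \<Rightarrow> bool" where
  "radial_pair k h y z \<longleftrightarrow> continuous_on {0<..1} y \<and>
     (\<forall>r\<in>{0<..<1}. (y has_real_derivative - (z r / r ^ k)) (at r) \<and>
        (z has_real_derivative r ^ k * h r) (at r)) \<and>
     (z \<longlongrightarrow> 0) (at_right 0)"

lemma radial_pairD:
  assumes "radial_pair k h y z"
  shows "continuous_on {0<..1} y" "(z \<longlongrightarrow> 0) (at_right 0)"
    and "\<And>r. 0 < r \<Longrightarrow> r < 1 \<Longrightarrow> (y has_real_derivative - (z r / r ^ k)) (at r)"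
    and "\<And>r. 0 < r \<Longrightarrow> r < 1 \<Longrightarrow> (z has_real_derivative r ^ k * h r) (at r)"
  using assms by (auto simp: radial_pair_def)

lemma nonneg_if_tendsto_0_and_deriv_nonneg:
  fixes z :: "real \<Rightarrow> real"
  assumes "(z \<longlongrightarrow> 0) (at_right 0)"
    and "\<And>r. 0 < r \<Longrightarrow> r < b \<Longrightarrow> (z has_real_derivative z' r) (at r)"
    and "\<And>r. 0 < r \<Longrightarrow> r < b \<Longrightarrow> 0 \<le> z' r"
    and "0 < r" "r < b"
  shows "0 \<le> z r"
proof (rule tendsto_upperbound[OF assms(1)])
  have "z s \<le> z r" if "0 < s" "s < r" for s
  proof (rule DERIV_nonneg_imp_nondecreasing[of s r z])
    fix x assume "s \<le> x" "x \<le> r"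
    then show "\<exists>y. (z has_real_derivative y) (at x) \<and> 0 \<le> y"
      using assms(2,3)[of x] \<open>0 < s\<close> \<open>r < b\<close> by (intro exI[of _ "z' x"]) simp
  qed (use that in simp)
  then show "\<forall>\<^sub>F s in at_right 0. z s \<le> z r"
    using assms(4) eventually_at_right_less by (auto simp: eventually_at_right_field)
qed simp

lemma nonincreasing_if_deriv_nonpos:
  fixes y :: "real \<Rightarrow> real"
  assumes "continuous_on {0<..1} y"
    and "\<And>r. 0 < r \<Longrightarrow> r < 1 \<Longrightarrow> (y has_real_derivative y' r) (at r)"
    and "\<And>r. 0 < r \<Longrightarrow> r < 1 \<Longrightarrow> y' r \<le> 0"
    and "0 < r" "r \<le> s" "s \<le> 1"
  shows "y s \<le> y r"
proof (rule DERIV_nonpos_imp_decreasing_open[of r s y])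
  fix x assume "r < x" "x < s"
  then show "\<exists>d. (y has_real_derivative d) (at x) \<and> d \<le> 0"
    using assms(2,3)[of x] assms(4,6) by (intro exI[of _ "y' x"]) simp
next
  show "continuous_on {r..s} y"
    by (rule continuous_on_subset[OF assms(1)]) (use assms in auto)
qed (use assms in simp)

lemma radial_pair_flux_nonneg:
  assumes "radial_pair k h y z" "\<And>r. 0 < r \<Longrightarrow> r < 1 \<Longrightarrow> 0 \<le> h r" "0 < r" "r < 1"
  shows "0 \<le> z r"
  by (rule nonneg_if_tendsto_0_and_deriv_nonneg[of z 1 "\<lambda>r. r ^ k * h r"])
     (use assms radial_pairD[OF assms(1)] in auto)

lemma radial_pair_nonincreasing:
  assumes "radial_pair k h y z" "\<And>r. 0 < r \<Longrightarrow> r < 1 \<Longrightarrow> 0 \<le> h r" "0 < r" "r \<le> s" "s \<le> 1"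
  shows "y s \<le> y r"
  by (rule nonincreasing_if_deriv_nonpos[of y "\<lambda>r. - (z r / r ^ k)"])
     (use assms radial_pair_flux_nonneg[OF assms(1,2)] radial_pairD[OF assms(1)] in auto)

lemma radial_pair_diff:
  assumes "radial_pair k h1 y1 z1" "radial_pair k h2 y2 z2"
  shows "radial_pair k (\<lambda>r. h2 r - h1 r) (\<lambda>r. y2 r - y1 r) (\<lambda>r. z2 r - z1 r)"
  unfolding radial_pair_def
proof (intro conjI ballI)
  fix r :: real
  assume r: "r \<in> {0<..<1}"
  show "((\<lambda>r. y2 r - y1 r) has_real_derivative - ((z2 r - z1 r) / r ^ k)) (at r)"
    using DERIV_diff[OF radial_pairD(3)[OF assms(2)] radial_pairD(3)[OF assms(1)], of r] r
    by (simp add: diff_divide_distrib)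
  show "((\<lambda>r. z2 r - z1 r) has_real_derivative r ^ k * (h2 r - h1 r)) (at r)"
    using DERIV_diff[OF radial_pairD(4)[OF assms(2)] radial_pairD(4)[OF assms(1)], of r] r
    by (simp add: algebra_simps)
next
  show "((\<lambda>r. z2 r - z1 r) \<longlongrightarrow> 0) (at_right 0)"
    using tendsto_diff[OF radial_pairD(2)[OF assms(2)] radial_pairD(2)[OF assms(1)]] by simp
qed (rule continuous_on_diff[OF radial_pairD(1)[OF assms(2)] radial_pairD(1)[OF assms(1)]])

text \<open>A nonnegative source forces a nonnegative flux, so \<open>y2 - y1\<close> is
  nonincreasing in \<open>r\<close> and smallest at the boundary. Functions singular at 0 are
  included, which allows comparison with the singular solution.\<close>

lemma radial_pair_le:
  assumes "radial_pair k h1 y1 z1" "radial_pair k h2 y2 z2"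
    and "\<And>r. 0 < r \<Longrightarrow> r < 1 \<Longrightarrow> h1 r \<le> h2 r" "y1 1 \<le> y2 1" "0 < r" "r \<le> 1"
  shows "y1 r \<le> y2 r"
  using radial_pair_nonincreasing[OF radial_pair_diff[OF assms(1,2)], of r 1] assms by auto

lemma flux_integrand_continuous:
  "continuous_on {0..1} h \<Longrightarrow> continuous_on {0..1} (\<lambda>t::real. t ^ k * h t)" for h :: "real \<Rightarrow> real"
  by (intro continuous_intros)

lemma flux_has_derivative:
  assumes "continuous_on {0..1} h" "0 < r" "r < 1"
  shows "(flux k h has_real_derivative r ^ k * h r) (at r)"
  using integral_has_real_derivative[OF flux_integrand_continuous[OF assms(1)], of r k] assms
  by (simp add: flux_def[abs_def] at_within_Icc_at)

lemma continuous_on_flux: "continuous_on {0..1} h \<Longrightarrow> continuous_on {0..1} (flux k h)"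
  unfolding flux_def[abs_def]
  by (intro indefinite_integral_continuous_1 integrable_continuous_interval flux_integrand_continuous)

lemma flux_bound:
  assumes h: "continuous_on {0..1} h" and M: "\<And>t. t \<in> {0..1} \<Longrightarrow> \<bar>h t\<bar> \<le> M" and "0 \<le> r" "r \<le> 1"
  shows "\<bar>flux k h r\<bar> \<le> M * r ^ Suc k"
proof -
  have "0 \<le> M"
    using M[of 0] by force
  have "norm (integral {0..r} (\<lambda>t. t ^ k * h t)) \<le> (M * r ^ k) * (r - 0)"
  proof (rule integral_bound)
    show "continuous_on {0..r} (\<lambda>t. t ^ k * h t)"
      by (rule continuous_on_subset[OF flux_integrand_continuous[OF h]]) (use assms in auto)
    fix t assume t: "t \<in> {0..r}"
    then have "t ^ k * \<bar>h t\<bar> \<le> r ^ k * M"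
      using assms M[of t] \<open>0 \<le> M\<close> by (intro mult_mono power_mono) auto
    then show "norm (t ^ k * h t) \<le> M * r ^ k"
      using t by (simp add: abs_mult mult_ac)
  qed (use assms in auto)
  then show ?thesis
    by (simp add: flux_def mult_ac)
qed

lemma continuous_on_Icc_bounded:
  fixes h :: "real \<Rightarrow> real"
  assumes "continuous_on {a..b} h"
  obtains M where "\<And>t. t \<in> {a..b} \<Longrightarrow> \<bar>h t\<bar> \<le> M" "0 < M"
proof -
  have "bounded (h ` {a..b})"
    using assms by (intro compact_imp_bounded compact_continuous_image) auto
  then obtain M where "\<forall>x\<in>h ` {a..b}. \<bar>x\<bar> \<le> M"
    unfolding bounded_iff by auto
  then show thesis
    by (intro that[of "max M 1"]) (auto simp: le_max_iff_disj)
qed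

lemma abs_flux_quotient_le:
  assumes h: "continuous_on {0..1} h" and M: "\<And>t. t \<in> {0..1} \<Longrightarrow> \<bar>h t\<bar> \<le> M" and "0 < r" "r \<le> 1"
  shows "\<bar>flux k h r / r ^ k\<bar> \<le> M * r"
proof -
  have "\<bar>flux k h r\<bar> \<le> M * r ^ Suc k"
    by (rule flux_bound[OF h M]) (use assms(3,4) in auto)
  then have "\<bar>flux k h r\<bar> / r ^ k \<le> M * r"
    using assms(3) by (simp add: pos_divide_le_eq)
  then show ?thesis
    using assms(3) by simp
qed

text \<open>The flux is 0 at 0, so the quotient has the value 0 there; the bound
  \<open>M * t\<close> shows that this is also its limit.\<close>

lemma continuous_on_flux_quotient:
  assumes h: "continuous_on {0..1} h"
  shows "continuous_on {0..1} (\<lambda>t. flux k h t / t ^ k)"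
proof -
  obtain M where M: "\<And>t. t \<in> {0..1} \<Longrightarrow> \<bar>h t\<bar> \<le> M" "0 < M"
    using continuous_on_Icc_bounded[OF h] by blast
  have b: "\<bar>flux k h t / t ^ k\<bar> \<le> M * t" if "t \<in> {0..1}" for t
  proof (cases "t = 0")
    case True
    then show ?thesis
      by (simp add: flux_def)
  next
    case False
    then show ?thesis
      using that by (intro abs_flux_quotient_le[OF h M(1)]) auto
  qed
  show ?thesis
    unfolding continuous_on_eq_continuous_within
  proof
    fix t :: real
    assume t: "t \<in> {0..1}"
    show "continuous (at t within {0..1}) (\<lambda>t. flux k h t / t ^ k)"
    proof (cases "t = 0")
      case True
      have "((\<lambda>t. flux k h t / t ^ k) \<longlongrightarrow> 0) (at 0 within {0..1})"
      proof (rule tendsto_0_le[where f = "\<lambda>t. t" and K = M])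
        show "\<forall>\<^sub>F t in at 0 within {0..1}. norm (flux k h t / t ^ k) \<le> norm t * M"
          using b by (auto simp: eventually_at_filter mult_ac intro!: always_eventually)
      qed (simp add: tendsto_ident_at)
      with True show ?thesis
        by (simp add: continuous_within flux_def)
    next
      case False
      then show ?thesis
        using continuous_on_flux[OF h, of k] t unfolding continuous_within continuous_on_def
        by (intro tendsto_divide tendsto_power tendsto_ident_at) auto
    qed
  qed
qed

lemma continuous_on_green: "continuous_on {0..1} h \<Longrightarrow> continuous_on {0..1} (green k h)"
  unfolding green_def[abs_def]
  by (intro indefinite_integral_continuous_1' integrable_continuous_interval continuous_on_flux_quotient)

lemma green_has_derivative:
  assumes "continuous_on {0..1} h" "0 < r" "r < 1"
  shows "(green k h has_real_derivative - (flux k h r / r ^ k)) (at r)"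
  using integral_has_real_derivative'[OF continuous_on_flux_quotient[OF assms(1)], of r k] assms
  by (simp add: green_def[abs_def] at_within_Icc_at)

lemma green_1: "green k h 1 = 0"
  by (simp add: green_def)

lemma flux_tendsto_0:
  assumes "continuous_on {0..1} h"
  shows "(flux k h \<longlongrightarrow> 0) (at_right 0)"
proof -
  have "(flux k h \<longlongrightarrow> flux k h 0) (at 0 within {0..1})"
    using continuous_on_flux[OF assms, of k] by (auto simp: continuous_on_def)
  then show ?thesis
    by (simp add: flux_def at_within_Icc_at_right)
qed

lemma radial_pair_green:
  assumes "continuous_on {0..1} h"
  shows "radial_pair k h (green k h) (flux k h)"
  unfolding radial_pair_def
  using green_has_derivative[OF assms] flux_has_derivative[OF assms] flux_tendsto_0[OF assms]
    continuous_on_subset[OF continuous_on_green[OF assms], of "{0<..1}"] by (auto simp: subset_iff)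

lemma flux_mono:
  assumes "continuous_on {0..1} h1" "continuous_on {0..1} h2" "\<And>t. t \<in> {0..1} \<Longrightarrow> h1 t \<le> h2 t"
    and "r \<in> {0..1}"
  shows "flux k h1 r \<le> flux k h2 r"
  unfolding flux_def using assms
  by (intro integral_le integrable_continuous_interval mult_left_mono)
     (auto intro: continuous_on_subset[OF flux_integrand_continuous])

lemma green_mono:
  assumes "continuous_on {0..1} h1" "continuous_on {0..1} h2" "\<And>t. t \<in> {0..1} \<Longrightarrow> h1 t \<le> h2 t"
    and "r \<in> {0..1}"
  shows "green k h1 r \<le> green k h2 r"
  unfolding green_def using assms
  by (intro integral_le integrable_continuous_interval divide_right_mono flux_mono)
     (auto intro: continuous_on_subset[OF continuous_on_flux_quotient])

lemma green_0: "green k (\<lambda>r. 0) r = 0"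
  by (simp add: green_def flux_def)

lemma green_nonneg:
  assumes "continuous_on {0..1} h" "\<And>t. t \<in> {0..1} \<Longrightarrow> 0 \<le> h t" "r \<in> {0..1}"
  shows "0 \<le> green k h r"
  using green_mono[of "\<lambda>r. 0" h r k] assms by (simp add: green_0)

lemma green_antimono:
  assumes h: "continuous_on {0..1} h" "\<And>t. t \<in> {0..1} \<Longrightarrow> 0 \<le> h t" and "0 \<le> r" "r \<le> s" "s \<le> 1"
  shows "green k h s \<le> green k h r"
proof (rule DERIV_nonpos_imp_decreasing_open[of r s "green k h"])
  fix x assume "r < x" "x < s"
  moreover from this have "0 \<le> flux k h x"
    using radial_pair_flux_nonneg[OF radial_pair_green[OF h(1)], of x] assms by auto
  ultimately show "\<exists>y. (green k h has_real_derivative y) (at x) \<and> y \<le> 0"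
    using green_has_derivative[OF h(1), of x k] assms by (auto intro!: exI)
qed (use assms in \<open>auto intro: continuous_on_subset[OF continuous_on_green]\<close>)

lemma green_le:
  assumes h: "continuous_on {0..1} h" and M: "\<And>t. t \<in> {0..1} \<Longrightarrow> \<bar>h t\<bar> \<le> M" and "r \<in> {0..1}"
  shows "\<bar>green k h r\<bar> \<le> M * (1 - r)"
proof -
  have "0 \<le> M"
    using M[of 0] by force
  have "norm (integral {r..1} (\<lambda>t. flux k h t / t ^ k)) \<le> M * (1 - r)"
  proof (rule integral_bound)
    fix t assume t: "t \<in> {r..1}"
    have "\<bar>flux k h t / t ^ k\<bar> \<le> M * t"
    proof (cases "t = 0")
      case False
      then show ?thesis
        using t assms(3) by (intro abs_flux_quotient_le[OF h M]) auto
    qed (simp add: flux_def)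
    also have "\<dots> \<le> M * 1"
      using t \<open>0 \<le> M\<close> by (intro mult_left_mono) auto
    finally show "norm (flux k h t / t ^ k) \<le> M"
      by simp
  qed (use assms in \<open>auto intro: continuous_on_subset[OF continuous_on_flux_quotient]\<close>)
  then show ?thesis
    by (simp add: green_def)
qed

text \<open>Comparison in both directions. The vanishing flux replaces boundedness at 0, so a
  possibly singular candidate with a continuous source turns out to be regular.\<close>

lemma green_eq_if_radial_pair:
  assumes "continuous_on {0..1} h" "radial_pair k h y z" "y 1 = 0" "0 < r" "r \<le> 1"
  shows "y r = green k h r"
  using radial_pair_le[OF assms(2) radial_pair_green[OF assms(1)], of r]
    radial_pair_le[OF radial_pair_green[OF assms(1)] assms(2), of r] assms green_1[of k h]
  by (intro antisym) auto

lemma flux_quotient_limit: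
  assumes "continuous_on {0..1} h"
  shows "((\<lambda>r. flux k h r / r ^ Suc k) \<longlongrightarrow> h 0 / Suc k) (at_right 0)"
proof (rule lhopital_right_0[where ?f0.0 = "flux k h" and ?g0.0 = "\<lambda>r. r ^ Suc k"
      and f' = "\<lambda>r. r ^ k * h r" and g' = "\<lambda>r. real (Suc k) * r ^ k"])
  have ev: "\<forall>\<^sub>F r::real in at_right 0. 0 < r \<and> r < 1"
    by (rule eventually_in_unit_interval)
  show "(flux k h \<longlongrightarrow> 0) (at_right 0)"
    by (rule flux_tendsto_0[OF assms])
  have "((\<lambda>r::real. r ^ Suc k) \<longlongrightarrow> 0 ^ Suc k) (at_right 0)"
    by (intro tendsto_intros)
  then show "((\<lambda>r::real. r ^ Suc k) \<longlongrightarrow> 0) (at_right 0)"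
    by simp
  show "\<forall>\<^sub>F r::real in at_right 0. r ^ Suc k \<noteq> 0" "\<forall>\<^sub>F r::real in at_right 0. real (Suc k) * r ^ k \<noteq> 0"
    using ev by (eventually_elim; simp)+
  show "\<forall>\<^sub>F r in at_right 0. (flux k h has_real_derivative r ^ k * h r) (at r)"
    using ev by eventually_elim (use flux_has_derivative[OF assms] in auto)
  show "\<forall>\<^sub>F r::real in at_right 0. ((\<lambda>r. r ^ Suc k) has_real_derivative real (Suc k) * r ^ k) (at r)"
    using DERIV_pow[of "Suc k"] by (auto intro!: always_eventually)
  have "(h \<longlongrightarrow> h 0) (at 0 within {0..1})"
    using assms by (auto simp: continuous_on_def)
  then have "((\<lambda>r. h r / Suc k) \<longlongrightarrow> h 0 / Suc k) (at_right 0)"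
    by (intro tendsto_intros) (simp_all add: at_within_Icc_at_right)
  then show "((\<lambda>r. r ^ k * h r / (real (Suc k) * r ^ k)) \<longlongrightarrow> h 0 / Suc k) (at_right 0)"
    by (rule Lim_transform_eventually) (use ev in eventually_elim, simp)
qed

subsection \<open>Monotone iteration\<close>

text \<open>Here \<open>k + 1\<close> is the dimension. Working on \<open>{A<..}\<close> with
  \<open>A < 0\<close> makes all derivatives at nonnegative arguments two-sided; monotonicity of
  \<open>f1\<close> expresses convexity.\<close>

locale radial_problem =
  fixes k :: nat and f f1 :: "real \<Rightarrow> real" and A :: real
  assumes k_pos: "0 < k" and A_neg: "A < 0"
    and f_has_derivative: "A < t \<Longrightarrow> (f has_real_derivative f1 t) (at t)"
    and f1_mono: "A < s \<Longrightarrow> s \<le> t \<Longrightarrow> f1 s \<le> f1 t"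
    and f1_nonneg: "A < t \<Longrightarrow> 0 \<le> f1 t"
    and continuous_on_f1: "continuous_on {A<..} f1"
    and f_pos: "A < t \<Longrightarrow> 0 < f t"
begin

lemma continuous_on_f: "continuous_on {A<..} f"
  by (auto intro!: continuous_at_imp_continuous_on DERIV_isCont f_has_derivative)

lemma f_mono: "0 \<le> s \<Longrightarrow> s \<le> t \<Longrightarrow> f s \<le> f t"
proof (rule DERIV_nonneg_imp_nondecreasing[of s t f])
  fix x assume "0 \<le> s" "s \<le> x"
  then show "\<exists>y. (f has_real_derivative y) (at x) \<and> 0 \<le> y"
    using A_neg by (intro exI[of _ "f1 x"] conjI f_has_derivative f1_nonneg) auto
qed

lemma f_convex: "A < s \<Longrightarrow> A < t \<Longrightarrow> f s + f1 s * (t - s) \<le> f t"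
proof (cases s t rule: linorder_cases)
  case less
  assume "A < s"
  with less obtain c where c: "s < c" "c < t" "f t - f s = (t - s) * f1 c"
    using MVT2[of s t f f1] f_has_derivative by auto
  then show ?thesis
    using f1_mono[of s c] \<open>A < s\<close> mult_left_mono[of "f1 s" "f1 c" "t - s"] by (simp add: algebra_simps)
next
  case greater
  assume "A < t"
  with greater obtain c where c: "t < c" "c < s" "f s - f t = (s - t) * f1 c"
    using MVT2[of t s f f1] f_has_derivative by auto
  then show ?thesis
    using f1_mono[of c s] \<open>A < t\<close> mult_left_mono[of "f1 c" "f1 s" "s - t"] by (simp add: algebra_simps)
qed simp

lemma continuous_on_f_compose:
  assumes "continuous_on S u" "\<And>r. r \<in> S \<Longrightarrow> 0 \<le> u r"
  shows "continuous_on S (\<lambda>r. f (u r))"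
  by (rule continuous_on_compose2[OF continuous_on_f assms(1)]) (use assms(2) A_neg in force)

lemma continuous_on_f1_compose:
  assumes "continuous_on S u" "\<And>r. r \<in> S \<Longrightarrow> 0 \<le> u r"
  shows "continuous_on S (\<lambda>r. f1 (u r))"
  by (rule continuous_on_compose2[OF continuous_on_f1 assms(1)]) (use assms(2) A_neg in force)

primrec iter :: "real \<Rightarrow> nat \<Rightarrow> real \<Rightarrow> real" where
  "iter a 0 = (\<lambda>r. 0)"
| "iter a (Suc n) = green k (\<lambda>r. a * f (iter a n r))"

context
  fixes a :: real
  assumes a: "0 \<le> a"
begin

lemma iter_continuous_nonneg:
  "continuous_on {0..1} (iter a n) \<and> (\<forall>r\<in>{0..1}. 0 \<le> iter a n r)"
proof (induction n)
  case (Suc n)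
  then have "continuous_on {0..1} (\<lambda>r. a * f (iter a n r))"
    by (intro continuous_on_mult continuous_on_const continuous_on_f_compose) auto
  moreover have "0 \<le> a * f (iter a n r)" if "r \<in> {0..1}" for r
  proof -
    have "0 \<le> iter a n r"
      using Suc that by blast
    then have "0 < f (iter a n r)"
      using A_neg by (intro f_pos) simp
    with a show ?thesis
      by simp
  qed
  ultimately show ?case
    using continuous_on_green green_nonneg by simp
qed simp

lemma iter_continuous: "continuous_on {0..1} (iter a n)"
  using iter_continuous_nonneg by blast

lemma iter_nonneg: "r \<in> {0..1} \<Longrightarrow> 0 \<le> iter a n r"
  using iter_continuous_nonneg by blast

lemma iter_source_continuous: "continuous_on {0..1} (\<lambda>r. a * f (iter a n r))"
  by (intro continuous_on_mult continuous_on_const continuous_on_f_compose iter_continuous iter_nonneg)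

lemma iter_source_nonneg: "r \<in> {0..1} \<Longrightarrow> 0 \<le> a * f (iter a n r)"
  using f_pos[of "iter a n r"] iter_nonneg[of r n] A_neg a by force

lemma iter_le_Suc: "r \<in> {0..1} \<Longrightarrow> iter a n r \<le> iter a (Suc n) r"
proof (induction n arbitrary: r)
  case 0
  then show ?case
    using iter_nonneg[of r 1] by simp
next
  case (Suc n)
  show ?case
    unfolding iter.simps
    by (intro green_mono iter_source_continuous[of "Suc n", unfolded iter.simps] iter_source_continuous
        mult_left_mono f_mono a Suc.prems Suc.IH[unfolded iter.simps] iter_nonneg)
qed

lemma iter_incseq: "r \<in> {0..1} \<Longrightarrow> incseq (\<lambda>n. iter a n r)"
  by (intro incseq_SucI iter_le_Suc)

lemma iter_antimono: "0 \<le> r \<Longrightarrow> r \<le> s \<Longrightarrow> s \<le> 1 \<Longrightarrow> iter a n s \<le> iter a n r"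
  by (cases n) (use green_antimono[OF iter_source_continuous iter_source_nonneg] in auto)

lemma iter_1: "iter a n 1 = 0"
  by (cases n) (simp_all add: green_1)

lemma iter_Suc_radial_pair:
  "radial_pair k (\<lambda>r. a * f (iter a n r)) (iter a (Suc n)) (flux k (\<lambda>r. a * f (iter a n r)))"
  unfolding iter.simps by (intro radial_pair_green iter_source_continuous)

text \<open>Monotonicity of \<open>f\<close> carries the bound through each Green step. The
  supersolution may be singular at 0.\<close>

lemma iter_le_supersolution:
  assumes v: "radial_pair k h v z" "\<And>r. 0 < r \<Longrightarrow> r < 1 \<Longrightarrow> a * f (v r) \<le> h r"
    and nonneg: "\<And>r. 0 < r \<Longrightarrow> r \<le> 1 \<Longrightarrow> 0 \<le> v r" and r: "0 < r" "r \<le> 1"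
  shows "iter a n r \<le> v r"
  using r
proof (induction n arbitrary: r)
  case 0
  then show ?case
    using nonneg by simp
next
  case (Suc n)
  show ?case
  proof (rule radial_pair_le[OF iter_Suc_radial_pair v(1) _ _ Suc.prems])
    fix r :: real assume "0 < r" "r < 1"
    then have "a * f (iter a n r) \<le> a * f (v r)"
      using Suc.IH[of r] a by (intro mult_left_mono f_mono iter_nonneg) auto
    with v(2)[of r] \<open>0 < r\<close> \<open>r < 1\<close> show "a * f (iter a n r) \<le> h r"
      by simp
  qed (use nonneg[of 1] in \<open>simp only: iter_1\<close>)
qed

end

lemma iter_mono_parameter:
  assumes "0 \<le> a" "a \<le> b" "r \<in> {0..1}"
  shows "iter a n r \<le> iter b n r"
  using assms(3)
proof (induction n arbitrary: r)
  case (Suc n)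
  have "a * f (iter a n t) \<le> b * f (iter b n t)" if "t \<in> {0..1}" for t
    using assms Suc.IH[OF that] that iter_nonneg[of a t n] f_pos[of "iter a n t"] A_neg
    by (intro mult_mono f_mono) auto
  then show ?case
    unfolding iter.simps
    using assms Suc.prems by (intro green_mono iter_source_continuous) auto
qed simp

text \<open>Meaningful at \<open>r\<close> only if the iterates stay bounded there.\<close>

definition lim_iter :: "real \<Rightarrow> real \<Rightarrow> real" where
  "lim_iter a r = (SUP n. iter a n r)"

lemma lim_iter_1: "0 \<le> a \<Longrightarrow> lim_iter a 1 = 0"
  by (simp add: lim_iter_def iter_1)

context
  fixes a :: real
  assumes a: "0 \<le> a"
    and bounded: "\<And>r. 0 < r \<Longrightarrow> r \<le> 1 \<Longrightarrow> \<exists>B. \<forall>n. iter a n r \<le> B"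
begin

lemma iter_bdd_above: "0 < r \<Longrightarrow> r \<le> 1 \<Longrightarrow> bdd_above (range (\<lambda>n. iter a n r))"
  using bounded[of r] by (auto simp: bdd_above_def)

lemma iter_tendsto: "0 < r \<Longrightarrow> r \<le> 1 \<Longrightarrow> (\<lambda>n. iter a n r) \<longlonglongrightarrow> lim_iter a r"
  unfolding lim_iter_def by (intro LIMSEQ_incseq_SUP iter_bdd_above iter_incseq a) auto

lemma iter_le_lim_iter: "0 < r \<Longrightarrow> r \<le> 1 \<Longrightarrow> iter a n r \<le> lim_iter a r"
  unfolding lim_iter_def by (intro cSUP_upper iter_bdd_above) auto

lemma lim_iter_nonneg: "0 < r \<Longrightarrow> r \<le> 1 \<Longrightarrow> 0 \<le> lim_iter a r"
  using iter_le_lim_iter[of r 0] by simp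

text \<open>The fluxes turn out to be bounded uniformly on the whole interval, so monotone
  convergence applies to them down to 0. The limit source is then integrable at the origin, which
  makes the limit flux vanish there.\<close>

lemma lim_iter_radial_pair: "\<exists>z. radial_pair k (\<lambda>r. a * f (lim_iter a r)) (lim_iter a) z"
proof -
  define g where "g n t = t ^ k * (a * f (iter a n t))" for n t
  define g\<^sub>0 where "g\<^sub>0 t = t ^ k * (a * f (lim_iter a t))" for t
  define F where "F n = flux k (\<lambda>r. a * f (iter a n r))" for n
  have g_cont: "continuous_on {0..1} (g n)" for n
    unfolding g_def by (intro flux_integrand_continuous iter_source_continuous a)
  have g_nonneg: "0 \<le> g n t" if "t \<in> {0..1}" for n t
    unfolding g_def using that by (intro mult_nonneg_nonneg[OF _ iter_source_nonneg[OF a]]) auto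
  have F: "F n r = integral {0..r} (g n)" for n r
    by (simp add: F_def flux_def g_def[abs_def])
  have g_int: "g n integrable_on {c..d}" if "0 \<le> c" "d \<le> 1" for n c d
    by (rule integrable_continuous_interval, rule continuous_on_subset[OF g_cont]) (use that in auto)
  have F_mono: "F n r \<le> F n s" if "0 \<le> r" "r \<le> s" "s \<le> 1" for n r s
    unfolding F using that by (intro integral_subset_le g_int) (auto intro!: g_nonneg)
  have F_nonneg: "0 \<le> F n r" if "0 \<le> r" "r \<le> 1" for n r
    using F_mono[of 0 r n] that by (simp add: F)
  have quot_cont: "continuous_on {0..1} (\<lambda>t. F n t / t ^ k)" for n
    unfolding F_def by (intro continuous_on_flux_quotient iter_source_continuous a)
  have iter_Suc: "iter a (Suc n) r = integral {r..1} (\<lambda>t. F n t / t ^ k)" for n r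
    by (simp add: green_def F_def)
  \<comment> \<open>The radius 1/2 is arbitrary. The Green formula turns a bound on the next iterate
    there into a bound on the flux at 1/2; from 1/2 to 1 the iterates are at most \<open>B\<close>
    since they decrease in \<open>r\<close>, which bounds the rest of the flux.\<close>
  obtain B where B: "\<And>n. iter a n (1/2) \<le> B"
    using bounded[of "1/2"] by auto
  have "F n (1/2) \<le> 2 * B" for n
  proof -
    have "integral {1/2..1::real} (\<lambda>t. F n (1/2)) \<le> integral {1/2..1} (\<lambda>t. F n t / t ^ k)"
    proof (intro integral_le integrable_continuous_interval continuous_on_const)
      fix t :: real assume t: "t \<in> {1/2..1}"
      then have "F n (1/2) * t ^ k \<le> F n t * 1"
        using F_mono[of "1/2" t n] F_nonneg[of "1/2" n] F_nonneg[of t n]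
        by (intro mult_mono) (auto simp: power_le_one)
      then show "F n (1/2) \<le> F n t / t ^ k"
        using t by (simp add: pos_le_divide_eq)
    qed (auto intro: continuous_on_subset[OF quot_cont])
    then show ?thesis
      using B[of "Suc n", unfolded iter_Suc] by simp
  qed
  moreover have "F n 1 - F n (1/2) \<le> a * f B * (1/2)" for n
  proof -
    have "norm (integral {1/2..1} (g n)) \<le> a * f B * (1 - 1/2)"
    proof (rule integral_bound)
      fix t :: real assume t: "t \<in> {1/2..1}"
      then have "f (iter a n t) \<le> f B"
        using iter_antimono[OF a, of "1/2" t n] B[of n] by (intro f_mono iter_nonneg[OF a]) auto
      have "t ^ k * (a * f (iter a n t)) \<le> 1 * (a * f (iter a n t))"
        using t by (intro mult_right_mono power_le_one iter_source_nonneg[OF a]) auto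
      also have "\<dots> \<le> 1 * (a * f B)"
        using \<open>f (iter a n t) \<le> f B\<close> a by (intro mult_left_mono) auto
      finally show "norm (g n t) \<le> a * f B"
        using g_nonneg[of t n] t by (simp add: g_def)
    qed (auto intro: continuous_on_subset[OF g_cont])
    moreover have "F n 1 = F n (1/2) + integral {1/2..1} (g n)"
      unfolding F by (rule Henstock_Kurzweil_Integration.integral_combine[symmetric]) (use g_int in auto)
    ultimately show ?thesis
      by simp
  qed
  ultimately have F_le: "F n 1 \<le> 2 * B + a * f B * (1/2)" for n
    by (smt (verit))
  have Z: "g\<^sub>0 integrable_on {0..r} \<and> (\<lambda>n. F n r) \<longlonglongrightarrow> integral {0..r} g\<^sub>0" if r: "0 \<le> r" "r \<le> 1" for r
    unfolding F
  proof (rule monotone_convergence_increasing)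
    show "g n t \<le> g (Suc n) t" if "t \<in> {0..r}" for n t
      unfolding g_def using that r a
      by (intro mult_left_mono f_mono iter_nonneg iter_le_Suc) auto
    \<comment> \<open>At 0 the iterates may be unbounded and \<open>lim_iter\<close> meaningless,
      but the weight \<open>t ^ k\<close> vanishes there.\<close>
    show "(\<lambda>n. g n t) \<longlonglongrightarrow> g\<^sub>0 t" if "t \<in> {0..r}" for t
    proof (cases "t = 0")
      case False
      have "isCont f (lim_iter a t)"
        using lim_iter_nonneg[of t] A_neg that r False by (intro DERIV_isCont[OF f_has_derivative]) auto
      then show ?thesis
        unfolding g_def g\<^sub>0_def using that r False
        by (intro tendsto_mult tendsto_const isCont_tendsto_compose[of _ f] iter_tendsto) auto
    qed (use k_pos in \<open>simp add: g_def g\<^sub>0_def zero_power\<close>)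
    have "norm (integral {0..r} (g n)) \<le> 2 * B + a * f B * (1/2)" for n
      using F_le[of n] F_mono[of r 1 n] F_nonneg[of r n] r by (simp add: F)
    then show "bounded (range (\<lambda>n. integral {0..r} (g n)))"
      unfolding bounded_iff by blast
  qed (use g_int r in auto)
  define z where "z r = integral {0..r} g\<^sub>0" for r
  have z_cont: "continuous_on {0..1} z"
    unfolding z_def by (rule indefinite_integral_continuous_1) (use Z[of 1] in simp)
  have F_lim: "(\<lambda>n. F n r) \<longlonglongrightarrow> z r" if "0 \<le> r" "r \<le> 1" for r
    using Z[OF that] by (simp add: z_def)
  have y_eq: "lim_iter a r = integral {r..1} (\<lambda>t. z t / t ^ k)" if r: "0 < r" "r \<le> 1" for r
  proof -
    have "(\<lambda>t. z t / t ^ k) integrable_on {r..1} \<and>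
      (\<lambda>n. iter a (Suc n) r) \<longlonglongrightarrow> integral {r..1} (\<lambda>t. z t / t ^ k)"
      unfolding iter_Suc
    proof (rule monotone_convergence_increasing)
      fix n t assume t: "t \<in> {r..1}"
      show "(\<lambda>n. F n t / t ^ k) \<longlonglongrightarrow> z t / t ^ k"
        using t r by (intro tendsto_divide tendsto_const F_lim) auto
      show "F n t / t ^ k \<le> F (Suc n) t / t ^ k"
        unfolding F using t r a
        by (intro divide_right_mono integral_le g_int)
           (auto simp: g_def intro!: mult_left_mono f_mono iter_nonneg iter_le_Suc[unfolded iter.simps])
    next
      show "(\<lambda>t. F n t / t ^ k) integrable_on {r..1}" for n
        by (rule integrable_continuous_interval, rule continuous_on_subset[OF quot_cont]) (use r in auto)
      have "(\<lambda>n. iter a (Suc n) r) \<longlonglongrightarrow> lim_iter a r"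
        by (rule LIMSEQ_Suc[OF iter_tendsto[OF r]])
      then show "bounded (range (\<lambda>n. integral {r..1} (\<lambda>t. F n t / t ^ k)))"
        unfolding iter_Suc by (rule convergent_imp_bounded)
    qed
    then show ?thesis
      using LIMSEQ_unique[OF LIMSEQ_Suc[OF iter_tendsto[OF r]]] by blast
  qed
  have q_cont: "continuous_on {d..1} (\<lambda>t. z t / t ^ k)" if "0 < d" for d
    using that by (intro continuous_on_divide continuous_on_subset[OF z_cont] continuous_intros) auto
  have y_deriv: "(lim_iter a has_real_derivative - (z r / r ^ k)) (at r)" if r: "0 < r" "r < 1" for r
  proof -
    have "((\<lambda>r. integral {r..1} (\<lambda>t. z t / t ^ k)) has_real_derivative - (z r / r ^ k)) (at r)"
      using integral_has_real_derivative'[OF q_cont[of "r / 2"], of r] r by (simp add: at_within_Icc_at)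
    then show ?thesis
      by (rule has_field_derivative_transform_within_open[of _ _ _ "{0<..<1}"]) (use r y_eq in auto)
  qed
  have y_cont: "continuous_on {d..1} (lim_iter a)" if "0 < d" for d
  proof -
    have "continuous_on {d..1} (\<lambda>r. integral {r..1} (\<lambda>t. z t / t ^ k))"
      by (intro indefinite_integral_continuous_1' integrable_continuous_interval q_cont that)
    then show ?thesis
      using that y_eq by (subst continuous_on_cong[OF refl]) auto
  qed
  have z_deriv: "(z has_real_derivative r ^ k * (a * f (lim_iter a r))) (at r)" if r: "0 < r" "r < 1" for r
  proof -
    have "isCont (lim_iter a) r" "isCont f (lim_iter a r)"
      using y_deriv[OF r] lim_iter_nonneg[of r] A_neg r
      by (auto intro!: DERIV_isCont f_has_derivative intro: DERIV_isCont)
    then have "isCont g\<^sub>0 r"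
      unfolding g\<^sub>0_def by (intro continuous_intros) (auto intro: isCont_o2)
    then show ?thesis
      using integral_has_vector_derivative_continuous_at[of g\<^sub>0 0 1 r "{}"] Z[of 1] r
      by (auto simp: z_def[abs_def] g\<^sub>0_def has_real_derivative_iff_has_vector_derivative at_within_Icc_at
          intro: continuous_at_imp_continuous_within)
  qed
  have "(z \<longlongrightarrow> z 0) (at 0 within {0..1})"
    using z_cont by (auto simp: continuous_on_def)
  then have "(z \<longlongrightarrow> 0) (at_right 0)"
    by (simp add: z_def at_within_Icc_at_right)
  moreover have "continuous_on {0<..1} (lim_iter a)"
    unfolding continuous_on_eq_continuous_within
  proof
    fix r :: real assume r: "r \<in> {0<..1}"
    have "at r within {0<..1} = at r within {r/2..1}"
      using r by (intro at_within_nhd[of _ "{r/2<..}"]) auto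
    then show "continuous (at r within {0<..1}) (lim_iter a)"
      using y_cont[of "r/2"] r by (simp add: continuous_on_eq_continuous_within)
  qed
  ultimately have "radial_pair k (\<lambda>r. a * f (lim_iter a r)) (lim_iter a) z"
    using y_deriv z_deriv by (auto simp: radial_pair_def)
  then show ?thesis
    by blast
qed

end

end

lemma green_diff:
  assumes "continuous_on {0..1} h1" "continuous_on {0..1} h2" "r \<in> {0..1}"
  shows "green k (\<lambda>t. h1 t - h2 t) r = green k h1 r - green k h2 r"
proof -
  have flux: "flux k (\<lambda>t. h1 t - h2 t) t = flux k h1 t - flux k h2 t" if "t \<in> {0..1}" for t
    unfolding flux_def right_diff_distrib using assms that
    by (intro integral_diff integrable_continuous_interval)
       (auto intro: continuous_on_subset[OF flux_integrand_continuous])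
  have "green k (\<lambda>t. h1 t - h2 t) r = integral {r..1} (\<lambda>t. flux k h1 t / t ^ k - flux k h2 t / t ^ k)"
    unfolding green_def using assms(3)
    by (intro integral_cong) (simp add: flux diff_divide_distrib)
  then show ?thesis
    unfolding green_def using assms
    by (simp only:, intro integral_diff integrable_continuous_interval)
       (auto intro: continuous_on_subset[OF continuous_on_flux_quotient])
qed

text \<open>The factor \<open>s\<close> records that the derivative of \<open>green k h\<close> is
  of size \<open>M * r\<close>. For \<open>r = 0\<close> this is the quadratic estimate behind
  differentiability at the origin; otherwise it gives a uniform Lipschitz bound.\<close>

lemma green_Lipschitz:
  assumes h: "continuous_on {0..1} h" and M: "\<And>t. t \<in> {0..1} \<Longrightarrow> \<bar>h t\<bar> \<le> M" and "0 \<le> r" "r \<le> s" "s \<le> 1"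
  shows "\<bar>green k h r - green k h s\<bar> \<le> M * s * (s - r)"
proof -
  have "0 \<le> M"
    using M[of 0] by force
  have "norm (integral {r..s} (\<lambda>t. flux k h t / t ^ k)) \<le> M * s * (s - r)"
  proof (rule integral_bound)
    fix t assume t: "t \<in> {r..s}"
    have "\<bar>flux k h t / t ^ k\<bar> \<le> M * t"
    proof (cases "t = 0")
      case False
      then show ?thesis
        using t assms(3-) by (intro abs_flux_quotient_le[OF h M]) auto
    qed (simp add: flux_def)
    also have "\<dots> \<le> M * s"
      using t \<open>0 \<le> M\<close> by (intro mult_left_mono) auto
    finally show "norm (flux k h t / t ^ k) \<le> M * s"
      by simp
  next
    show "continuous_on {r..s} (\<lambda>t. flux k h t / t ^ k)"
      by (rule continuous_on_subset[OF continuous_on_flux_quotient[OF h]]) (use assms in auto)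
  qed (use assms in auto)
  moreover have "integral {r..s} (\<lambda>t. flux k h t / t ^ k) + green k h s = green k h r"
    unfolding green_def
    by (rule Henstock_Kurzweil_Integration.integral_combine)
       (use assms in \<open>auto intro!: integrable_continuous_interval intro: continuous_on_subset[OF continuous_on_flux_quotient[OF h]]\<close>)
  ultimately show ?thesis
    by simp
qed

context radial_problem
begin

text \<open>A common bound \<open>T\<close> bounds all sources by \<open>a * f T\<close>, so the
  iterates share one Lipschitz constant and the limit inherits it. The integral equation then
  extends from positive radii to the origin by continuity.\<close>

lemma lim_iter_solution:
  assumes a: "0 \<le> a" and T: "\<And>n r. 0 < r \<Longrightarrow> r \<le> 1 \<Longrightarrow> iter a n r \<le> T"
  shows "continuous_on {0..1} (lim_iter a)"
    and "\<And>r. r \<in> {0..1} \<Longrightarrow> lim_iter a r = green k (\<lambda>r. a * f (lim_iter a r)) r"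
    and "\<And>r. r \<in> {0..1} \<Longrightarrow> 0 \<le> lim_iter a r"
    and "\<And>r. r \<in> {0..1} \<Longrightarrow> (\<lambda>n. iter a n r) \<longlonglongrightarrow> lim_iter a r"
proof -
  have T0: "iter a n r \<le> T" if "r \<in> {0..1}" for n r
  proof (cases "r = 0")
    case True
    have "(iter a n \<longlongrightarrow> iter a n 0) (at 0 within {0..1})"
      using iter_continuous[OF a, of n] by (auto simp: continuous_on_def)
    moreover have "\<forall>\<^sub>F s in at 0 within {0..1}. iter a n s \<le> T"
      using T by (auto simp: eventually_at_filter intro!: always_eventually)
    ultimately show ?thesis
      using True by (intro tendsto_upperbound[of "iter a n"]) (auto simp: at_within_Icc_at_right)
  qed (use that T in auto)
  have bdd: "bdd_above (range (\<lambda>n. iter a n r))" if "r \<in> {0..1}" for r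
    using T0[OF that] by (auto simp: bdd_above_def)
  show lim: "(\<lambda>n. iter a n r) \<longlonglongrightarrow> lim_iter a r" if "r \<in> {0..1}" for r
    unfolding lim_iter_def by (intro LIMSEQ_incseq_SUP bdd iter_incseq a that)
  show nonneg: "0 \<le> lim_iter a r" if "r \<in> {0..1}" for r
    by (rule LIMSEQ_le_const[OF lim[OF that]]) (use iter_nonneg[OF a that] in auto)
  define M where "M = a * f T"
  have "0 \<le> T"
    using T0[of 0 0] by simp
  have Lip: "\<bar>iter a n r - iter a n s\<bar> \<le> M * \<bar>r - s\<bar>" if "r \<in> {0..1}" "s \<in> {0..1}" for n r s
  proof -
    have "\<bar>iter a n r - iter a n s\<bar> \<le> M * (s - r)" if "0 \<le> r" "r \<le> s" "s \<le> 1" for r s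
    proof (cases n)
      case 0
      then show ?thesis
        using that a f_pos[of T] A_neg \<open>0 \<le> T\<close> by (simp add: M_def)
    next
      case (Suc j)
      have "\<bar>a * f (iter a j t)\<bar> \<le> M" if "t \<in> {0..1}" for t
        using iter_source_nonneg[OF a that, of j] T0[OF that, of j] iter_nonneg[OF a that] a
        by (auto simp: M_def intro!: mult_left_mono f_mono)
      then have "\<bar>iter a n r - iter a n s\<bar> \<le> M * s * (s - r)"
        unfolding Suc iter.simps by (intro green_Lipschitz iter_source_continuous a that)
      also have "\<dots> \<le> M * 1 * (s - r)"
        using that a f_pos[of T] A_neg \<open>0 \<le> T\<close>
        by (intro mult_right_mono mult_left_mono) (auto simp: M_def less_imp_le)
      finally show ?thesis
        by simp
    qed
    from this[of r s] this[of s r] show ?thesis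
      using that by (cases "r \<le> s") (auto simp: abs_minus_commute)
  qed
  have Lip': "\<bar>lim_iter a r - lim_iter a s\<bar> \<le> M * \<bar>r - s\<bar>" if "r \<in> {0..1}" "s \<in> {0..1}" for r s
    using that Lip by (intro LIMSEQ_le_const2[OF tendsto_rabs[OF tendsto_diff[OF lim lim]]]) auto
  then have "M-lipschitz_on {0..1} (lim_iter a)"
    using a f_pos[of T] A_neg \<open>0 \<le> T\<close> by (auto intro!: lipschitz_onI simp: M_def dist_real_def)
  then show cont: "continuous_on {0..1} (lim_iter a)"
    by (rule lipschitz_on_continuous_on)
  have src: "continuous_on {0..1} (\<lambda>r. a * f (lim_iter a r))"
    by (intro continuous_on_mult continuous_on_const continuous_on_f_compose cont nonneg)
  have bounded: "\<exists>B. \<forall>n. iter a n r \<le> B" if "0 < r" "r \<le> 1" for r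
    using T that by blast
  obtain z where z: "radial_pair k (\<lambda>r. a * f (lim_iter a r)) (lim_iter a) z"
    using lim_iter_radial_pair[OF a bounded] by blast
  have pos: "lim_iter a r = green k (\<lambda>r. a * f (lim_iter a r)) r" if "0 < r" "r \<le> 1" for r
    by (rule green_eq_if_radial_pair[OF src z lim_iter_1[OF a] that])
  show "lim_iter a r = green k (\<lambda>r. a * f (lim_iter a r)) r" if "r \<in> {0..1}" for r
  proof (cases "r = 0")
    case True
    have "((\<lambda>r. lim_iter a r - green k (\<lambda>r. a * f (lim_iter a r)) r) \<longlongrightarrow>
        lim_iter a 0 - green k (\<lambda>r. a * f (lim_iter a r)) 0) (at 0 within {0..1})"
      using cont continuous_on_green[OF src, of k] by (intro tendsto_diff) (auto simp: continuous_on_def)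
    moreover have "((\<lambda>r. lim_iter a r - green k (\<lambda>r. a * f (lim_iter a r)) r) \<longlongrightarrow> 0) (at 0 within {0..1})"
      by (rule tendsto_eventually) (use pos in \<open>auto simp: eventually_at_filter intro!: always_eventually\<close>)
    ultimately have "lim_iter a 0 - green k (\<lambda>r. a * f (lim_iter a r)) 0 = 0"
      by (rule tendsto_unique[rotated]) (simp add: at_within_Icc_at_right)
    with True show ?thesis
      by simp
  qed (use pos that in auto)
qed

text \<open>Each Green step is Lipschitz because \<open>f1\<close> is bounded on the range of the
  iterate. The estimate treats one \<open>n\<close> at a time, so that \<open>n\<close> can be fixed
  before the parameter tends to 1.\<close>

lemma iter_parameter_Lipschitz:
  "\<exists>C\<ge>0. \<forall>a r. 0 \<le> a \<longrightarrow> a \<le> 1 \<longrightarrow> r \<in> {0..1} \<longrightarrow> iter 1 n r - iter a n r \<le> C * (1 - a)"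
proof (induction n)
  case (Suc n)
  then obtain C where C: "0 \<le> C"
    "\<And>a r. 0 \<le> a \<Longrightarrow> a \<le> 1 \<Longrightarrow> r \<in> {0..1} \<Longrightarrow> iter 1 n r - iter a n r \<le> C * (1 - a)"
    by blast
  obtain M where M: "\<And>t. t \<in> {0..1} \<Longrightarrow> \<bar>iter 1 n t\<bar> \<le> M" "0 < M"
    using continuous_on_Icc_bounded[OF iter_continuous, of 1 n] by force
  \<comment> \<open>From \<open>f u - a * f v = (f u - f v) + (1 - a) * f v\<close>: convexity
    contributes \<open>f1 M * C\<close> and monotonicity \<open>f M\<close>, each times
    \<open>1 - a\<close>.\<close>
  define C' where "C' = f M + f1 M * C"
  have C': "0 \<le> C'"
    using C(1) f_pos[of M] f1_nonneg[of M] M(2) A_neg by (simp add: C'_def)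
  show ?case
  proof (intro exI[of _ C'] conjI C' allI impI)
    fix a r :: real
    assume a: "0 \<le> a" "a \<le> 1" and r: "r \<in> {0..1}"
    have bnd: "\<bar>1 * f (iter 1 n t) - a * f (iter a n t)\<bar> \<le> C' * (1 - a)" if t: "t \<in> {0..1}" for t
    proof -
      define u v where "u = iter 1 n t" and "v = iter a n t"
      have uv: "0 \<le> v" "v \<le> u" "u \<le> M" "u - v \<le> C * (1 - a)"
        using iter_nonneg[OF a(1) t, of n] iter_mono_parameter[OF a t, of n] M(1)[OF t] C(2)[OF a t]
        by (auto simp: u_def v_def)
      have "f u - f v \<le> f1 u * (u - v)"
        using f_convex[of u v] uv A_neg by (simp add: algebra_simps)
      also have "\<dots> \<le> f1 M * (C * (1 - a))"
        using uv A_neg by (intro mult_mono f1_mono f1_nonneg) auto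
      finally have 1: "f u - f v \<le> f1 M * (C * (1 - a))" .
      have 2: "(1 - a) * f v \<le> (1 - a) * f M"
        using uv a by (intro mult_left_mono f_mono) auto
      have "a * f v \<le> 1 * f v"
        using a f_pos[of v] uv A_neg by (intro mult_right_mono) auto
      then have "0 \<le> f u - a * f v"
        using f_mono[OF uv(1,2)] by simp
      with 1 2 show ?thesis
        by (simp add: C'_def u_def v_def algebra_simps)
    qed
    have "iter 1 (Suc n) r - iter a (Suc n) r =
        green k (\<lambda>t. 1 * f (iter 1 n t) - a * f (iter a n t)) r"
      unfolding iter.simps by (intro green_diff[symmetric] iter_source_continuous a r) simp
    also have "\<dots> \<le> C' * (1 - a) * (1 - r)"
    proof (rule order_trans[OF abs_ge_self green_le[OF _ bnd r]])
      show "continuous_on {0..1} (\<lambda>t. 1 * f (iter 1 n t) - a * f (iter a n t))"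
        by (intro continuous_on_diff iter_source_continuous a) simp
    qed
    also have "\<dots> \<le> C' * (1 - a) * 1"
      using C' a r by (intro mult_left_mono) auto
    finally show "iter 1 (Suc n) r - iter a (Suc n) r \<le> C' * (1 - a)"
      by simp
  qed
qed auto

end

subsection \<open>Bounded supersolutions and the singular solution\<close>

context radial_problem
begin

text \<open>The integral of \<open>1 / f\<close> from 0 to \<open>t\<close>. Integrals over reversed
  intervals are 0, so a base point below 0 is needed for the function to be differentiable and
  strictly increasing across 0.\<close>

definition recip_integral :: "real \<Rightarrow> real" where
  "recip_integral t = integral {A / 2..t} (\<lambda>s. 1 / f s) - integral {A / 2..0} (\<lambda>s. 1 / f s)"

lemma recip_integral_0: "recip_integral 0 = 0"
  by (simp add: recip_integral_def)

lemma recip_integral_has_derivative: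
  assumes "A / 2 < t"
  shows "(recip_integral has_real_derivative 1 / f t) (at t)"
proof -
  have "continuous_on {A / 2..t + 1} (\<lambda>s. 1 / f s)"
  proof (intro continuous_on_divide continuous_on_const continuous_on_subset[OF continuous_on_f] ballI)
    fix s assume "s \<in> {A / 2..t + 1}"
    then have "0 < f s"
      using A_neg by (intro f_pos) auto
    then show "f s \<noteq> 0"
      by simp
  qed (use A_neg in auto)
  from integral_has_real_derivative[OF this, of t] assms
  have "((\<lambda>t. integral {A / 2..t} (\<lambda>s. 1 / f s)) has_real_derivative 1 / f t) (at t)"
    by (simp add: at_within_Icc_at)
  then show ?thesis
    unfolding recip_integral_def[abs_def] by (auto intro!: derivative_eq_intros)
qed

lemma recip_integral_strict_mono:
  assumes "A / 2 < s" "s < t"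
  shows "recip_integral s < recip_integral t"
proof (rule DERIV_pos_imp_increasing[OF assms(2)])
  fix x assume "s \<le> x" "x \<le> t"
  then show "\<exists>y. (recip_integral has_real_derivative y) (at x) \<and> 0 < y"
    using recip_integral_has_derivative[of x] f_pos[of x] assms A_neg by (intro exI[of _ "1 / f x"]) auto
qed

lemma recip_integral_less_iff:
  "A / 2 < s \<Longrightarrow> A / 2 < t \<Longrightarrow> recip_integral s < recip_integral t \<longleftrightarrow> s < t"
  using recip_integral_strict_mono[of s t] recip_integral_strict_mono[of t s]
  by (cases s t rule: linorder_cases) auto

text \<open>
  The change of unknown of Brezis, Cazenave, Martel and Ramiandrisoana: if \<open>J' = 1 / f\<close> is bounded
  and \<open>y\<close> solves the equation with parameter \<open>a\<close>, then \<open>v\<close> with \<open>J v = (b / a) J y\<close> is bounded and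
  is a supersolution for the smaller parameter \<open>b\<close>.
\<close>

lemma bounded_supersolution:
  assumes y: "radial_pair k (\<lambda>r. a * f (y r)) y z" and y_nonneg: "\<And>r. 0 < r \<Longrightarrow> r \<le> 1 \<Longrightarrow> 0 \<le> y r"
    and b: "0 < b" "b < a" and C: "\<And>t. 0 \<le> t \<Longrightarrow> recip_integral t \<le> C"
  obtains T v zv h where "radial_pair k h v zv" "\<And>r. 0 < r \<Longrightarrow> r < 1 \<Longrightarrow> b * f (v r) \<le> h r"
    "\<And>r. 0 < r \<Longrightarrow> r \<le> 1 \<Longrightarrow> 0 \<le> v r" "\<And>r. 0 < r \<Longrightarrow> r \<le> 1 \<Longrightarrow> v r \<le> T"
proof -
  define J where "J = recip_integral"
  define \<theta> where "\<theta> = b / a"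
  have \<theta>: "0 < \<theta>" "\<theta> < 1" "\<theta> * a = b"
    using b by (auto simp: \<theta>_def)
  define S where "S = {A / 2<..}"
  have S: "open S" "\<And>t. 0 \<le> t \<Longrightarrow> t \<in> S"
    using A_neg by (auto simp: S_def)
  have J_deriv: "(J has_real_derivative 1 / f t) (at t)" if "t \<in> S" for t
    using recip_integral_has_derivative that by (simp add: J_def S_def)
  have J_cont: "continuous_on S J"
    using J_deriv by (intro continuous_at_imp_continuous_on ballI DERIV_isCont)
  have J_less: "J s < J t \<longleftrightarrow> s < t" if "s \<in> S" "t \<in> S" for s t
    using recip_integral_less_iff that by (simp add: J_def S_def)
  have J_le: "J s \<le> J t \<longleftrightarrow> s \<le> t" if "s \<in> S" "t \<in> S" for s t
    using J_less[OF that(2,1)] by (simp add: not_less[symmetric])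
  have J_inj: "inj_on J S"
    by (intro inj_onI) (metis J_le order_antisym order_refl)
  have f_pos': "0 < f t" if "0 \<le> t" for t
    using f_pos A_neg that by auto
  have J0: "J 0 = 0"
    by (simp add: J_def recip_integral_0)
  \<comment> \<open>Inverting on the open set \<open>S\<close>, which extends below 0, makes the
    inverse differentiable at \<open>J 0\<close> as well.\<close>
  define K where "K = the_inv_into S J"
  have KJ: "K (J t) = t" if "t \<in> S" for t
    unfolding K_def by (rule the_inv_into_f_f[OF J_inj that])
  have K_deriv: "(K has_real_derivative f t) (at (J t))" if "0 \<le> t" for t
    using has_field_derivative_inverse_strong[OF J_deriv[OF S(2)[OF that]] _ S(1) S(2)[OF that] J_cont, of K]
      KJ f_pos'[OF that] by simp
  define \<sigma> where "\<sigma> = (SUP t\<in>{0..}. J t)"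
  have bdd: "bdd_above (J ` {0..})"
    using C by (auto simp: bdd_above_def J_def)
  have J_le_\<sigma>: "J t \<le> \<sigma>" if "0 \<le> t" for t
    unfolding \<sigma>_def using that by (intro cSUP_upper bdd) auto
  have "0 < \<sigma>"
    using J_less[of 0 1] J0 J_le_\<sigma>[of 1] S(2) by force
  \<comment> \<open>Boundedness of \<open>v\<close> originates here:
    \<open>\<theta> * J (y r)\<close> stays below a level strictly under the supremum of
    \<open>J\<close>, a level that \<open>J\<close> exceeds at some finite \<open>T\<close>.\<close>
  then have "\<theta> * \<sigma> < \<sigma>"
    using \<theta> by simp
  then obtain T where T: "0 \<le> T" "\<theta> * \<sigma> < J T"
    unfolding \<sigma>_def using less_cSUP_iff[OF _ bdd, of "\<theta> * \<sigma>"] by (auto simp: \<sigma>_def)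
  have ex: "\<exists>x. 0 \<le> x \<and> x \<le> T \<and> J x = \<theta> * J t" if "0 \<le> t" for t
  proof (rule IVT')
    show "J 0 \<le> \<theta> * J t"
      using J0 J_le[of 0 t] S(2) that \<theta> by simp
    have "\<theta> * J t \<le> \<theta> * \<sigma>"
      using J_le_\<sigma>[OF that] \<theta> by simp
    then show "\<theta> * J t \<le> J T"
      using T by simp
    show "continuous_on {0..T} J"
      using S(2) by (intro continuous_on_subset[OF J_cont]) auto
  qed (use T in simp)
  define v where "v r = K (\<theta> * J (y r))" for r
  have v: "0 \<le> v r \<and> v r \<le> T \<and> J (v r) = \<theta> * J (y r)" if r: "0 < r" "r \<le> 1" for r
  proof -
    obtain x where "0 \<le> x" "x \<le> T" "J x = \<theta> * J (y r)"
      using ex[OF y_nonneg[OF r]] by blast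
    then show ?thesis
      using KJ[of x] S(2) by (simp add: v_def)
  qed
  have v_le_y: "v r \<le> y r" if "0 < r" "r \<le> 1" for r
  proof -
    have "0 \<le> J (y r)"
      using J_le[of 0 "y r"] J0 S(2) y_nonneg[OF that] by simp
    then have "J (v r) \<le> J (y r)"
      using v[OF that] \<theta> by (simp add: mult_left_le_one_le)
    then show ?thesis
      using J_le S(2) v[OF that] y_nonneg[OF that] by blast
  qed
  have z_nonneg: "0 \<le> z r" if "0 < r" "r < 1" for r
    using that f_pos'[OF y_nonneg] b by (intro radial_pair_flux_nonneg[OF y]) (auto intro: less_imp_le)
  define zv where "zv r = \<theta> * (f (v r) / f (y r) * z r)" for r
  \<comment> \<open>The source of \<open>v\<close>, found by differentiating its flux. The second
    term contains the squared derivative of \<open>y\<close>; it is nonnegative because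
    \<open>v \<le> y\<close>, \<open>f1\<close> is nondecreasing and
    \<open>\<theta> < 1\<close>.\<close>
  define h where "h r = b * f (v r) + \<theta> * (f (v r) / (f (y r))\<^sup>2) * (z r / r ^ k)\<^sup>2 * (f1 (y r) - \<theta> * f1 (v r))"
    for r
  have v_deriv: "(v has_real_derivative - (zv r / r ^ k)) (at r)" if r: "0 < r" "r < 1" for r
  proof -
    have "(K has_real_derivative f (v r)) (at (\<theta> * J (y r)))"
      using K_deriv[of "v r"] v[of r] r by simp
    moreover have "((\<lambda>r. \<theta> * J (y r)) has_real_derivative \<theta> * (1 / f (y r) * - (z r / r ^ k))) (at r)"
      using DERIV_chain2[OF J_deriv[OF S(2)] radial_pairD(3)[OF y r]] y_nonneg[of r] r
      by (intro DERIV_cmult) auto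
    ultimately show ?thesis
      unfolding v_def zv_def by (rule DERIV_cong[OF DERIV_chain2]) simp
  qed
  have f_deriv: "(f has_real_derivative f1 t) (at t)" if "0 \<le> t" for t
    using f_has_derivative A_neg that by auto
  have zv_deriv: "(zv has_real_derivative r ^ k * h r) (at r)" if r: "0 < r" "r < 1" for r
  proof -
    have nonneg: "0 \<le> v r" "0 \<le> y r"
      using v[of r] y_nonneg[of r] r by auto
    have fv: "((\<lambda>r. f (v r)) has_real_derivative f1 (v r) * - (zv r / r ^ k)) (at r)"
      by (rule DERIV_chain2[OF f_deriv[OF nonneg(1)] v_deriv[OF r]])
    have fy: "((\<lambda>r. f (y r)) has_real_derivative f1 (y r) * - (z r / r ^ k)) (at r)"
      by (rule DERIV_chain2[OF f_deriv[OF nonneg(2)] radial_pairD(3)[OF y r]])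
    have "f (y r) \<noteq> 0"
      using f_pos'[OF nonneg(2)] by simp
    have "((\<lambda>r. \<theta> * (f (v r) / f (y r) * z r)) has_real_derivative
      \<theta> * ((f1 (v r) * - (zv r / r ^ k) * f (y r) - f (v r) * (f1 (y r) * - (z r / r ^ k))) / (f (y r) * f (y r)) * z r
        + r ^ k * (a * f (y r)) * (f (v r) / f (y r)))) (at r)"
      by (intro DERIV_cmult DERIV_mult DERIV_divide fv fy radial_pairD(4)[OF y r] \<open>f (y r) \<noteq> 0\<close>)
    then show ?thesis
      unfolding zv_def[abs_def]
    proof (rule DERIV_cong)
      have alg: "\<theta> * ((g1 * - (\<theta> * (g / q * z) / c) * q - g * (q1 * - (z / c))) / (q * q) * z + c * (a * q) * (g / q)) =
          c * ((\<theta> * a) * g + \<theta> * (g / q\<^sup>2) * (z / c)\<^sup>2 * (q1 - \<theta> * g1))"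
        if "q \<noteq> 0" "c \<noteq> 0" for g1 g q q1 z c :: real
        using that by (simp add: field_simps power2_eq_square)
      show "\<theta> * ((f1 (v r) * - (\<theta> * (f (v r) / f (y r) * z r) / r ^ k) * f (y r)
          - f (v r) * (f1 (y r) * - (z r / r ^ k))) / (f (y r) * f (y r)) * z r
          + r ^ k * (a * f (y r)) * (f (v r) / f (y r))) = r ^ k * h r"
        unfolding h_def \<theta>(3)[symmetric] by (rule alg) (use \<open>f (y r) \<noteq> 0\<close> r in auto)
    qed
  qed
  have h_ge: "b * f (v r) \<le> h r" if r: "0 < r" "r < 1" for r
  proof -
    have "f1 (v r) \<le> f1 (y r)" "0 \<le> f1 (v r)"
      using v[of r] v_le_y[of r] r A_neg by (auto intro!: f1_mono f1_nonneg)
    moreover from this have "\<theta> * f1 (v r) \<le> 1 * f1 (v r)"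
      using \<theta> by (intro mult_right_mono) auto
    ultimately have "0 \<le> f1 (y r) - \<theta> * f1 (v r)"
      by simp
    moreover have "0 < f (v r)"
      using f_pos' v[of r] r by auto
    ultimately show ?thesis
      using \<theta> by (simp add: h_def)
  qed
  have zv_bounds: "0 \<le> zv r \<and> zv r \<le> z r" if r: "0 < r" "r < 1" for r
  proof -
    have "f (v r) \<le> f (y r)" "0 < f (v r)" "0 < f (y r)"
      using v[of r] v_le_y[of r] r f_pos' y_nonneg[of r] by (auto intro: f_mono)
    then have "0 \<le> f (v r) / f (y r)" "f (v r) / f (y r) \<le> 1"
      by auto
    then have q: "0 \<le> f (v r) / f (y r) * z r" "f (v r) / f (y r) * z r \<le> z r"
      using z_nonneg[OF r] mult_left_le_one_le mult_nonneg_nonneg by blast+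
    then show ?thesis
      unfolding zv_def using \<theta>(1,2) mult_left_le_one_le[OF q(1), of \<theta>] mult_nonneg_nonneg[OF _ q(1), of \<theta>]
      by linarith
  qed
  have "radial_pair k h v zv"
    unfolding radial_pair_def
  proof (intro conjI ballI)
    have "continuous_on (J ` {0..}) K"
      using K_deriv by (intro continuous_at_imp_continuous_on) (auto intro: DERIV_isCont)
    moreover have "continuous_on {0<..1} (\<lambda>r. \<theta> * J (y r))"
      using y_nonneg S(2)
      by (intro continuous_on_mult continuous_on_const continuous_on_compose2[OF J_cont radial_pairD(1)[OF y]]) auto
    moreover have "(\<lambda>r. \<theta> * J (y r)) ` {0<..1} \<subseteq> J ` {0..}"
    proof
      fix x assume "x \<in> (\<lambda>r. \<theta> * J (y r)) ` {0<..1}"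
      then obtain r where "0 < r" "r \<le> 1" "x = \<theta> * J (y r)"
        by auto
      then show "x \<in> J ` {0..}"
        using v[of r] by (intro image_eqI[of _ _ "v r"]) auto
    qed
    ultimately show "continuous_on {0<..1} v"
      unfolding v_def[abs_def] by (rule continuous_on_compose2)
    show "(zv \<longlongrightarrow> 0) (at_right 0)"
    proof (rule real_tendsto_sandwich[OF _ _ tendsto_const radial_pairD(2)[OF y]])
      have ev: "\<forall>\<^sub>F r::real in at_right 0. 0 < r \<and> r < 1"
        by (rule eventually_in_unit_interval)
      show "\<forall>\<^sub>F r in at_right 0. 0 \<le> zv r" "\<forall>\<^sub>F r in at_right 0. zv r \<le> z r"
        using ev by (eventually_elim; use zv_bounds in blast)+
    qed
  qed (use v_deriv zv_deriv in auto)
  with h_ge v that show thesis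
    by blast
qed

end

text \<open>The facts about the profile on which extremality rests, separated from its construction.
  \<open>P\<close> is the derivative of \<open>ln w\<close> and \<open>P1\<close> that of
  \<open>P\<close>, both with respect to \<open>- ln r\<close>. The upper bound on \<open>P\<close>
  and \<open>k \<le> m\<^sup>2\<close> are the stability conditions.\<close>

locale singular_profile = radial_problem +
  fixes U w P P1 :: "real \<Rightarrow> real" and m :: real
  assumes U_deriv: "0 < r \<Longrightarrow> r < 2 \<Longrightarrow> (U has_real_derivative - w r) (at r)"
    and w_deriv: "0 < r \<Longrightarrow> r < 2 \<Longrightarrow> (w has_real_derivative - (P r * w r / r)) (at r)"
    and P_deriv: "0 < r \<Longrightarrow> r < 2 \<Longrightarrow> (P has_real_derivative - (P1 r / r)) (at r)"
    and w_pos: "0 < r \<Longrightarrow> r < 2 \<Longrightarrow> 0 < w r" and w_1: "w 1 = 1" and U_1: "U 1 = 0"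
    and f_U: "0 < r \<Longrightarrow> r \<le> 1 \<Longrightarrow> f (U r) = w r / r * (k - P r)"
    and f1_U: "0 < r \<Longrightarrow> r \<le> 1 \<Longrightarrow> f1 (U r) = ((k - P r) * (1 + P r) - P1 r) / r\<^sup>2"
    and P_ge: "0 < r \<Longrightarrow> r < 2 \<Longrightarrow> -1 \<le> P r"
    and P_le: "0 < r \<Longrightarrow> r < 2 \<Longrightarrow> P r \<le> (real k - 1) / 2 - m"
    and m_ge: "3 \<le> m" and m_square: "real k \<le> m\<^sup>2"
    and U_at_top: "filterlim U at_top (at_right 0)"
begin

lemma two_P_le: "0 < r \<Longrightarrow> r < 2 \<Longrightarrow> 2 * P r + 2 * m \<le> real k - 1"
  using P_le[of r] by (simp add: field_simps)

lemma k_ge: "5 \<le> k"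
proof -
  have "4 \<le> real k - 1"
    using P_ge[of 1] two_P_le[of 1] m_ge by simp
  then show ?thesis
    by linarith
qed

lemma continuous_on_U: "continuous_on {0<..1} U"
proof (intro continuous_at_imp_continuous_on ballI)
  fix r :: real assume "r \<in> {0<..1}"
  then show "isCont U r"
    using DERIV_isCont[OF U_deriv, of r] by simp
qed

lemma U_antimono: "0 < r \<Longrightarrow> r \<le> s \<Longrightarrow> s \<le> 1 \<Longrightarrow> U s \<le> U r"
proof (rule nonincreasing_if_deriv_nonpos[OF continuous_on_U, of "\<lambda>r. - w r"])
  fix r :: real assume "0 < r" "r < 1"
  then show "(U has_real_derivative - w r) (at r)" "- w r \<le> 0"
    using U_deriv[of r] w_pos[of r] by auto
qed auto

lemma U_nonneg: "0 < r \<Longrightarrow> r \<le> 1 \<Longrightarrow> 0 \<le> U r"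
  using U_antimono[of r 1] U_1 by simp

lemma power_k_has_derivative:
  "0 < r \<Longrightarrow> ((\<lambda>r. r ^ k) has_real_derivative k * r ^ k / r) (at r)" for r :: real
  by (rule DERIV_cong[OF DERIV_pow]) (use k_pos in \<open>cases k; simp\<close>)

text \<open>The vanishing flux is the point. Since \<open>P \<le> k - 1\<close>, the function
  \<open>r ^ k * w r / r\<close> is nondecreasing; it equals 1 at \<open>r = 1\<close>, so the flux
  is at most \<open>r\<close>.\<close>

lemma radial_pair_U: "radial_pair k (\<lambda>r. f (U r)) U (\<lambda>r. r ^ k * w r)"
  unfolding radial_pair_def
proof (intro conjI ballI continuous_on_U)
  fix r :: real assume r: "r \<in> {0<..<1}"
  then show "(U has_real_derivative - (r ^ k * w r / r ^ k)) (at r)"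
    using U_deriv[of r] by simp
  have "((\<lambda>r. r ^ k * w r) has_real_derivative (k * r ^ k / r) * w r + - (P r * w r / r) * r ^ k) (at r)"
    using r by (intro DERIV_mult power_k_has_derivative w_deriv) auto
  then show "((\<lambda>r. r ^ k * w r) has_real_derivative r ^ k * f (U r)) (at r)"
    by (rule DERIV_cong) (use r in \<open>simp add: f_U field_simps\<close>)
next
  define q where "q r = r ^ k * w r / r" for r
  have q_deriv: "(q has_real_derivative r ^ k * w r / r\<^sup>2 * (real k - 1 - P r)) (at r)" if r: "0 < r" "r < 2" for r
  proof -
    have "((\<lambda>r. r ^ k * w r / r) has_real_derivative
      (((k * r ^ k / r) * w r + - (P r * w r / r) * r ^ k) * r - (r ^ k * w r) * 1) / (r * r)) (at r)"
      using r by (intro DERIV_divide DERIV_mult power_k_has_derivative w_deriv DERIV_ident) auto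
    then show ?thesis
      unfolding q_def[abs_def]
      by (rule DERIV_cong) (use r in \<open>simp add: field_simps power2_eq_square\<close>)
  qed
  have "q r \<le> q 1" if "0 < r" "r < 1" for r
  proof (rule DERIV_nonneg_imp_nondecreasing[of r 1 q])
    fix x assume x: "r \<le> x" "x \<le> 1"
    then have "0 \<le> x ^ k * w x / x\<^sup>2 * (real k - 1 - P x)"
      using two_P_le[of x] m_ge k_ge w_pos[of x] that by (intro mult_nonneg_nonneg divide_nonneg_nonneg) auto
    then show "\<exists>y. (q has_real_derivative y) (at x) \<and> 0 \<le> y"
      using q_deriv[of x] x that by auto
  qed (use that in simp)
  then have z_le: "r ^ k * w r \<le> r" if "0 < r" "r < 1" for r
    using that by (fastforce simp: q_def w_1 divide_le_eq)
  have ev: "\<forall>\<^sub>F r::real in at_right 0. 0 < r \<and> r < 1"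
    by (rule eventually_in_unit_interval)
  show "((\<lambda>r. r ^ k * w r) \<longlongrightarrow> 0) (at_right 0)"
  proof (rule real_tendsto_sandwich[OF _ _ tendsto_const tendsto_ident_at])
    show "\<forall>\<^sub>F r in at_right 0. 0 \<le> r ^ k * w r"
      using ev by eventually_elim (use w_pos in \<open>auto simp: less_imp_le\<close>)
    show "\<forall>\<^sub>F r in at_right 0. r ^ k * w r \<le> r"
      using ev by eventually_elim (use z_le in auto)
  qed
qed

text \<open>Along the profile \<open>w r / f (U r) = r / (k - P r) \<le> r\<close>, so
  \<open>recip_integral (U r) + r\<^sup>2 / 2\<close> is nondecreasing in \<open>r\<close>, with
  value 1/2 at \<open>r = 1\<close>. As \<open>U\<close> takes arbitrarily large values, every
  argument is covered.\<close>

lemma recip_integral_le: "0 \<le> t \<Longrightarrow> recip_integral t \<le> 1 / 2"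
proof -
  assume "0 \<le> t"
  have le: "recip_integral (U r) \<le> 1 / 2" if r: "0 < r" "r < 1" for r
  proof -
    have "recip_integral (U r) + r\<^sup>2 / 2 \<le> recip_integral (U 1) + 1\<^sup>2 / 2"
    proof (rule DERIV_nonneg_imp_nondecreasing[of r 1 "\<lambda>r. recip_integral (U r) + r\<^sup>2 / 2"])
      fix x assume x: "r \<le> x" "x \<le> 1"
      have "1 \<le> k - P x"
        using two_P_le[of x] m_ge k_ge x r by (simp add: field_simps)
      have "0 < w x"
        using w_pos x r by simp
      have "((\<lambda>r. recip_integral (U r) + r\<^sup>2 / 2) has_real_derivative 1 / f (U x) * - w x + x) (at x)"
        using DERIV_chain2[OF recip_integral_has_derivative U_deriv, of x] x r U_nonneg[of x] A_neg
        by (auto intro!: derivative_eq_intros)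
      moreover have "0 \<le> 1 / f (U x) * - w x + x"
      proof -
        have "1 / f (U x) * w x = x / (k - P x)"
          using x r \<open>0 < w x\<close> by (simp add: f_U)
        also have "\<dots> \<le> x / 1"
          using x r \<open>1 \<le> k - P x\<close> by (intro divide_left_mono) auto
        finally show ?thesis
          by simp
      qed
      ultimately show "\<exists>y. ((\<lambda>r. recip_integral (U r) + r\<^sup>2 / 2) has_real_derivative y) (at x) \<and> 0 \<le> y"
        by blast
    qed (use r in simp)
    then show ?thesis
      unfolding U_1 recip_integral_0 power_one using zero_le_power2[of r] by linarith
  qed
  have "\<forall>\<^sub>F r in at_right 0. t \<le> U r"
    using U_at_top by (auto simp: filterlim_at_top)
  moreover have "\<forall>\<^sub>F r::real in at_right 0. 0 < r \<and> r < 1"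
    by (rule eventually_in_unit_interval)
  ultimately have "\<forall>\<^sub>F r in at_right 0. t \<le> U r \<and> 0 < r \<and> r < 1"
    by eventually_elim auto
  then obtain r where r: "t \<le> U r" "0 < r" "r < 1"
    using eventually_happens'[OF trivial_limit_at_right_real] by blast
  then have "recip_integral t \<le> recip_integral (U r)"
    using \<open>0 \<le> t\<close> A_neg recip_integral_less_iff[of "U r" t] by (simp add: not_less[symmetric])
  also have "\<dots> \<le> 1 / 2"
    using le r by blast
  finally show ?thesis .
qed

text \<open>
  Uniqueness below the singular solution. The function \<open>\<xi> = w r\<^sup>-\<^sup>m\<close> is a positive supersolution of the
  linearised operator at \<open>U\<close> because \<open>k \<le> m\<^sup>2\<close>. By convexity the Wronskian of \<open>d = U - y\<close> and \<open>\<xi>\<close> is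
  monotone, so \<open>d / \<xi>\<close> either vanishes or grows logarithmically at \<open>0\<close>; it is bounded by \<open>1\<close>.
\<close>

lemma eq_U_if_solution_le_U:
  assumes y: "radial_pair k (\<lambda>r. f (y r)) y z" "y 1 = 0"
    and y_bounds: "\<And>r. 0 < r \<Longrightarrow> r \<le> 1 \<Longrightarrow> 0 \<le> y r \<and> y r \<le> U r" and r0: "0 < r0" "r0 \<le> 1"
  shows "y r0 = U r0"
proof (rule ccontr)
  assume "y r0 \<noteq> U r0"
  then have "y r0 < U r0" "r0 < 1"
    using y_bounds[OF r0] y(2) U_1 r0 by (auto simp: less_le)
  define d where "d r = U r - y r" for r
  define D where "D r = r ^ k * w r - z r" for r
  define \<xi> where "\<xi> r = w r * r powr (- m)" for r
  \<comment> \<open>This is \<open>r ^ k * (\<xi>' * d - \<xi> * d')\<close>, so the derivative of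
    \<open>e\<close> is \<open>- W / (r ^ k * \<xi>\<^sup>2)\<close>.\<close>
  define W where "W r = \<xi> r * D r - r ^ k / r * ((P r + m) * \<xi> r * d r)" for r
  define e where "e r = d r / \<xi> r" for r
  have pair: "radial_pair k (\<lambda>r. f (U r) - f (y r)) d D"
    unfolding d_def[abs_def] D_def[abs_def] by (rule radial_pair_diff[OF y(1) radial_pair_U])
  note d_deriv = radial_pairD(3)[OF pair] and D_deriv = radial_pairD(4)[OF pair]
  have \<xi>_pos: "0 < \<xi> r" if "0 < r" "r < 2" for r
    using w_pos that by (simp add: \<xi>_def)
  have \<xi>_1: "\<xi> 1 = 1"
    by (simp add: \<xi>_def w_1)
  have \<xi>_deriv: "(\<xi> has_real_derivative - ((P r + m) * \<xi> r / r)) (at r)" if "0 < r" "r < 2" for r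
  proof -
    have "((\<lambda>r. r powr (- m)) has_real_derivative (- m) * r powr (- m - 1)) (at r)"
      using that by (intro has_real_derivative_powr) auto
    from DERIV_mult[OF w_deriv[OF that] this]
    show ?thesis
      unfolding \<xi>_def[abs_def]
      by (rule DERIV_cong) (use that in \<open>simp add: powr_diff field_simps\<close>)
  qed
  have e_deriv: "(e has_real_derivative - (W r / (r ^ k * (\<xi> r)\<^sup>2))) (at r)" if r: "0 < r" "r < 1" for r
  proof -
    have "\<xi> r \<noteq> 0"
      using \<xi>_pos[of r] r by simp
    from DERIV_divide[OF d_deriv[OF r] \<xi>_deriv this] r
    have "(e has_real_derivative (- (D r / r ^ k) * \<xi> r - d r * - ((P r + m) * \<xi> r / r)) / (\<xi> r * \<xi> r)) (at r)"
      unfolding e_def[abs_def] by simp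
    then show ?thesis
      by (rule DERIV_cong) (use r \<open>\<xi> r \<noteq> 0\<close> in \<open>simp add: W_def field_simps power2_eq_square\<close>)
  qed
  have W_deriv_nonpos: "\<exists>W'. (W has_real_derivative W') (at r) \<and> W' \<le> 0" if r: "0 < r" "r < 1" for r
  proof -
    define p where "p = P r + m"
    have kr: "((\<lambda>r. r ^ k / r) has_real_derivative (real k - 1) * r ^ k / r\<^sup>2) (at r)"
      by (rule DERIV_cong[OF DERIV_divide[OF power_k_has_derivative DERIV_ident]])
         (use r in \<open>auto simp: field_simps power2_eq_square\<close>)
    have Pd: "((\<lambda>r. P r + m) has_real_derivative - (P1 r / r)) (at r)"
      using P_deriv[of r] r by (auto intro!: derivative_eq_intros)
    have \<xi>d: "(\<xi> has_real_derivative - (p * \<xi> r / r)) (at r)"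
      unfolding p_def using \<xi>_deriv r by simp
    have "(W has_real_derivative
        (- (p * \<xi> r / r) * D r + (r ^ k * (f (U r) - f (y r))) * \<xi> r)
        - (((real k - 1) * r ^ k / r\<^sup>2) * (p * \<xi> r * d r)
           + ((- (P1 r / r) * \<xi> r + - (p * \<xi> r / r) * p) * d r + - (D r / r ^ k) * (p * \<xi> r)) * (r ^ k / r))) (at r)"
      unfolding W_def[abs_def] p_def
      by (intro DERIV_diff DERIV_mult kr Pd \<xi>d[unfolded p_def] d_deriv D_deriv r)
    then have "(W has_real_derivative \<xi> r * (r ^ k * (f (U r) - f (y r)))
        - \<xi> r * (r ^ k / r\<^sup>2 * d r * (p * (real k - 1 - p) - P1 r))) (at r)"
      by (rule DERIV_cong) (use r in \<open>simp add: field_simps power2_eq_square\<close>)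
    moreover have "f (U r) - f (y r) \<le> d r / r\<^sup>2 * (p * (real k - 1 - p) - P1 r)"
    proof -
      have "A < y r" "A < U r" "0 \<le> d r"
        using y_bounds[of r] r A_neg by (auto simp: d_def)
      then have "f (U r) - f (y r) \<le> f1 (U r) * d r"
        using f_convex[of "U r" "y r"] by (simp add: d_def algebra_simps)
      also have "\<dots> = d r / r\<^sup>2 * ((k - P r) * (1 + P r) - P1 r)"
        using r by (simp add: f1_U)
      \<comment> \<open>With \<open>p = P + m\<close> the right bracket exceeds the left one by
        \<open>m * (k - 1 - 2 * P) - m\<^sup>2 - k\<close>, which by \<open>two_P_le\<close> is at
        least \<open>m\<^sup>2 - k\<close>.\<close>
      also have "\<dots> \<le> d r / r\<^sup>2 * (p * (real k - 1 - p) - P1 r)"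
      proof (intro mult_left_mono)
        have "m * (2 * m) \<le> m * (real k - 1 - 2 * P r)"
          using two_P_le[of r] r m_ge by (intro mult_left_mono) auto
        then show "(k - P r) * (1 + P r) - P1 r \<le> p * (real k - 1 - p) - P1 r"
          using m_square by (simp add: p_def power2_eq_square algebra_simps)
      qed (use \<open>0 \<le> d r\<close> in simp)
      finally show ?thesis .
    qed
    then have "\<xi> r * (r ^ k * (f (U r) - f (y r))) \<le> \<xi> r * (r ^ k * (d r / r\<^sup>2 * (p * (real k - 1 - p) - P1 r)))"
      using \<xi>_pos[of r] r by (intro mult_left_mono) auto
    then have "\<xi> r * (r ^ k * (f (U r) - f (y r)))
        - \<xi> r * (r ^ k / r\<^sup>2 * d r * (p * (real k - 1 - p) - P1 r)) \<le> 0"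
      by simp
    ultimately show ?thesis
      by blast
  qed
  \<comment> \<open>The logarithmic derivative of \<open>r ^ k / r * \<xi>\<^sup>2\<close> is
    \<open>(k - 1 - 2 * (P + m)) / r\<close>, nonnegative by the upper bound on \<open>P\<close>,
    and the value at 1 is 1.\<close>
  have rho: "r ^ k * (\<xi> r)\<^sup>2 \<le> r" if r: "0 < r" "r < 1" for r
  proof -
    define q where "q r = r ^ k / r * (\<xi> r * \<xi> r)" for r
    have "q r \<le> q 1"
    proof (rule DERIV_nonneg_imp_nondecreasing[of r 1 q])
      fix x assume x: "r \<le> x" "x \<le> 1"
      have kx: "((\<lambda>r. r ^ k / r) has_real_derivative (real k - 1) * x ^ k / x\<^sup>2) (at x)"
        by (rule DERIV_cong[OF DERIV_divide[OF power_k_has_derivative DERIV_ident]])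
           (use x r in \<open>auto simp: field_simps power2_eq_square\<close>)
      have "(q has_real_derivative (real k - 1) * x ^ k / x\<^sup>2 * (\<xi> x * \<xi> x)
          + (- ((P x + m) * \<xi> x / x) * \<xi> x + - ((P x + m) * \<xi> x / x) * \<xi> x) * (x ^ k / x)) (at x)"
        unfolding q_def[abs_def] using x r by (intro DERIV_mult kx \<xi>_deriv) auto
      then have "(q has_real_derivative x ^ k / x\<^sup>2 * (\<xi> x * \<xi> x) * (real k - 1 - 2 * (P x + m))) (at x)"
        by (rule DERIV_cong) (use x r in \<open>simp add: field_simps power2_eq_square\<close>)
      moreover have "0 \<le> x ^ k / x\<^sup>2 * (\<xi> x * \<xi> x) * (real k - 1 - 2 * (P x + m))"
        using two_P_le[of x] \<xi>_pos[of x] x r by (intro mult_nonneg_nonneg) (auto simp: less_imp_le)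
      ultimately show "\<exists>y. (q has_real_derivative y) (at x) \<and> 0 \<le> y"
        by blast
    qed (use r in simp)
    then show ?thesis
      using r by (simp add: q_def \<xi>_1 field_simps power2_eq_square)
  qed
  \<comment> \<open>For \<open>r \<le> 1\<close> one has \<open>w \<le> \<xi>\<close> and
    \<open>P + m \<ge> 1\<close>, so towards 0 the function \<open>\<xi>\<close> grows at least as
    fast as \<open>U\<close> and stays above it.\<close>
  have e_le_1: "e r \<le> 1" if r: "0 < r" "r < 1" for r
  proof -
    have "\<xi> 1 - U 1 \<le> \<xi> r - U r"
    proof (rule DERIV_nonpos_imp_nonincreasing[of r 1 "\<lambda>r. \<xi> r - U r"])
      fix x assume x: "r \<le> x" "x \<le> 1"
      have "((\<lambda>r. \<xi> r - U r) has_real_derivative - ((P x + m) * \<xi> x / x) - - w x) (at x)"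
        using x r by (intro DERIV_diff \<xi>_deriv U_deriv) auto
      moreover have "w x \<le> (P x + m) * \<xi> x / x"
      proof -
        have "0 < w x"
          using w_pos x r by simp
        have "1 powr (- m) \<le> x powr (- m)"
          using x r m_ge by (intro powr_mono2') auto
        then have "w x \<le> \<xi> x"
          using \<open>0 < w x\<close> by (simp add: \<xi>_def)
        then have "w x * 1 \<le> \<xi> x * (1 / x)"
          using x r \<open>0 < w x\<close> by (intro mult_mono) auto
        also have "\<dots> \<le> (P x + m) * (\<xi> x * (1 / x))"
          using P_ge[of x] m_ge x r \<xi>_pos[of x] mult_right_mono[of 1 "P x + m" "\<xi> x * (1 / x)"]
          by (simp add: less_imp_le)
        finally show ?thesis
          by simp
      qed
      ultimately show "\<exists>y. ((\<lambda>r. \<xi> r - U r) has_real_derivative y) (at x) \<and> y \<le> 0"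
        by (intro exI[of _ "- ((P x + m) * \<xi> x / x) - - w x"]) simp
    qed (use r in simp)
    then have "d r \<le> \<xi> r"
      using y_bounds[of r] r by (simp add: \<xi>_1 U_1 d_def)
    then show ?thesis
      using \<xi>_pos[of r] r by (simp add: e_def)
  qed
  have "continuous_on {r0..1} \<xi>"
    using r0 by (intro continuous_at_imp_continuous_on ballI DERIV_isCont[OF \<xi>_deriv]) auto
  then have "continuous_on {r0..1} e"
    unfolding e_def[abs_def] using r0 \<xi>_pos
    by (intro continuous_on_divide continuous_on_subset[OF radial_pairD(1)[OF pair]]) (auto simp: less_le)
  moreover have "e differentiable (at x)" if "r0 < x" "x < 1" for x
    using e_deriv[of x] that r0 by (auto simp: real_differentiable_def)
  \<comment> \<open>As \<open>e\<close> falls from a positive value to 0, it has negative slope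
    somewhere, so \<open>W\<close> is positive there; monotonicity of \<open>W\<close> keeps it so
    at all smaller radii.\<close>
  ultimately obtain l r1 where r1: "r0 < r1" "r1 < 1" "(e has_real_derivative l) (at r1)"
    "e 1 - e r0 = (1 - r0) * l"
    using MVT[OF \<open>r0 < 1\<close>] by blast
  have "0 < e r0" "e 1 = 0"
    using \<open>y r0 < U r0\<close> \<xi>_pos[of r0] r0 y(2) U_1 by (auto simp: e_def d_def)
  then have "l < 0"
    using r1(4) \<open>r0 < 1\<close> by (smt (verit) mult_nonneg_nonneg)
  have "0 < r1"
    using r0 r1 by simp
  have "l = - (W r1 / (r1 ^ k * (\<xi> r1)\<^sup>2))"
    by (rule DERIV_unique[OF r1(3) e_deriv]) (use r1 r0 in auto)
  then have "0 < W r1 / (r1 ^ k * (\<xi> r1)\<^sup>2)"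
    using \<open>l < 0\<close> by simp
  moreover have "0 < r1 ^ k * (\<xi> r1)\<^sup>2"
    using \<xi>_pos[of r1] \<open>0 < r1\<close> r1(2) by simp
  ultimately have W_pos: "0 < W r1"
    by (simp add: zero_less_divide_iff)
  define c where "c = W r1"
  have W_ge: "c \<le> W r" if "0 < r" "r \<le> r1" for r
    unfolding c_def
  proof (rule DERIV_nonpos_imp_nonincreasing[OF that(2)])
    fix x assume "r \<le> x" "x \<le> r1"
    with W_deriv_nonpos[of x] that r1 show "\<exists>y. (W has_real_derivative y) (at x) \<and> y \<le> 0"
      by simp
  qed
  \<comment> \<open>Below \<open>r1\<close> the slope of \<open>e\<close> is at most
    \<open>- c / x\<close>, so \<open>e\<close> gains at least \<open>c * ln (r1 / r) = 2\<close>,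
    more than the bound 1 allows.\<close>
  define r where "r = r1 * exp (- 2 / c)"
  have c: "0 < c"
    using W_pos by (simp add: c_def)
  then have r: "0 < r" "r \<le> r1"
    using \<open>0 < r1\<close> by (auto simp: r_def mult_le_cancel_left1 intro: mult_pos_pos)
  have "e r1 + c * ln r1 \<le> e r + c * ln r"
  proof (rule DERIV_nonpos_imp_nonincreasing[of r r1 "\<lambda>r. e r + c * ln r"])
    fix x assume x: "r \<le> x" "x \<le> r1"
    then have x': "0 < x" "x < 1"
      using r r1 by auto
    have "((\<lambda>r. e r + c * ln r) has_real_derivative - (W x / (x ^ k * (\<xi> x)\<^sup>2)) + c * (1 / x)) (at x)"
      using x' by (intro DERIV_add DERIV_cmult e_deriv DERIV_ln_divide) auto
    moreover have "c / x \<le> W x / (x ^ k * (\<xi> x)\<^sup>2)"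
      using W_ge[of x] rho[of x] x x' c \<xi>_pos[of x] by (intro frac_le) auto
    ultimately show "\<exists>y. ((\<lambda>r. e r + c * ln r) has_real_derivative y) (at x) \<and> y \<le> 0"
      by (intro exI[of _ "- (W x / (x ^ k * (\<xi> x)\<^sup>2)) + c * (1 / x)"]) simp
  qed (use r in simp)
  moreover have "ln r = ln r1 - 2 / c"
    using \<open>0 < r1\<close> by (simp add: r_def ln_mult)
  ultimately have "e r1 + 2 \<le> e r"
    using c by (simp add: right_diff_distrib)
  moreover have "0 \<le> e r1"
    using y_bounds[of r1] \<xi>_pos[of r1] r1 \<open>0 < r1\<close> by (simp add: e_def d_def)
  ultimately show False
    using e_le_1[of r] r r1 by simp
qed

end

subsection \<open>Radial functions on the unit ball\<close>

lemma partial_deriv_eq: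
  assumes "(u has_derivative (\<lambda>h. D \<bullet> h)) (at x)"
  shows "partial_deriv b u x = D \<bullet> b"
proof -
  have "((\<lambda>t::real. x + t *\<^sub>R b) has_derivative (\<lambda>t. t *\<^sub>R b)) (at 0)"
    by (auto intro!: derivative_eq_intros)
  moreover have "(u has_derivative (\<lambda>h. D \<bullet> h)) (at (x + 0 *\<^sub>R b))"
    using assms by simp
  ultimately have "((\<lambda>t. u (x + t *\<^sub>R b)) has_derivative (\<lambda>t. D \<bullet> (t *\<^sub>R b))) (at 0)"
    by (rule has_derivative_compose)
  then have "((\<lambda>t. u (x + t *\<^sub>R b)) has_real_derivative D \<bullet> b) (at 0)"
    by (simp add: has_field_derivative_def mult.commute[of _ "D \<bullet> b"])
  then show ?thesis
    unfolding partial_deriv_def by (rule DERIV_imp_deriv)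
qed

lemma has_real_derivative_line:
  assumes "(Du has_derivative blinfun_apply H) (at x)"
  shows "((\<lambda>t. Du (x + t *\<^sub>R b) \<bullet> b) has_real_derivative H b \<bullet> b) (at 0)"
proof -
  have "((\<lambda>t::real. x + t *\<^sub>R b) has_derivative (\<lambda>t. t *\<^sub>R b)) (at 0)"
    by (auto intro!: derivative_eq_intros)
  moreover have "(Du has_derivative blinfun_apply H) (at (x + 0 *\<^sub>R b))"
    using assms by simp
  ultimately have "((\<lambda>t. Du (x + t *\<^sub>R b)) has_derivative (\<lambda>t. H (t *\<^sub>R b))) (at 0)"
    by (rule has_derivative_compose)
  then have "((\<lambda>t. Du (x + t *\<^sub>R b) \<bullet> b) has_derivative (\<lambda>t. H (t *\<^sub>R b) \<bullet> b)) (at 0)"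
    by (rule has_derivative_inner_left)
  then show ?thesis
    by (simp add: has_field_derivative_def blinfun.scaleR_right mult.commute[of _ "H b \<bullet> b"])
qed

lemma eventually_line_in_open:
  fixes x b :: "'a::real_normed_vector"
  assumes "open S" "x \<in> S"
  shows "\<forall>\<^sub>F t::real in nhds 0. x + t *\<^sub>R b \<in> S"
proof -
  have "((\<lambda>t::real. x + t *\<^sub>R b) \<longlongrightarrow> x + 0 *\<^sub>R b) (nhds 0)"
    by (intro tendsto_intros filterlim_ident)
  then show ?thesis
    using assms by (auto simp: tendsto_def)
qed

lemma laplacian_eq:
  fixes u :: "'a::euclidean_space \<Rightarrow> real"
  assumes "open S" "x \<in> S"
    and "\<And>y. y \<in> S \<Longrightarrow> (u has_derivative (\<lambda>h. Du y \<bullet> h)) (at y)"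
    and "(Du has_derivative blinfun_apply H) (at x)"
  shows "laplacian u x = (\<Sum>b\<in>Basis. H b \<bullet> b)"
  unfolding laplacian_def
proof (rule sum.cong)
  fix b :: 'a
  have "\<forall>\<^sub>F t::real in nhds 0. partial_deriv b u (x + t *\<^sub>R b) = Du (x + t *\<^sub>R b) \<bullet> b"
    using eventually_line_in_open[OF assms(1,2), of b]
    by eventually_elim (use partial_deriv_eq assms(3) in blast)
  then have "partial_deriv b (partial_deriv b u) x = deriv (\<lambda>t. Du (x + t *\<^sub>R b) \<bullet> b) 0"
    unfolding partial_deriv_def[of b "partial_deriv b u"] by (rule deriv_cong_ev) simp
  then show "partial_deriv b (partial_deriv b u) x = H b \<bullet> b"
    using DERIV_imp_deriv[OF has_real_derivative_line[OF assms(4), of b]] by simp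
qed simp

lemma second_derivative_nonneg_at_local_min:
  fixes g :: "real \<Rightarrow> real"
  assumes "\<forall>\<^sub>F t in nhds 0. (g has_real_derivative g' t) (at t)" "(g' has_real_derivative c) (at 0)"
    and "\<forall>\<^sub>F t in nhds 0. g 0 \<le> g t"
  shows "0 \<le> c"
proof (rule ccontr)
  assume "\<not> 0 \<le> c"
  obtain d1 where d1: "0 < d1" "\<And>t. \<bar>t\<bar> < d1 \<Longrightarrow> (g has_real_derivative g' t) (at t)"
    using assms(1) by (auto simp: eventually_nhds_metric dist_real_def)
  obtain d2 where d2: "0 < d2" "\<And>t. \<bar>t\<bar> < d2 \<Longrightarrow> g 0 \<le> g t"
    using assms(3) by (auto simp: eventually_nhds_metric dist_real_def)
  have "g' 0 = 0"
    by (rule DERIV_local_min[OF d1(2) d2(1)]) (use d1(1) d2(2) in auto)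
  obtain d3 where d3: "0 < d3" "\<And>h. 0 < h \<Longrightarrow> h < d3 \<Longrightarrow> g' h < 0"
    using DERIV_neg_dec_right[OF assms(2)] \<open>\<not> 0 \<le> c\<close> \<open>g' 0 = 0\<close> by auto
  define t where "t = min d1 (min d2 d3) / 2"
  have t: "0 < t" "t < d1" "t < d2" "t < d3"
    using d1(1) d2(1) d3(1) by (auto simp: t_def)
  have "g t < g 0"
  proof (rule DERIV_neg_imp_decreasing_open[OF t(1)])
    fix s assume "0 < s" "s < t"
    then show "\<exists>y. (g has_real_derivative y) (at s) \<and> y < 0"
      using d1(2)[of s] d3(2)[of s] t by (intro exI[of _ "g' s"]) auto
  next
    show "continuous_on {0..t} g"
    proof (intro continuous_at_imp_continuous_on ballI)
      fix s assume "s \<in> {0..t}"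
      then show "isCont g s"
        using DERIV_isCont[OF d1(2)[of s]] t by auto
    qed
  qed
  then show False
    using d2(2)[of t] t by auto
qed

lemma C2_on_mono:
  assumes "C2_on S u" "T \<subseteq> S"
  shows "C2_on T u"
  using assms interior_mono[OF assms(2)] unfolding C2_on_def
  by (meson continuous_on_subset subsetD)

text \<open>After adding a small multiple of \<open>1 - x \<bullet> x\<close>, a negative minimum of
  \<open>v - u\<close> would lie inside the ball and have a Hessian with nonnegative trace, whereas
  that trace is strictly negative.\<close>

lemma le_if_laplacian_le:
  fixes u v :: "'a::euclidean_space \<Rightarrow> real"
  assumes cont: "continuous_on (cball 0 1) u" "continuous_on (cball 0 1) v"
    and C2: "C2_on (ball 0 1) u" "C2_on (ball 0 1) v"
    and lap: "\<And>x. x \<in> ball 0 1 \<Longrightarrow> laplacian v x \<le> laplacian u x"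
    and bdry: "\<And>x. x \<in> sphere 0 1 \<Longrightarrow> u x \<le> v x"
    and x0: "x0 \<in> cball 0 1"
  shows "u x0 \<le> v x0"
proof (rule ccontr)
  assume "\<not> u x0 \<le> v x0"
  obtain Du D2u where u: "\<And>x. x \<in> ball 0 1 \<Longrightarrow> (u has_derivative (\<lambda>h. Du x \<bullet> h)) (at x)"
    "\<And>x. x \<in> ball 0 1 \<Longrightarrow> (Du has_derivative blinfun_apply (D2u x)) (at x)"
    using C2(1) unfolding C2_on_def interior_open[OF open_ball] by blast
  obtain Dv D2v where v: "\<And>x. x \<in> ball 0 1 \<Longrightarrow> (v has_derivative (\<lambda>h. Dv x \<bullet> h)) (at x)"
    "\<And>x. x \<in> ball 0 1 \<Longrightarrow> (Dv has_derivative blinfun_apply (D2v x)) (at x)"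
    using C2(2) unfolding C2_on_def interior_open[OF open_ball] by blast
  \<comment> \<open>Half the excess at \<open>x0\<close>: the paraboloid added to
    \<open>v - u\<close> is at most \<open>\<epsilon>\<close>, so \<open>\<psi> x0\<close> remains
    negative, and it vanishes on the sphere.\<close>
  define \<epsilon> where "\<epsilon> = (u x0 - v x0) / 2"
  have "0 < \<epsilon>"
    using \<open>\<not> u x0 \<le> v x0\<close> by (simp add: \<epsilon>_def)
  define \<psi> where "\<psi> x = v x - u x + \<epsilon> * (1 - x \<bullet> x)" for x
  have "continuous_on (cball 0 1) \<psi>"
    unfolding \<psi>_def by (intro continuous_intros cont)
  then obtain x1 where x1: "x1 \<in> cball 0 1" "\<And>y. y \<in> cball 0 1 \<Longrightarrow> \<psi> x1 \<le> \<psi> y"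
    using continuous_attains_inf[of "cball (0::'a) 1" \<psi>] by auto
  have "x0 \<bullet> x0 \<ge> 0"
    by simp
  then have "\<epsilon> * (1 - x0 \<bullet> x0) \<le> \<epsilon> * 1"
    using \<open>0 < \<epsilon>\<close> by (intro mult_left_mono) auto
  moreover have "u x0 - v x0 = 2 * \<epsilon>"
    by (simp add: \<epsilon>_def)
  ultimately have "\<psi> x0 < 0"
    using \<open>0 < \<epsilon>\<close> unfolding \<psi>_def by linarith
  then have neg: "\<psi> x1 < 0"
    using x1(2)[OF x0] by simp
  have "x1 \<notin> sphere 0 1"
    using bdry[of x1] neg by (auto simp: \<psi>_def dot_square_norm)
  then have x1b: "x1 \<in> ball 0 1"
    using x1(1) by (auto simp: less_le)
  have second: "0 \<le> (D2v x1 b - D2u x1 b - (2 * \<epsilon>) *\<^sub>R b) \<bullet> b" for b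
  proof (rule second_derivative_nonneg_at_local_min)
    let ?D = "\<lambda>y. Dv y - Du y - (2 * \<epsilon>) *\<^sub>R y"
    have D: "(\<psi> has_derivative (\<lambda>h. ?D y \<bullet> h)) (at y)" if "y \<in> ball 0 1" for y
      unfolding \<psi>_def using u(1)[OF that] v(1)[OF that]
      by (auto intro!: derivative_eq_intros simp: algebra_simps inner_commute)
    have "((\<lambda>t. \<psi> (x1 + t *\<^sub>R b)) has_real_derivative ?D (x1 + t *\<^sub>R b) \<bullet> b) (at t)"
      if "x1 + t *\<^sub>R b \<in> ball 0 1" for t
    proof -
      have "((\<lambda>t::real. x1 + t *\<^sub>R b) has_derivative (\<lambda>t. t *\<^sub>R b)) (at t)"
        by (auto intro!: derivative_eq_intros)
      from has_derivative_compose[OF this D[OF that]] show ?thesis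
        by (simp add: has_field_derivative_def mult.commute[of _ "?D (x1 + t *\<^sub>R b) \<bullet> b"])
    qed
    then show "\<forall>\<^sub>F t in nhds 0. ((\<lambda>t. \<psi> (x1 + t *\<^sub>R b)) has_real_derivative ?D (x1 + t *\<^sub>R b) \<bullet> b) (at t)"
      using eventually_line_in_open[OF open_ball x1b, of b] by (auto elim: eventually_mono)
    have "(?D has_derivative blinfun_apply (D2v x1 - D2u x1 - (2 * \<epsilon>) *\<^sub>R id_blinfun)) (at x1)"
      using u(2)[OF x1b] v(2)[OF x1b] unfolding blinfun.diff_left blinfun.scaleR_left
      by (auto intro!: derivative_eq_intros)
    from has_real_derivative_line[OF this, of b]
    show "((\<lambda>t. ?D (x1 + t *\<^sub>R b) \<bullet> b) has_real_derivative (D2v x1 b - D2u x1 b - (2 * \<epsilon>) *\<^sub>R b) \<bullet> b) (at 0)"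
      by (simp add: blinfun.diff_left blinfun.scaleR_left)
    show "\<forall>\<^sub>F t in nhds 0. \<psi> (x1 + 0 *\<^sub>R b) \<le> \<psi> (x1 + t *\<^sub>R b)"
      using eventually_line_in_open[OF open_ball x1b, of b]
      by eventually_elim (use x1(2) in auto)
  qed
  have "laplacian v x1 - laplacian u x1 - 2 * \<epsilon> * DIM('a) =
      (\<Sum>b\<in>Basis. (D2v x1 b - D2u x1 b - (2 * \<epsilon>) *\<^sub>R b) \<bullet> b)"
    using laplacian_eq[OF open_ball x1b u(1) u(2)[OF x1b]] laplacian_eq[OF open_ball x1b v(1) v(2)[OF x1b]]
    by (simp add: inner_diff_left sum_subtractf)
  also have "\<dots> \<ge> 0"
    by (intro sum_nonneg second)
  finally have "2 * \<epsilon> * DIM('a) \<le> 0"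
    using lap[OF x1b] by simp
  then show False
    using \<open>0 < \<epsilon>\<close> by (simp add: mult_le_0_iff)
qed

section \<open>Regularity of radial Green functions up to the boundary\<close>

context
  fixes h :: "real \<Rightarrow> real" and k :: nat
  assumes h: "continuous_on {0..1} h"
begin

text \<open>
  The gradient of the radial function \<open>green k h (norm x)\<close> is \<open>- (mean_flux r) x\<close> with \<open>r = norm x\<close>;
  \<open>mean_flux\<close> and \<open>anisotropy\<close> are continuous up to \<open>r = 0\<close>, which gives the regularity at the origin.
\<close>

definition mean_flux :: "real \<Rightarrow> real" where
  "mean_flux r = (if r = 0 then h 0 / Suc k else flux k h r / r ^ Suc k)"

definition anisotropy :: "real \<Rightarrow> real" where
  "anisotropy r = h r - Suc k * mean_flux r"

lemma continuous_on_mean_flux: "continuous_on {0..1} mean_flux"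
  unfolding continuous_on_eq_continuous_within
proof
  fix r :: real assume r: "r \<in> {0..1}"
  show "continuous (at r within {0..1}) mean_flux"
  proof (cases "r = 0")
    case True
    have "(mean_flux \<longlongrightarrow> h 0 / Suc k) (at_right 0)"
      by (rule Lim_transform_eventually[OF flux_quotient_limit[OF h, of k]])
         (auto simp: mean_flux_def eventually_at_filter)
    with True show ?thesis
      by (simp add: continuous_within at_within_Icc_at_right mean_flux_def)
  next
    case False
    have "((\<lambda>r. flux k h r / r ^ Suc k) \<longlongrightarrow> flux k h r / r ^ Suc k) (at r within {0..1})"
      using continuous_on_flux[OF h, of k] r False unfolding continuous_on_def
      by (intro tendsto_divide tendsto_power tendsto_ident_at) auto
    then have "(mean_flux \<longlongrightarrow> flux k h r / r ^ Suc k) (at r within {0..1})"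
    proof (rule Lim_transform_within_open[of _ _ _ _ "- {0}"])
    qed (use False in \<open>auto simp: mean_flux_def\<close>)
    with False show ?thesis
      by (simp add: continuous_within mean_flux_def)
  qed
qed

lemma continuous_on_anisotropy: "continuous_on {0..1} anisotropy"
  unfolding anisotropy_def[abs_def] by (intro continuous_intros h continuous_on_mean_flux)

lemma anisotropy_0: "anisotropy 0 = 0"
  by (simp add: anisotropy_def mean_flux_def del: of_nat_Suc)

lemma mean_flux_has_derivative:
  assumes "0 < r" "r < 1"
  shows "(mean_flux has_real_derivative anisotropy r / r) (at r)"
proof -
  have "((\<lambda>r. flux k h r / r ^ Suc k) has_real_derivative
      (r ^ k * h r * r ^ Suc k - flux k h r * (Suc k * r ^ k)) / (r ^ Suc k * r ^ Suc k)) (at r)"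
    using assms DERIV_pow[of "Suc k" r] by (intro DERIV_divide flux_has_derivative h) auto
  then have "((\<lambda>r. flux k h r / r ^ Suc k) has_real_derivative anisotropy r / r) (at r)"
    by (rule DERIV_cong) (use assms in \<open>simp add: anisotropy_def mean_flux_def field_simps del: of_nat_Suc\<close>)
  then show ?thesis
    by (rule has_field_derivative_transform_within_open[of _ _ _ "{0<..}"])
       (use assms in \<open>auto simp: mean_flux_def\<close>)
qed

text \<open>At the origin \<open>norm\<close> is not differentiable; there the quadratic estimate of
  \<open>green_Lipschitz\<close> gives gradient 0.\<close>

lemma radial_has_derivative:
  fixes x :: "'a::euclidean_space"
  assumes "x \<in> ball 0 1"
  shows "((\<lambda>x. green k h (norm x)) has_derivative (\<lambda>v. (- mean_flux (norm x) *\<^sub>R x) \<bullet> v)) (at x)"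
proof (cases "x = 0")
  case False
  then have x: "0 < norm x" "norm x < 1"
    using assms by auto
  have "((\<lambda>x. green k h (norm x)) has_derivative
      (\<lambda>v. (v \<bullet> sgn x) * - (flux k h (norm x) / norm x ^ k))) (at x)"
    using has_derivative_compose[OF has_derivative_norm[OF False]
        green_has_derivative[OF h x, unfolded has_field_derivative_def]]
    by (simp add: mult.commute)
  moreover have "(\<lambda>v. (v \<bullet> sgn x) * - (flux k h (norm x) / norm x ^ k)) = (\<lambda>v. (- mean_flux (norm x) *\<^sub>R x) \<bullet> v)"
    using x by (auto simp: mean_flux_def sgn_div_norm inner_commute field_simps)
  ultimately show ?thesis
    by simp
next
  case True
  obtain M where M: "\<And>t. t \<in> {0..1} \<Longrightarrow> \<bar>h t\<bar> \<le> M" "0 < M"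
    using continuous_on_Icc_bounded[OF h] by blast
  have "((\<lambda>x. green k h (norm x)) has_derivative (\<lambda>v. 0)) (at (0::'a))"
    unfolding has_derivative_at
  proof (intro conjI bounded_linear_zero)
    have "((\<lambda>v::'a. norm v) \<longlongrightarrow> 0) (at 0)"
      by (rule tendsto_norm_zero[OF tendsto_ident_at])
    then show "(\<lambda>v::'a. norm (green k h (norm (0 + v)) - green k h (norm (0::'a)) - 0) / norm v) \<midarrow>0\<rightarrow> 0"
    proof (rule tendsto_0_le[where K = M])
      have "\<forall>\<^sub>F v::'a in at 0. v \<in> ball 0 1"
        by (intro eventually_at_in_open') auto
      then show "\<forall>\<^sub>F v::'a in at 0. norm (norm (green k h (norm (0 + v)) - green k h (norm (0::'a)) - 0) / norm v)
          \<le> norm (norm v) * M"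
      proof eventually_elim
        case (elim v)
        have "\<bar>green k h 0 - green k h (norm v)\<bar> \<le> M * norm v * (norm v - 0)"
          using elim by (intro green_Lipschitz h M(1)) auto
        then have "\<bar>green k h (norm v) - green k h 0\<bar> \<le> (M * norm v) * norm v"
          by (simp add: abs_minus_commute)
        then show ?case
          by (cases "v = 0") (simp_all add: divide_le_eq mult_ac)
      qed
    qed
  qed
  with True show ?thesis
    by simp
qed

text \<open>A multiple of the identity and a rank-one radial correction. At \<open>x = 0\<close>
  division by zero removes the correction, which is the right value because
  \<open>anisotropy\<close> tends to 0.\<close>

definition radial_hessian :: "'a::euclidean_space \<Rightarrow> 'a \<Rightarrow>\<^sub>L 'a" where
  "radial_hessian x = - mean_flux (norm x) *\<^sub>R id_blinfun -
     (anisotropy (norm x) / (norm x)\<^sup>2) *\<^sub>R (blinfun_scaleR_left x o\<^sub>L blinfun_inner_left x)"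

lemma radial_hessian_apply:
  "radial_hessian x v = - mean_flux (norm x) *\<^sub>R v - (anisotropy (norm x) / (norm x)\<^sup>2 * (v \<bullet> x)) *\<^sub>R x"
  by (simp add: radial_hessian_def blinfun.diff_left blinfun.scaleR_left blinfun.minus_left)

lemma radial_gradient_has_derivative:
  fixes x :: "'a::euclidean_space"
  assumes "x \<in> ball 0 1"
  shows "((\<lambda>x. - mean_flux (norm x) *\<^sub>R x) has_derivative blinfun_apply (radial_hessian x)) (at x)"
proof (cases "x = 0")
  case False
  then have x: "0 < norm x" "norm x < 1"
    using assms by auto
  have m: "((\<lambda>x. - mean_flux (norm x)) has_derivative
      (\<lambda>v. - (anisotropy (norm x) / norm x * (v \<bullet> sgn x)))) (at x)"
    using has_derivative_compose[OF has_derivative_norm[OF False]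
        mean_flux_has_derivative[OF x, unfolded has_field_derivative_def]]
    by (intro has_derivative_minus) simp
  show ?thesis
    by (rule has_derivative_eq_rhs[OF has_derivative_scaleR[OF m has_derivative_ident]])
       (use x in \<open>auto simp: radial_hessian_apply sgn_div_norm field_simps power2_eq_square\<close>)
next
  case True
  have "(mean_flux \<longlongrightarrow> mean_flux 0) (at 0 within {0..1})"
    using continuous_on_mean_flux by (auto simp: continuous_on_def)
  moreover have "filterlim (\<lambda>v::'a. norm v) (at 0 within {0..1}) (at 0)"
    unfolding filterlim_at
  proof (intro conjI tendsto_norm_zero[OF tendsto_ident_at])
    have "\<forall>\<^sub>F v::'a in at 0. v \<in> ball 0 1"
      by (intro eventually_at_in_open') auto
    moreover have "\<forall>\<^sub>F v::'a in at 0. v \<noteq> 0"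
      by (simp add: eventually_at_filter)
    ultimately show "\<forall>\<^sub>F v::'a in at 0. norm v \<in> {0..1} \<and> norm v \<noteq> 0"
      by eventually_elim auto
  qed
  ultimately have lim: "((\<lambda>v::'a. mean_flux (norm v)) \<longlongrightarrow> mean_flux 0) (at 0)"
    by (rule filterlim_compose)
  have "((\<lambda>x. - mean_flux (norm x) *\<^sub>R x) has_derivative (\<lambda>v. - mean_flux 0 *\<^sub>R v)) (at (0::'a))"
    unfolding has_derivative_at
  proof (intro conjI bounded_linear_scaleR_right)
    have "((\<lambda>v::'a. mean_flux (norm v) - mean_flux 0) \<longlongrightarrow> 0) (at 0)"
      using tendsto_diff[OF lim tendsto_const[of "mean_flux 0"]] by simp
    then have "((\<lambda>v::'a. \<bar>mean_flux (norm v) - mean_flux 0\<bar>) \<longlongrightarrow> 0) (at 0)"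
      by (rule tendsto_rabs_zero)
    then show "(\<lambda>v::'a. norm (- mean_flux (norm (0 + v)) *\<^sub>R (0 + v) - - mean_flux (norm (0::'a)) *\<^sub>R 0
        - - mean_flux 0 *\<^sub>R v) / norm v) \<midarrow>0\<rightarrow> 0"
    proof (rule Lim_transform_eventually)
      have "norm (- mean_flux (norm v) *\<^sub>R v + mean_flux 0 *\<^sub>R v) / norm v = \<bar>mean_flux (norm v) - mean_flux 0\<bar>"
        if "v \<noteq> 0" for v :: 'a
      proof -
        have "- mean_flux (norm v) *\<^sub>R v + mean_flux 0 *\<^sub>R v = (mean_flux 0 - mean_flux (norm v)) *\<^sub>R v"
          by (simp add: algebra_simps)
        then show ?thesis
          using that by (simp add: abs_minus_commute)
      qed
      then show "\<forall>\<^sub>F v::'a in at 0. \<bar>mean_flux (norm v) - mean_flux 0\<bar> =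
        norm (- mean_flux (norm (0 + v)) *\<^sub>R (0 + v) - - mean_flux (norm (0::'a)) *\<^sub>R 0 - - mean_flux 0 *\<^sub>R v) / norm v"
        by (auto simp: eventually_at_filter)
    qed
  qed
  moreover have "blinfun_apply (radial_hessian (0::'a)) = (\<lambda>v. - mean_flux 0 *\<^sub>R v)"
    by (auto simp: radial_hessian_apply)
  ultimately show ?thesis
    using True by simp
qed

lemma continuous_on_compose_norm:
  "continuous_on {0..1} g \<Longrightarrow> continuous_on (cball (0::'a::euclidean_space) 1) (\<lambda>x. g (norm x))"
  for g :: "real \<Rightarrow> real"
  by (rule continuous_on_compose2[of "{0..1}" g]) (auto intro: continuous_intros)

text \<open>The direction of \<open>x\<close> has no limit at the origin, but the rank-one term is
  bounded by \<open>\<bar>anisotropy (norm x)\<bar>\<close>, which tends to 0.\<close>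

lemma continuous_on_radial_hessian:
  "continuous_on (cball 0 1) (radial_hessian :: 'a::euclidean_space \<Rightarrow> _)"
proof -
  let ?T = "\<lambda>x::'a. (anisotropy (norm x) / (norm x)\<^sup>2) *\<^sub>R (blinfun_scaleR_left x o\<^sub>L blinfun_inner_left x)"
  have an: "continuous_on (cball 0 1) (\<lambda>x::'a. anisotropy (norm x))"
    by (rule continuous_on_compose_norm[OF continuous_on_anisotropy])
  have T_bound: "norm (?T x) \<le> \<bar>anisotropy (norm x)\<bar>" for x :: 'a
  proof (cases "x = 0")
    case False
    have "norm (blinfun_scaleR_left x o\<^sub>L blinfun_inner_left x) \<le> (norm x)\<^sup>2"
    proof (rule norm_blinfun_bound)
      fix y :: 'a
      show "norm ((blinfun_scaleR_left x o\<^sub>L blinfun_inner_left x) y) \<le> (norm x)\<^sup>2 * norm y"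
        using mult_right_mono[OF Cauchy_Schwarz_ineq2[of y x], of "norm x"]
        by (simp add: power2_eq_square mult_ac)
    qed simp
    then have "\<bar>anisotropy (norm x)\<bar> / (norm x)\<^sup>2 * norm (blinfun_scaleR_left x o\<^sub>L blinfun_inner_left x)
        \<le> \<bar>anisotropy (norm x)\<bar> / (norm x)\<^sup>2 * (norm x)\<^sup>2"
      by (intro mult_left_mono) auto
    with False show ?thesis
      by simp
  qed simp
  have "continuous_on (cball 0 1) ?T"
    unfolding continuous_on_eq_continuous_within
  proof
    fix x :: 'a assume x: "x \<in> cball 0 1"
    show "continuous (at x within cball 0 1) ?T"
    proof (cases "x = 0")
      case True
      have "((\<lambda>x::'a. anisotropy (norm x)) \<longlongrightarrow> 0) (at 0 within cball 0 1)"
        using an[unfolded continuous_on_def, rule_format, of 0] anisotropy_0 by simp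
      then have "(?T \<longlongrightarrow> 0) (at 0 within cball 0 1)"
        by (rule tendsto_0_le[where K = 1]) (use T_bound in \<open>auto intro!: always_eventually\<close>)
      with True show ?thesis
        by (simp add: continuous_within)
    next
      case False
      have "((\<lambda>x::'a. anisotropy (norm x)) \<longlongrightarrow> anisotropy (norm x)) (at x within cball 0 1)"
        using an x by (auto simp: continuous_on_def)
      then show ?thesis
        unfolding continuous_within using False
        by (intro tendsto_intros bounded_linear.tendsto[OF bounded_linear_blinfun_scaleR_left]
            bounded_linear.tendsto[OF bounded_linear_blinfun_inner_left]
            bounded_bilinear.tendsto[OF bounded_bilinear_blinfun_compose]) auto
    qed
  qed
  then show ?thesis
    unfolding radial_hessian_def[abs_def]
    by (rule continuous_on_diff[rotated])
       (intro continuous_on_scaleR continuous_on_minus continuous_on_const continuous_on_compose_norm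
         continuous_on_mean_flux)
qed

lemma C2_on_radial: "C2_on (cball 0 1) (\<lambda>x::'a::euclidean_space. green k h (norm x))"
  unfolding C2_on_def
proof (intro exI conjI ballI)
  show "continuous_on (cball 0 1) (\<lambda>x::'a. green k h (norm x))"
    by (intro continuous_on_compose_norm continuous_on_green h)
  show "continuous_on (cball 0 1) (\<lambda>x::'a. - mean_flux (norm x) *\<^sub>R x)"
    by (intro continuous_on_scaleR continuous_on_minus continuous_on_compose_norm continuous_on_mean_flux continuous_on_id)
  show "continuous_on (cball 0 1) (radial_hessian :: 'a \<Rightarrow> _)"
    by (rule continuous_on_radial_hessian)
next
  fix x :: 'a assume "x \<in> interior (cball 0 1)"
  then have x: "x \<in> ball 0 1"
    by simp
  show "((\<lambda>x. green k h (norm x)) has_derivative (\<lambda>v. (- mean_flux (norm x) *\<^sub>R x) \<bullet> v)) (at x)"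
    by (rule radial_has_derivative[OF x])
  show "((\<lambda>x. - mean_flux (norm x) *\<^sub>R x) has_derivative blinfun_apply (radial_hessian x)) (at x)"
    by (rule radial_gradient_has_derivative[OF x])
qed

text \<open>The trace of the Hessian collects \<open>k + 1\<close> copies of
  \<open>mean_flux\<close> and one of \<open>anisotropy\<close>, which is defined so that the mean
  fluxes cancel.\<close>

lemma laplacian_radial:
  fixes x :: "'a::euclidean_space"
  assumes "DIM('a) = Suc k" "x \<in> ball 0 1"
  shows "laplacian (\<lambda>x. green k h (norm x)) x = - h (norm x)"
proof -
  have "laplacian (\<lambda>x. green k h (norm x)) x = (\<Sum>b\<in>Basis. radial_hessian x b \<bullet> b)"
    by (rule laplacian_eq[OF open_ball assms(2) radial_has_derivative radial_gradient_has_derivative[OF assms(2)]])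
  also have "\<dots> = (\<Sum>b\<in>Basis. - mean_flux (norm x) - anisotropy (norm x) / (norm x)\<^sup>2 * ((x \<bullet> b) * (x \<bullet> b)))"
  proof (rule sum.cong)
    fix b :: 'a assume "b \<in> Basis"
    then show "radial_hessian x b \<bullet> b =
        - mean_flux (norm x) - anisotropy (norm x) / (norm x)\<^sup>2 * ((x \<bullet> b) * (x \<bullet> b))"
      by (simp add: radial_hessian_apply inner_diff_left inner_commute[of b x])
  qed simp
  also have "\<dots> = - (Suc k * mean_flux (norm x)) - anisotropy (norm x) / (norm x)\<^sup>2 * (x \<bullet> x)"
    by (simp add: sum_subtractf assms(1) euclidean_inner[of x x] sum_distrib_left sum_negf)
  also have "\<dots> = - (Suc k * mean_flux (norm x)) - anisotropy (norm x)"
    by (cases "x = 0") (simp_all add: anisotropy_0 dot_square_norm)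
  also have "\<dots> = - h (norm x)"
    by (simp add: anisotropy_def)
  finally show ?thesis .
qed

end

subsection \<open>Weak solutions\<close>

text \<open>Polar coordinates as a push-forward under \<open>norm\<close>. It suffices to compare
  both measures on half-lines, whose preimages are shells of known volume.\<close>

lemma distr_norm_ball:
  assumes dim: "DIM('a::euclidean_space) = Suc k"
  shows "distr (lebesgue_on (ball (0::'a) 1)) borel norm =
    density lborel (\<lambda>r. ennreal (indicator {0..1} r * (Suc k * unit_ball_vol (Suc k) * r ^ k)))"
proof (rule measure_eqI_lessThan)
  let ?V = "unit_ball_vol (real (Suc k))"
  have V: "0 \<le> ?V"
    by simp
  have norm_meas: "norm \<in> borel_measurable (lebesgue_on (ball (0::'a) 1))"
    by (intro continuous_imp_measurable_on_sets_lebesgue continuous_intros) auto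
  have left: "emeasure (distr (lebesgue_on (ball (0::'a) 1)) borel norm) {t<..} =
      ennreal (?V * (1 - (max 0 (min 1 t)) ^ Suc k))" for t
  proof -
    have "emeasure (distr (lebesgue_on (ball (0::'a) 1)) borel norm) {t<..} =
        emeasure (lebesgue_on (ball (0::'a) 1)) (norm -` {t<..} \<inter> ball 0 1)"
      by (subst emeasure_distr[OF norm_meas]) auto
    also have "norm -` {t<..} \<inter> ball (0::'a) 1 = ball 0 1 - (if t < 0 then {} else cball 0 t)"
      by (auto intro: less_le_trans[OF _ norm_ge_zero])
    also have "emeasure (lebesgue_on (ball (0::'a) 1)) \<dots> =
        emeasure lborel (ball (0::'a) 1 - (if t < 0 then {} else cball 0 t))"
      by (subst emeasure_restrict_space) auto
    also have "\<dots> = ennreal (?V * (1 - (max 0 (min 1 t)) ^ Suc k))"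
    proof (cases "0 \<le> t \<and> t < 1")
      case True
      then have "emeasure lborel (ball (0::'a) 1 - cball 0 t) = emeasure lborel (ball (0::'a) 1) - emeasure lborel (cball (0::'a) t)"
        by (intro emeasure_Diff) (auto simp: emeasure_cball dim)
      also have "\<dots> = ennreal ?V - ennreal (?V * t ^ Suc k)"
        using True by (simp add: emeasure_cball emeasure_ball dim del: power_Suc of_nat_Suc)
      also have "\<dots> = ennreal (?V - ?V * t ^ Suc k)"
        using True V by (intro ennreal_minus) (auto intro!: mult_nonneg_nonneg)
      finally show ?thesis
        using True by (simp add: right_diff_distrib del: power_Suc of_nat_Suc)
    next
      case False
      have "ball (0::'a) 1 \<subseteq> cball 0 t" if "1 \<le> t"
        using that by auto
      with False show ?thesis
        by (cases "t < 0") (auto simp: emeasure_ball dim Diff_eq_empty_iff[THEN iffD2] simp del: of_nat_Suc)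
    qed
    finally show ?thesis .
  qed
  show "emeasure (distr (lebesgue_on (ball (0::'a) 1)) borel norm) {t<..} < \<infinity>" for t
    unfolding left by simp
  show "emeasure (distr (lebesgue_on (ball (0::'a) 1)) borel norm) {t<..} =
    emeasure (density lborel (\<lambda>r. ennreal (indicator {0..1} r * (Suc k * ?V * r ^ k)))) {t<..}" for t
  proof -
    define s where "s = max 0 (min 1 t)"
    have "emeasure (density lborel (\<lambda>r. ennreal (indicator {0..1} r * (Suc k * ?V * r ^ k)))) {t<..} =
      (\<integral>\<^sup>+r. ennreal (indicator {0..1} r * (Suc k * ?V * r ^ k)) * indicator {t<..} r \<partial>lborel)"
      by (subst emeasure_density) auto
    also have "\<dots> = (\<integral>\<^sup>+r. ennreal (Suc k * ?V * r ^ k) * indicator {s..1} r \<partial>lborel)"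
    proof (rule nn_integral_cong_AE)
      \<comment> \<open>The indicators can differ only at the endpoints \<open>t\<close> and
        1.\<close>
      show "AE r in lborel. ennreal (indicator {0..1} r * (Suc k * ?V * r ^ k)) * indicator {t<..} r =
          ennreal (Suc k * ?V * r ^ k) * indicator {s..1} r"
        using AE_lborel_singleton[of t] AE_lborel_singleton[of 1]
        by eventually_elim (auto simp: s_def indicator_def)
    qed
    also have "\<dots> = ennreal (?V * 1 ^ Suc k - ?V * s ^ Suc k)"
    proof (rule nn_integral_FTC_Icc)
      fix r assume "r \<in> {s..1}"
      then show "0 \<le> Suc k * ?V * r ^ k"
        using V by (auto simp: s_def intro!: mult_nonneg_nonneg)
      have "((\<lambda>r. ?V * r ^ Suc k) has_real_derivative ?V * (real (Suc k) * r ^ k)) (at r)"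
        using DERIV_pow[of "Suc k" r] by (intro DERIV_cmult) simp
      then show "((\<lambda>r. ?V * r ^ Suc k) has_real_derivative Suc k * ?V * r ^ k) (at r)"
        by (simp only: mult_ac)
    qed (auto simp: s_def)
    finally show ?thesis
      unfolding left s_def by (simp add: right_diff_distrib del: power_Suc of_nat_Suc)
  qed
qed auto

lemma integral_radial:
  assumes dim: "DIM('a::euclidean_space) = Suc k" and \<phi>: "continuous_on {0..1} \<phi>"
  shows "(LINT x|lebesgue_on (ball (0::'a) 1). \<phi> (norm x)) =
    Suc k * unit_ball_vol (Suc k) * integral {0..1} (\<lambda>r. r ^ k * \<phi> r)"
proof -
  let ?c = "Suc k * unit_ball_vol (Suc k)"
  define \<phi>' where "\<phi>' r = (if r \<in> {0..1} then \<phi> r else 0)" for r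
  have meas: "\<phi>' \<in> borel_measurable borel"
    unfolding \<phi>'_def by (rule borel_measurable_continuous_on_if[OF _ \<phi>]) auto
  have norm_meas: "norm \<in> borel_measurable (lebesgue_on (ball (0::'a) 1))"
    by (intro continuous_imp_measurable_on_sets_lebesgue continuous_intros) auto
  have "(LINT x|lebesgue_on (ball (0::'a) 1). \<phi> (norm x)) = (LINT x|lebesgue_on (ball (0::'a) 1). \<phi>' (norm x))"
    by (intro Bochner_Integration.integral_cong) (auto simp: \<phi>'_def)
  also have "\<dots> = (LINT r|distr (lebesgue_on (ball (0::'a) 1)) borel norm. \<phi>' r)"
    by (rule integral_distr[symmetric, OF norm_meas meas])
  also have "\<dots> = (LINT r|lborel. (indicator {0..1} r * (?c * r ^ k)) *\<^sub>R \<phi>' r)"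
    unfolding distr_norm_ball[OF dim] using meas by (intro integral_density) (auto intro!: AE_I2 simp: indicator_def)
  also have "\<dots> = (LINT r:{0..1}|lborel. ?c * (r ^ k * \<phi> r))"
    unfolding set_lebesgue_integral_def
    by (intro Bochner_Integration.integral_cong) (auto simp: \<phi>'_def indicator_def)
  also have "\<dots> = integral {0..1} (\<lambda>r. ?c * (r ^ k * \<phi> r))"
    by (intro set_borel_integral_eq_integral borel_integrable_atLeastAtMost' continuous_intros \<phi>)
  also have "\<dots> = ?c * integral {0..1} (\<lambda>r. r ^ k * \<phi> r)"
    by simp
  finally show ?thesis .
qed

text \<open>Green's second identity in radial form: \<open>\<psi>\<close> vanishes at 0 through the
  fluxes and at 1 through the boundary values.\<close>

lemma integral_green_symmetric:
  assumes dim: "DIM('a::euclidean_space) = Suc k"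
    and h: "continuous_on {0..1} h1" "continuous_on {0..1} h2"
  shows "(LINT x|lebesgue_on (ball (0::'a) 1). h1 (norm x) * green k h2 (norm x)) =
    (LINT x|lebesgue_on (ball (0::'a) 1). green k h1 (norm x) * h2 (norm x))"
proof -
  define \<psi> where "\<psi> r = flux k h1 r * green k h2 r - flux k h2 r * green k h1 r" for r
  note cont = continuous_on_flux[OF h(1), of k] continuous_on_flux[OF h(2), of k]
    continuous_on_green[OF h(1), of k] continuous_on_green[OF h(2), of k]
  have "((\<lambda>r. r ^ k * (h1 r * green k h2 r) - r ^ k * (green k h1 r * h2 r)) has_integral \<psi> 1 - \<psi> 0) {0..1}"
  proof (rule fundamental_theorem_of_calculus_interior)
    show "continuous_on {0..1} \<psi>"
      unfolding \<psi>_def[abs_def] by (intro continuous_intros cont)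
    fix r :: real assume "r \<in> {0<..<1}"
    then have r: "0 < r" "r < 1"
      by auto
    have "(\<psi> has_real_derivative (r ^ k * h1 r * green k h2 r + - (flux k h2 r / r ^ k) * flux k h1 r)
        - (r ^ k * h2 r * green k h1 r + - (flux k h1 r / r ^ k) * flux k h2 r)) (at r)"
      unfolding \<psi>_def[abs_def] by (intro DERIV_diff DERIV_mult flux_has_derivative green_has_derivative h r)
    then have "(\<psi> has_real_derivative r ^ k * (h1 r * green k h2 r) - r ^ k * (green k h1 r * h2 r)) (at r)"
      by (rule DERIV_cong) simp
    then show "(\<psi> has_vector_derivative r ^ k * (h1 r * green k h2 r) - r ^ k * (green k h1 r * h2 r)) (at r)"
      by (simp add: has_real_derivative_iff_has_vector_derivative)
  qed simp
  then have "integral {0..1} (\<lambda>r. r ^ k * (h1 r * green k h2 r) - r ^ k * (green k h1 r * h2 r)) = 0"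
    by (simp add: integral_unique \<psi>_def green_1 flux_def)
  then have "integral {0..1} (\<lambda>r. r ^ k * (h1 r * green k h2 r)) = integral {0..1} (\<lambda>r. r ^ k * (green k h1 r * h2 r))"
    by (subst (asm) integral_diff) (auto intro!: integrable_continuous_interval continuous_intros cont h)
  then show ?thesis
    using integral_radial[OF dim continuous_on_mult[OF h(1) cont(4)]]
      integral_radial[OF dim continuous_on_mult[OF cont(3) h(2)]] by simp
qed

lemma borel_measurable_radial:
  fixes \<phi> :: "real \<Rightarrow> real"
  assumes "continuous_on {0..1} \<phi>"
  shows "(\<lambda>x. \<phi> (norm x)) \<in> borel_measurable (lebesgue_on (ball (0::'a::euclidean_space) 1))"
  by (rule continuous_imp_measurable_on_sets_lebesgue,
      rule continuous_on_subset[OF continuous_on_compose_norm[OF assms assms]]) auto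

lemma integrable_mult_radial:
  fixes z :: "'a::euclidean_space \<Rightarrow> real"
  assumes "integrable (lebesgue_on (ball 0 1)) z" "continuous_on {0..1} \<phi>"
  shows "integrable (lebesgue_on (ball 0 1)) (\<lambda>x. z x * \<phi> (norm x))"
proof -
  obtain M where M: "\<And>t. t \<in> {0..1} \<Longrightarrow> \<bar>\<phi> t\<bar> \<le> M" "0 < M"
    using continuous_on_Icc_bounded[OF assms(2)] by blast
  show ?thesis
  proof (rule Bochner_Integration.integrable_bound[OF integrable_mult_right[OF assms(1), of M]])
    show "(\<lambda>x. z x * \<phi> (norm x)) \<in> borel_measurable (lebesgue_on (ball 0 1))"
      by (intro borel_measurable_times borel_measurable_radial assms borel_measurable_integrable)
    have "norm (z x * \<phi> (norm x)) \<le> norm (M * z x)" if "x \<in> ball 0 1" for x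
      using M(1)[of "norm x"] M(2) that mult_right_mono[of "\<bar>\<phi> (norm x)\<bar>" M "\<bar>z x\<bar>"]
      by (simp add: abs_mult mult.commute)
    then show "AE x in lebesgue_on (ball 0 1). norm (z x * \<phi> (norm x)) \<le> norm (M * z x)"
      by (intro AE_I2) simp
  qed
qed

lemma integrable_radial:
  fixes \<phi> :: "real \<Rightarrow> real"
  shows "continuous_on {0..1} \<phi> \<Longrightarrow> integrable (lebesgue_on (ball (0::'a::euclidean_space) 1)) (\<lambda>x. \<phi> (norm x))"
proof -
  assume \<phi>: "continuous_on {0..1} \<phi>"
  have "integrable (lebesgue_on (ball (0::'a) 1)) (\<lambda>x. 1 :: real)"
    by (intro finite_measure.integrable_const finite_measure_lebesgue_on lmeasurable_ball)
  from integrable_mult_radial[OF this \<phi>] show ?thesis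
    by simp
qed

lemma infdist_frontier_ball_ge:
  fixes x :: "'a::euclidean_space"
  assumes "x \<in> ball 0 1"
  shows "1 - norm x \<le> infdist x (frontier (ball 0 1))"
proof -
  have ne: "frontier (ball (0::'a) 1) \<noteq> {}"
    by simp
  have "1 - norm x \<le> dist x y" if "y \<in> frontier (ball 0 1)" for y :: 'a
    using that norm_triangle_ineq2[of y x] by (simp add: dist_norm norm_minus_commute)
  then show ?thesis
    unfolding infdist_notempty[OF ne] by (intro cINF_greatest ne)
qed

context radial_problem
begin

text \<open>A radial Green function is \<open>C\<^sup>2\<close> up to the boundary and vanishes
  there, so it is an admissible test function. Being at most a multiple of
  \<open>1 - norm x\<close>, it inherits integrability from the distance weight.\<close>

lemma weak_solution_test_radial:
  fixes z :: "'a::euclidean_space \<Rightarrow> real"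
  assumes dim: "DIM('a) = Suc k" and z: "weak_solution (ball 0 1) f l z"
    and h: "continuous_on {0..1} h"
  shows "integrable (lebesgue_on (ball 0 1)) (\<lambda>x. f (z x) * green k h (norm x))"
    and "(LINT x|lebesgue_on (ball 0 1). z x * h (norm x)) =
      l * (LINT x|lebesgue_on (ball 0 1). f (z x) * green k h (norm x))"
proof -
  let ?\<delta> = "\<lambda>x::'a. infdist x (frontier (ball 0 1))"
  let ?L = "lebesgue_on (ball (0::'a) 1)"
  have int: "integrable ?L (\<lambda>x. f (z x) * ?\<delta> x)"
    using z by (simp add: weak_solution_def)
  obtain M where M: "\<And>t. t \<in> {0..1} \<Longrightarrow> \<bar>h t\<bar> \<le> M" "0 < M"
    using continuous_on_Icc_bounded[OF h] by blast
  have \<delta>_pos: "0 < ?\<delta> x" if "x \<in> ball 0 1" for x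
    using infdist_frontier_ball_ge[OF that] that by simp
  show "integrable ?L (\<lambda>x. f (z x) * green k h (norm x))"
  proof (rule Bochner_Integration.integrable_bound[OF integrable_mult_right[OF int, of M]])
    \<comment> \<open>Measurability is given for the product with the distance, so the distance,
      positive in the ball, is divided out again.\<close>
    have "(\<lambda>x. (f (z x) * ?\<delta> x) * (green k h (norm x) / ?\<delta> x)) \<in> borel_measurable ?L"
      by (intro borel_measurable_times borel_measurable_divide borel_measurable_radial continuous_on_green h
          borel_measurable_integrable[OF int] continuous_imp_measurable_on_sets_lebesgue continuous_on_infdist
          continuous_on_id) auto
    moreover have "(f (z x) * ?\<delta> x) * (green k h (norm x) / ?\<delta> x) = f (z x) * green k h (norm x)"
      if "x \<in> space ?L" for x
      using \<delta>_pos[of x] that by simp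
    ultimately show "(\<lambda>x. f (z x) * green k h (norm x)) \<in> borel_measurable ?L"
      by (subst measurable_cong[of _ _ "\<lambda>x. (f (z x) * ?\<delta> x) * (green k h (norm x) / ?\<delta> x)"]) simp_all
    have "norm (f (z x) * green k h (norm x)) \<le> norm (M * (f (z x) * ?\<delta> x))" if x: "x \<in> ball 0 1" for x
    proof -
      have "\<bar>green k h (norm x)\<bar> \<le> M * (1 - norm x)"
        using x by (intro green_le h M(1)) auto
      also have "\<dots> \<le> M * ?\<delta> x"
        using infdist_frontier_ball_ge[OF x] M(2) by (intro mult_left_mono) auto
      finally have "\<bar>f (z x)\<bar> * \<bar>green k h (norm x)\<bar> \<le> \<bar>f (z x)\<bar> * (M * ?\<delta> x)"
        by (intro mult_left_mono) auto
      then show ?thesis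
        using M(2) \<delta>_pos[OF x] by (simp add: abs_mult mult_ac)
    qed
    then show "AE x in ?L. norm (f (z x) * green k h (norm x)) \<le> norm (M * (f (z x) * ?\<delta> x))"
      by (intro AE_I2) simp
  qed
  have "C2_on (closure (ball 0 1)) (\<lambda>x::'a. green k h (norm x)) \<and>
      (\<forall>x\<in>frontier (ball (0::'a) 1). green k h (norm x) = 0)"
    using C2_on_radial[OF h] by (simp add: green_1)
  then have "(LINT x|?L. z x * - laplacian (\<lambda>x. green k h (norm x)) x) =
      l * (LINT x|?L. f (z x) * green k h (norm x))"
    using z unfolding weak_solution_def by blast
  moreover have "(LINT x|?L. z x * - laplacian (\<lambda>x. green k h (norm x)) x) = (LINT x|?L. z x * h (norm x))"
    by (intro Bochner_Integration.integral_cong) (simp_all add: laplacian_radial[OF h dim])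
  ultimately show "(LINT x|?L. z x * h (norm x)) = l * (LINT x|?L. f (z x) * green k h (norm x))"
    by simp
qed

text \<open>
  Testing with radial functions only: convexity of \<open>f\<close> replaces the maximum principle, since the
  error term \<open>f1 u (z - u)\<close> is again controlled by the induction hypothesis.
\<close>

lemma integral_iter_le_weak_solution:
  fixes z :: "'a::euclidean_space \<Rightarrow> real"
  assumes dim: "DIM('a) = Suc k" and z: "weak_solution (ball 0 1) f l z" and l: "0 \<le> l"
    and h: "continuous_on {0..1} h" "\<And>r. r \<in> {0..1} \<Longrightarrow> 0 \<le> h r"
  shows "(LINT x|lebesgue_on (ball (0::'a) 1). iter l n (norm x) * h (norm x)) \<le>
    (LINT x|lebesgue_on (ball 0 1). z x * h (norm x))"
  using h
proof (induction n arbitrary: h)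
  case 0
  have "AE x in lebesgue_on (ball 0 1). 0 \<le> z x"
    using z by (simp add: weak_solution_def)
  moreover have "AE x in lebesgue_on (ball (0::'a) 1). 0 \<le> h (norm x)"
    using 0(2) by (intro AE_I2) simp
  ultimately have "AE x in lebesgue_on (ball 0 1). 0 \<le> z x * h (norm x)"
    by eventually_elim simp
  then show ?case
    by (simp add: integral_nonneg_AE)
next
  case (Suc n)
  let ?L = "lebesgue_on (ball (0::'a) 1)"
  define g where "g = green k h"
  define u where "u = iter l n"
  have g: "continuous_on {0..1} g" "\<And>r. r \<in> {0..1} \<Longrightarrow> 0 \<le> g r"
    using continuous_on_green[OF Suc.prems(1)] green_nonneg[OF Suc.prems] by (auto simp: g_def)
  have u: "continuous_on {0..1} u" "\<And>r. r \<in> {0..1} \<Longrightarrow> 0 \<le> u r"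
    using iter_continuous[OF l] iter_nonneg[OF l] by (auto simp: u_def)
  have fu: "continuous_on {0..1} (\<lambda>r. f (u r))" "continuous_on {0..1} (\<lambda>r. f1 (u r))"
    by (rule continuous_on_f_compose[OF u], simp, rule continuous_on_f1_compose[OF u], simp)
  define h' where "h' r = f1 (u r) * g r" for r
  have h': "continuous_on {0..1} h'"
    unfolding h'_def by (intro continuous_on_mult fu g)
  have h'_nonneg: "0 \<le> h' r" if "r \<in> {0..1}" for r
    unfolding h'_def using u(2)[OF that] A_neg by (intro mult_nonneg_nonneg f1_nonneg g that) simp
  have z_int: "integrable ?L z"
    using z by (simp add: weak_solution_def)
  note weak = weak_solution_test_radial[OF dim z Suc.prems(1), folded g_def]
  have i1: "integrable ?L (\<lambda>x. f (u (norm x)) * g (norm x))"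
    by (rule integrable_radial[of "\<lambda>r. f (u r) * g r"]) (intro continuous_intros fu g)
  have i2: "integrable ?L (\<lambda>x. z x * h' (norm x))"
    by (rule integrable_mult_radial[OF z_int h'])
  have i3: "integrable ?L (\<lambda>x. u (norm x) * h' (norm x))"
    by (rule integrable_radial[of "\<lambda>r. u r * h' r"]) (intro continuous_intros u h')
  have "(LINT x|?L. f (u (norm x)) * g (norm x)) \<le> (LINT x|?L. f (u (norm x)) * g (norm x)) +
      ((LINT x|?L. z x * h' (norm x)) - (LINT x|?L. u (norm x) * h' (norm x)))"
    using Suc.IH[OF h' h'_nonneg] by (simp add: u_def)
  also have "\<dots> = (LINT x|?L. f (u (norm x)) * g (norm x) + (z x * h' (norm x) - u (norm x) * h' (norm x)))"
    using i1 i2 i3 by simp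
  also have "\<dots> \<le> (LINT x|?L. f (z x) * g (norm x))"
  proof (rule integral_mono_AE)
    have "AE x in ?L. 0 \<le> z x"
      using z by (simp add: weak_solution_def)
    moreover have "AE x in ?L. x \<in> ball 0 1"
      by (intro AE_I2) simp
    ultimately show "AE x in ?L. f (u (norm x)) * g (norm x) + (z x * h' (norm x) - u (norm x) * h' (norm x))
        \<le> f (z x) * g (norm x)"
    proof eventually_elim
      case (elim x)
      then have "f (u (norm x)) + f1 (u (norm x)) * (z x - u (norm x)) \<le> f (z x)" "0 \<le> g (norm x)"
        using u(2)[of "norm x"] g(2)[of "norm x"] A_neg by (auto intro!: f_convex)
      then have "(f (u (norm x)) + f1 (u (norm x)) * (z x - u (norm x))) * g (norm x) \<le> f (z x) * g (norm x)"
        by (rule mult_right_mono)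
      then show ?case
        by (simp add: h'_def algebra_simps)
    qed
  qed (use i1 i2 i3 weak in auto)
  finally have "l * (LINT x|?L. f (u (norm x)) * g (norm x)) \<le> (LINT x|?L. z x * h (norm x))"
    unfolding weak(2) using l by (intro mult_left_mono)
  \<comment> \<open>Symmetry moves the Green operator from the test weight \<open>h\<close> to the
    source of the next iterate.\<close>
  moreover have "l * (LINT x|?L. f (u (norm x)) * g (norm x)) = (LINT x|?L. iter l (Suc n) (norm x) * h (norm x))"
    using integral_green_symmetric[OF dim iter_source_continuous[OF l, of n] Suc.prems(1)]
    by (simp add: g_def u_def mult.assoc)
  ultimately show ?case
    by simp
qed

text \<open>The iterates decrease in \<open>norm x\<close>, so the value at \<open>r\<close> times
  the volume of the ball of radius \<open>r\<close> is at most their integral; the weight 1 compares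
  that with the integral of \<open>z\<close>.\<close>

lemma iter_bounded_if_weak_solution:
  fixes z :: "'a::euclidean_space \<Rightarrow> real"
  assumes dim: "DIM('a) = Suc k" and z: "weak_solution (ball 0 1) f l z" and l: "0 \<le> l"
    and r: "0 < r" "r \<le> 1"
  shows "\<exists>B. \<forall>n. iter l n r \<le> B"
proof (intro exI allI)
  fix n
  let ?L = "lebesgue_on (ball (0::'a) 1)"
  have meas: "ball (0::'a) r \<in> sets ?L"
    using r by (auto simp: sets_restrict_space_iff)
  have pos: "0 < measure ?L (ball 0 r)"
    using r by (subst measure_restrict_space) auto
  have fin: "emeasure ?L (ball 0 r) < \<infinity>"
    using r by (subst emeasure_restrict_space) (auto simp: emeasure_ball)
  have "iter l n r * measure ?L (ball 0 r) = (LINT x|?L. iter l n r * indicator (ball 0 r) x)"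
    using meas r by (simp add: Int_absorb2 subset_ball)
  also have "\<dots> \<le> (LINT x|?L. iter l n (norm x) * 1)"
  proof (rule integral_mono)
    show "integrable ?L (\<lambda>x. iter l n r * indicator (ball 0 r) x)"
      using meas fin by (intro integrable_mult_right integrable_real_indicator) auto
    show "integrable ?L (\<lambda>x. iter l n (norm x) * 1)"
      using integrable_radial[OF iter_continuous[OF l]] by simp
    show "iter l n r * indicator (ball 0 r) x \<le> iter l n (norm x) * 1" if "x \<in> space ?L" for x
      using that iter_antimono[OF l, of "norm x" r n] iter_nonneg[OF l, of "norm x" n] r
      by (auto simp: indicator_def)
  qed
  also have "\<dots> \<le> (LINT x|?L. z x * 1)"
    by (rule integral_iter_le_weak_solution[OF dim z l, of "\<lambda>r. 1"]) auto
  finally show "iter l n r \<le> (LINT x|?L. z x * 1) / measure ?L (ball 0 r)"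
    using pos by (simp add: pos_le_divide_eq)
qed

end

subsection \<open>The extremal solution\<close>

context radial_problem
begin

text \<open>The solution \<open>v\<close> may be nonradial, hence the comparison uses the maximum
  principle on the ball rather than the radial one.\<close>

lemma iter_le_classical_solution:
  fixes v :: "'a::euclidean_space \<Rightarrow> real"
  assumes dim: "DIM('a) = Suc k" and v: "classical_solution (ball 0 1) f l v" and l: "0 \<le> l"
    and x: "x \<in> cball 0 1"
  shows "iter l n (norm x) \<le> v x"
  using x
proof (induction n arbitrary: x)
  case 0
  then show ?case
    using v by (cases "x \<in> ball 0 1") (auto simp: classical_solution_def less_imp_le)
next
  case (Suc n)
  let ?h = "\<lambda>r. l * f (iter l n r)"
  note h = iter_source_continuous[OF l, of n]
  have "green k ?h (norm x) \<le> v x"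
  proof (rule le_if_laplacian_le[OF _ _ _ _ _ _ Suc.prems])
    show "continuous_on (cball 0 1) (\<lambda>x::'a. green k ?h (norm x))"
      using C2_on_radial[OF h] by (auto simp: C2_on_def)
    show "C2_on (ball 0 1) (\<lambda>x::'a. green k ?h (norm x))"
      by (rule C2_on_mono[OF C2_on_radial[OF h]]) auto
    show "laplacian v x \<le> laplacian (\<lambda>x. green k ?h (norm x)) x" if "x \<in> ball 0 1" for x
    proof -
      have "f (iter l n (norm x)) \<le> f (v x)"
        using Suc.IH[of x] that by (intro f_mono iter_nonneg l) auto
      then have "l * f (iter l n (norm x)) \<le> l * f (v x)"
        using l by (intro mult_left_mono)
      moreover have "- laplacian v x = l * f (v x)"
        using v that by (auto simp: classical_solution_def)
      ultimately show ?thesis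
        using laplacian_radial[OF h dim that] by simp
    qed
    show "green k ?h (norm x) \<le> v x" if "x \<in> sphere 0 1" for x
      using v that by (auto simp: classical_solution_def green_1)
  qed (use v in \<open>auto simp: classical_solution_def\<close>)
  then show ?case
    by simp
qed

text \<open>A multiple of the torsion function of the ball, an explicit lower barrier for strict
  positivity.\<close>

lemma green_const:
  assumes "0 < r" "r \<le> 1"
  shows "green k (\<lambda>r. c) r = c * (1 - r\<^sup>2) / (2 * (real k + 1))"
proof (rule green_eq_if_radial_pair[symmetric, OF _ _ _ assms])
  show "radial_pair k (\<lambda>r. c) (\<lambda>r. c * (1 - r\<^sup>2) / (2 * (real k + 1))) (\<lambda>r. c * r ^ Suc k / (real k + 1))"
    unfolding radial_pair_def
  proof (intro conjI ballI)
    show "continuous_on {0<..1} (\<lambda>r::real. c * (1 - r\<^sup>2) / (2 * (real k + 1)))"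
      by (intro continuous_intros) simp
    fix r :: real assume r: "r \<in> {0<..<1}"
    have "((\<lambda>r. c * (1 - r\<^sup>2) / (2 * (real k + 1))) has_real_derivative c * (0 - 2 * r) / (2 * (real k + 1))) (at r)"
      by (auto intro!: derivative_eq_intros )
    then show "((\<lambda>r. c * (1 - r\<^sup>2) / (2 * (real k + 1))) has_real_derivative - (c * r ^ Suc k / (real k + 1) / r ^ k)) (at r)"
      by (rule DERIV_cong) (use r in \<open>simp add: divide_simps\<close>)
    have "((\<lambda>r. c * r ^ Suc k / (real k + 1)) has_real_derivative c * ((real k + 1) * r ^ k) / (real k + 1)) (at r)"
      using DERIV_pow[of "Suc k" r] by (intro DERIV_cdivide DERIV_cmult) (simp add: add.commute)
    then show "((\<lambda>r. c * r ^ Suc k / (real k + 1)) has_real_derivative r ^ k * c) (at r)"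
      by (rule DERIV_cong) (use of_nat_0_le_iff[of k, where 'a = real] in \<open>simp add: add_eq_0_iff\<close>)
  next
    have "((\<lambda>r. c * r ^ Suc k / (real k + 1)) \<longlongrightarrow> c * 0 ^ Suc k / (real k + 1)) (at_right 0)"
      by (intro tendsto_intros) simp
    then show "((\<lambda>r. c * r ^ Suc k / (real k + 1)) \<longlongrightarrow> 0) (at_right 0)"
      by simp
  qed
qed simp_all

text \<open>On the closed ball this is \<open>lim_iter a (norm x)\<close> when the iterates are
  uniformly bounded; the Green form makes its regularity and Laplacian directly available.\<close>

definition radial_solution :: "real \<Rightarrow> 'a::euclidean_space \<Rightarrow> real" where
  "radial_solution a x = green k (\<lambda>r. a * f (lim_iter a r)) (norm x)"

context
  fixes a T :: real
  assumes a: "0 < a" and T: "\<And>n r. 0 < r \<Longrightarrow> r \<le> 1 \<Longrightarrow> iter a n r \<le> T"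
begin

lemma lim_iter_properties:
  "continuous_on {0..1} (lim_iter a)"
  "r \<in> {0..1} \<Longrightarrow> lim_iter a r = green k (\<lambda>r. a * f (lim_iter a r)) r"
  "r \<in> {0..1} \<Longrightarrow> 0 \<le> lim_iter a r"
  "r \<in> {0..1} \<Longrightarrow> (\<lambda>n. iter a n r) \<longlonglongrightarrow> lim_iter a r"
  using lim_iter_solution[OF less_imp_le[OF a] T] by auto

lemma radial_solution_eq: "x \<in> cball 0 1 \<Longrightarrow> radial_solution a x = lim_iter a (norm x)"
  using lim_iter_properties(2)[of "norm x"] by (simp add: radial_solution_def)

lemma minimal_solution_radial:
  assumes dim: "DIM('a::euclidean_space) = Suc k"
  shows "minimal_solution (ball 0 1) f a (radial_solution a :: 'a \<Rightarrow> real)"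
proof -
  let ?h = "\<lambda>r. a * f (lim_iter a r)"
  have h: "continuous_on {0..1} ?h"
    by (intro continuous_on_mult continuous_on_const continuous_on_f_compose lim_iter_properties)
  have h_ge: "a * f 0 \<le> ?h r" if "r \<in> {0..1}" for r
    using a lim_iter_properties(3)[OF that] by (intro mult_left_mono f_mono) auto
  have af0: "0 < a * f 0"
    using a f_pos[of 0] A_neg by simp
  have pos: "0 < green k ?h r" if r: "0 \<le> r" "r < 1" for r
  proof -
    \<comment> \<open>The explicit barrier is available at positive radii; moving to a larger radius
      below 1 and using monotonicity includes \<open>r = 0\<close>.\<close>
    define s where "s = (1 + r) / 2"
    have s: "r \<le> s" "0 < s" "s < 1"
      using r by (auto simp: s_def)
    have "s\<^sup>2 < 1"
      using s by (simp add: power_less_one_iff)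
    then have "0 < green k (\<lambda>r. a * f 0) s"
      using green_const[of s "a * f 0"] s af0 by simp
    also have "\<dots> \<le> green k ?h s"
      using s by (intro green_mono h h_ge continuous_on_const) auto
    also have "\<dots> \<le> green k ?h r"
    proof (rule green_antimono[OF h])
      fix t :: real assume "t \<in> {0..1}"
      then show "0 \<le> ?h t"
        using h_ge[of t] af0 by linarith
    qed (use r s in auto)
    finally show ?thesis .
  qed
  have "classical_solution (ball 0 1) f a (radial_solution a :: 'a \<Rightarrow> real)"
    unfolding classical_solution_def
  proof (intro conjI ballI)
    show "continuous_on (closure (ball 0 1)) (radial_solution a :: 'a \<Rightarrow> real)"
      using C2_on_radial[OF h, where 'a = 'a] by (auto simp: C2_on_def radial_solution_def[abs_def])
    show "C2_on (ball 0 1) (radial_solution a :: 'a \<Rightarrow> real)"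
      unfolding radial_solution_def[abs_def] by (rule C2_on_mono[OF C2_on_radial[OF h]]) auto
    fix x :: 'a
    show "radial_solution a x = 0" if "x \<in> frontier (ball 0 1)"
      using that by (simp add: radial_solution_def green_1)
    assume x: "x \<in> ball 0 1"
    show "- laplacian (radial_solution a) x = a * f (radial_solution a x)"
      using laplacian_radial[OF h dim x] radial_solution_eq[of x] x
      by (simp add: radial_solution_def[abs_def])
    show "0 < radial_solution a x"
      using pos x by (simp add: radial_solution_def)
  qed
  moreover have "radial_solution a x \<le> v x"
    if v: "classical_solution (ball 0 1) f a v" and x: "x \<in> closure (ball 0 1)" for v and x :: 'a
  proof -
    have x: "x \<in> cball 0 1"
      using x by simp
    have "lim_iter a (norm x) \<le> v x"
      by (rule LIMSEQ_le_const2[OF lim_iter_properties(4)])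
         (use x iter_le_classical_solution[OF dim v less_imp_le[OF a] x] in auto)
    then show ?thesis
      using radial_solution_eq[OF x] by simp
  qed
  ultimately show ?thesis
    by (simp add: minimal_solution_def)
qed

lemma lim_iter_antimono: "0 \<le> r \<Longrightarrow> r \<le> s \<Longrightarrow> s \<le> 1 \<Longrightarrow> lim_iter a s \<le> lim_iter a r"
  by (rule LIMSEQ_le[OF lim_iter_properties(4) lim_iter_properties(4)])
     (use iter_antimono[OF less_imp_le[OF a]] in auto)

end

end

section \<open>Extremality of the singular profile at parameter 1\<close>

context singular_profile
begin

lemma iter_1_le_U: "0 < r \<Longrightarrow> r \<le> 1 \<Longrightarrow> iter 1 n r \<le> U r"
  by (rule iter_le_supersolution[OF _ radial_pair_U]) (use U_nonneg in auto)

lemma lim_iter_1_eq_U: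
  assumes "0 < r" "r \<le> 1"
  shows "lim_iter 1 r = U r"
proof -
  have bounded: "\<exists>B. \<forall>n. iter 1 n r \<le> B" if "0 < r" "r \<le> 1" for r
    using iter_1_le_U[OF that] by blast
  obtain z where z: "radial_pair k (\<lambda>r. 1 * f (lim_iter 1 r)) (lim_iter 1) z"
    using lim_iter_radial_pair[OF _ bounded] by force
  have "0 \<le> lim_iter 1 r \<and> lim_iter 1 r \<le> U r" if "0 < r" "r \<le> 1" for r
    using lim_iter_nonneg[OF _ bounded that] LIMSEQ_le_const2[OF iter_tendsto[OF _ bounded that]]
      iter_1_le_U[OF that] by auto
  from eq_U_if_solution_le_U[OF _ lim_iter_1 this assms] z show ?thesis
    by simp
qed

lemma not_bounded_U: "\<exists>r. 0 < r \<and> r < 1 \<and> T < U r"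
proof -
  have "\<forall>\<^sub>F r in at_right 0. T < U r"
    using U_at_top by (auto simp: filterlim_at_top_dense)
  moreover have "\<forall>\<^sub>F r::real in at_right 0. 0 < r \<and> r < 1"
    by (rule eventually_in_unit_interval)
  ultimately have "\<forall>\<^sub>F r in at_right 0. 0 < r \<and> r < 1 \<and> T < U r"
    by eventually_elim auto
  then show ?thesis
    using eventually_happens'[OF trivial_limit_at_right_real] by blast
qed

text \<open>Transforming \<open>U\<close> itself yields a bounded supersolution for each parameter
  below 1, which makes the minimal solutions there classical.\<close>

lemma iter_bounded_below_1:
  assumes "0 < a" "a < 1"
  obtains T where "\<And>n r. 0 < r \<Longrightarrow> r \<le> 1 \<Longrightarrow> iter a n r \<le> T"
proof -
  have pair: "radial_pair k (\<lambda>r. 1 * f (U r)) U (\<lambda>r. r ^ k * w r)"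
    using radial_pair_U by simp
  obtain T v zv h where v: "radial_pair k h v zv" "\<And>r. 0 < r \<Longrightarrow> r < 1 \<Longrightarrow> a * f (v r) \<le> h r"
    "\<And>r. 0 < r \<Longrightarrow> r \<le> 1 \<Longrightarrow> 0 \<le> v r" "\<And>r. 0 < r \<Longrightarrow> r \<le> 1 \<Longrightarrow> v r \<le> T"
  proof (rule bounded_supersolution[OF pair U_nonneg assms recip_integral_le])
  qed (assumption+ | (rule that; assumption))+
  have "iter a n r \<le> T" if "0 < r" "r \<le> 1" for n r
    using iter_le_supersolution[OF less_imp_le[OF assms(1)] v(1,2,3) that, of n] v(4)[OF that] by simp
  then show thesis
    by (rule that)
qed

text \<open>Bounded iterates for \<open>l > 1\<close> would converge to a solution whose transform
  is a bounded supersolution for parameter 1, and this would bound \<open>U\<close>. Classical and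
  weak solutions both bound the iterates, so both are excluded.\<close>

lemma iter_not_bounded_above_1:
  assumes "1 < l" and bounded: "\<And>r. 0 < r \<Longrightarrow> r \<le> 1 \<Longrightarrow> \<exists>B. \<forall>n. iter l n r \<le> B"
  shows False
proof -
  obtain z where z: "radial_pair k (\<lambda>r. l * f (lim_iter l r)) (lim_iter l) z"
    using lim_iter_radial_pair[OF _ bounded] assms(1) by force
  have nonneg: "0 \<le> lim_iter l r" if "0 < r" "r \<le> 1" for r
    using lim_iter_nonneg[OF _ bounded that] assms(1) by simp
  obtain T v zv h where v: "radial_pair k h v zv" "\<And>r. 0 < r \<Longrightarrow> r < 1 \<Longrightarrow> 1 * f (v r) \<le> h r"
    "\<And>r. 0 < r \<Longrightarrow> r \<le> 1 \<Longrightarrow> 0 \<le> v r" "\<And>r. 0 < r \<Longrightarrow> r \<le> 1 \<Longrightarrow> v r \<le> T"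
  proof (rule bounded_supersolution[OF z nonneg zero_less_one assms(1) recip_integral_le])
  qed (assumption+ | (rule that; assumption))+
  have "U r \<le> T" if r: "0 < r" "r \<le> 1" for r
  proof -
    have "iter 1 n r \<le> T" for n
      using iter_le_supersolution[OF zero_le_one v(1,2,3) r, of n] v(4)[OF r] by simp
    then have "lim_iter 1 r \<le> T"
      unfolding lim_iter_def by (intro cSUP_least) auto
    then show ?thesis
      using lim_iter_1_eq_U[OF r] by simp
  qed
  then show False
    using not_bounded_U[of T] by force
qed

lemma lim_iter_le_U: "0 < a \<Longrightarrow> a < 1 \<Longrightarrow> 0 < r \<Longrightarrow> r \<le> 1 \<Longrightarrow> lim_iter a r \<le> U r"
  unfolding lim_iter_def
proof (intro cSUP_least)
  fix n assume "0 < a" "a < 1" "0 < r" "r \<le> 1"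
  then show "iter a n r \<le> U r"
    using iter_mono_parameter[of a 1 r n] iter_1_le_U[of r n] by simp
qed simp

lemma iter_le_lim_iter_below_1:
  "0 < a \<Longrightarrow> a < 1 \<Longrightarrow> 0 < r \<Longrightarrow> r \<le> 1 \<Longrightarrow> iter a n r \<le> lim_iter a r"
  by (rule iter_bounded_below_1[of a]) (auto intro!: iter_le_lim_iter)

text \<open>\<open>U\<close> lies above all minimal solutions. Conversely some single iterate at
  parameter 1 already exceeds \<open>y\<close>, and it depends continuously on the parameter; this
  exchanges the limits in \<open>n\<close> and in the parameter.\<close>

lemma lim_iter_tendsto_U:
  assumes r: "0 < r" "r \<le> 1"
  shows "((\<lambda>a. lim_iter a r) \<longlongrightarrow> U r) (at_left 1)"
proof (rule order_tendstoI)
  have ev: "\<forall>\<^sub>F a::real in at_left 1. 0 < a \<and> a < 1"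
    by (auto simp: eventually_at_left_field intro!: exI[of _ 0])
  show "\<forall>\<^sub>F a in at_left 1. lim_iter a r < y" if "U r < y" for y
    using ev by eventually_elim (use lim_iter_le_U[OF _ _ r] that in force)
  show "\<forall>\<^sub>F a in at_left 1. y < lim_iter a r" if y: "y < U r" for y
  proof -
    have bounded: "\<exists>B. \<forall>n. iter 1 n r \<le> B" if "0 < r" "r \<le> 1" for r
      using iter_1_le_U[OF that] by blast
    have "(\<lambda>n. iter 1 n r) \<longlonglongrightarrow> U r"
      using iter_tendsto[OF zero_le_one bounded r] lim_iter_1_eq_U[OF r] by simp
    then obtain n where n: "y < iter 1 n r"
      using order_tendstoD(1)[OF _ y] eventually_happens'[OF sequentially_bot] by blast
    obtain C where C: "\<And>a. 0 \<le> a \<Longrightarrow> a \<le> 1 \<Longrightarrow> iter 1 n r - iter a n r \<le> C * (1 - a)"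
      using iter_parameter_Lipschitz[of n] r by (metis atLeastAtMost_iff less_imp_le)
    have "((\<lambda>a. iter 1 n r - C * (1 - a)) \<longlongrightarrow> iter 1 n r - C * (1 - 1)) (at_left 1)"
      by (intro tendsto_intros)
    then have "\<forall>\<^sub>F a in at_left 1. y < iter 1 n r - C * (1 - a)"
      using n by (intro order_tendstoD(1)) auto
    with ev show ?thesis
    proof eventually_elim
      case (elim a)
      then show ?case
        using C[of a] iter_le_lim_iter_below_1[of a r n] r by linarith
    qed
  qed
qed

definition singular_solution :: "'a::euclidean_space \<Rightarrow> ereal" where
  "singular_solution x = (if x = 0 then \<infinity> else ereal (U (norm x)))"

context
  assumes dim: "DIM('a::euclidean_space) = Suc k"
begin

lemma minimal_solution_below_1:
  assumes "0 < a" "a < 1"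
  shows "minimal_solution (ball 0 1) f a (radial_solution a :: 'a \<Rightarrow> real)"
  by (rule iter_bounded_below_1[OF assms]) (rule minimal_solution_radial[OF assms(1) _ dim])

lemma extremal_parameter_1: "extremal_parameter (ball (0::'a) 1) f 1"
  unfolding extremal_parameter_def
proof (intro conjI allI impI)
  show "\<exists>u. minimal_solution (ball (0::'a) 1) f a u" if "0 < a \<and> a < 1" for a
    using minimal_solution_below_1 that by blast
  fix l :: real assume l: "1 < l"
  show "\<nexists>u. classical_solution (ball (0::'a) 1) f l u"
  proof
    assume "\<exists>u. classical_solution (ball (0::'a) 1) f l u"
    then obtain u where u: "classical_solution (ball (0::'a) 1) f l u" ..
    have "\<exists>B. \<forall>n. iter l n r \<le> B" if r: "0 < r" "r \<le> 1" for r
    proof -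
      obtain x :: 'a where x: "norm x = r"
        using vector_choose_size[of r] r by auto
      then have "\<forall>n. iter l n r \<le> u x"
        using iter_le_classical_solution[OF dim u, of x] l r by auto
      then show ?thesis
        by blast
    qed
    then show False
      using iter_not_bounded_above_1[OF l] by blast
  qed
  show "\<nexists>u. weak_solution (ball (0::'a) 1) f l u"
    using iter_bounded_if_weak_solution[OF dim] iter_not_bounded_above_1[OF l] l
    by (meson less_imp_le less_trans zero_less_one)
qed simp

lemma extremal_solution_singular: "extremal_solution (ball 0 1) f (singular_solution :: 'a \<Rightarrow> ereal)"
  unfolding extremal_solution_def
proof (intro exI[of _ 1] exI[of _ radial_solution] conjI allI impI ballI extremal_parameter_1)
  show "minimal_solution (ball 0 1) f l (radial_solution l :: 'a \<Rightarrow> real)" if "0 < l \<and> l < 1" for l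
    using minimal_solution_below_1 that by blast
  fix x :: 'a assume x: "x \<in> ball 0 1"
  have ev: "\<forall>\<^sub>F a::real in at_left 1. 0 < a \<and> a < 1"
    by (auto simp: eventually_at_left_field intro!: exI[of _ 0])
  have eq: "radial_solution a x = lim_iter a (norm x)" if "0 < a" "a < 1" for a
    by (rule iter_bounded_below_1[OF that], rule radial_solution_eq[OF that(1)]) (use x in auto)
  show "((\<lambda>l. ereal (radial_solution l x)) \<longlongrightarrow> singular_solution x) (at_left 1)"
  proof (cases "x = 0")
    case False
    have "((\<lambda>l. ereal (lim_iter l (norm x))) \<longlongrightarrow> ereal (U (norm x))) (at_left 1)"
      using lim_iter_tendsto_U[of "norm x"] False x by (intro tendsto_ereal) auto
    then have "((\<lambda>l. ereal (radial_solution l x)) \<longlongrightarrow> ereal (U (norm x))) (at_left 1)"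
      by (rule Lim_transform_eventually) (use ev in eventually_elim, simp add: eq)
    with False show ?thesis
      by (simp add: singular_solution_def)
  next
    case True
    \<comment> \<open>Each minimal solution is largest at the centre, so it dominates there its
      value at radius \<open>r\<close>, which tends to \<open>U r > M\<close>.\<close>
    have "\<forall>\<^sub>F l in at_left 1. ereal M < ereal (radial_solution l x)" for M
    proof -
      obtain r where r: "0 < r" "r < 1" "M < U r"
        using not_bounded_U by blast
      then have "\<forall>\<^sub>F l in at_left 1. M < lim_iter l r"
        by (intro order_tendstoD(1)[OF lim_iter_tendsto_U]) auto
      with ev show ?thesis
      proof eventually_elim
        case (elim l)
        obtain T where T: "\<And>n r. 0 < r \<Longrightarrow> r \<le> 1 \<Longrightarrow> iter l n r \<le> T"
          using iter_bounded_below_1[of l] elim by blast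
        have "lim_iter l r \<le> lim_iter l 0"
          by (rule lim_iter_antimono[OF _ T]) (use elim r in auto)
        with elim True eq[of l] show ?case
          by simp
      qed
    qed
    with True show ?thesis
      by (simp add: singular_solution_def tendsto_PInfty)
  qed
qed

text \<open>By monotonicity \<open>U\<close> exceeds any given bound on a whole ball around 0, a set
  of positive measure.\<close>

lemma ess_unbounded_singular: "ess_unbounded_on (ball 0 1) (singular_solution :: 'a \<Rightarrow> ereal)"
  unfolding ess_unbounded_on_def
proof
  assume "\<exists>M. AE x::'a in lebesgue_on (ball 0 1). singular_solution x \<le> ereal M"
  then obtain M where M: "AE x::'a in lebesgue_on (ball 0 1). singular_solution x \<le> ereal M" ..
  obtain d where d: "0 < d" "d < 1" "M < U d"
    using not_bounded_U by blast
  have "ereal M < singular_solution x" if "x \<in> ball 0 d" for x :: 'a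
    using U_antimono[of "norm x" d] d that by (auto simp: singular_solution_def)
  then have "AE x::'a in lebesgue_on (ball 0 1). x \<notin> ball 0 d"
    using M by (auto elim!: eventually_mono simp: not_le[symmetric] simp del: mem_ball_0)
  moreover have "ball (0::'a) d \<in> sets (lebesgue_on (ball 0 1))"
    using d by (auto simp: sets_restrict_space_iff)
  ultimately have "emeasure (lebesgue_on (ball 0 1)) (ball (0::'a) d) = 0"
    using AE_iff_null_sets null_setsD1 by blast
  moreover have "emeasure (lebesgue_on (ball 0 1)) (ball (0::'a) d) = emeasure lborel (ball (0::'a) d)"
    using d by (subst emeasure_restrict_space) auto
  moreover have "0 < emeasure lborel (ball (0::'a) d)"
    using d by (simp add: emeasure_ball dim)
  ultimately show False
    by simp
qed

end

end

subsection \<open>The oscillating nonlinearity\<close>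

lemma Limsup_ge_if_subsequence:
  fixes f :: "'b \<Rightarrow> ereal"
  assumes "filterlim x F sequentially" "(\<lambda>n. f (x n)) \<longlonglongrightarrow> c"
  shows "c \<le> Limsup F f"
proof -
  have "c = Limsup sequentially (\<lambda>n. f (x n))"
    using lim_imp_Limsup[OF _ assms(2)] by simp
  also have "\<dots> \<le> Limsup (filtermap x sequentially) f"
    by (rule Limsup_filtermap_ge)
  also have "\<dots> \<le> Limsup F f"
    using assms(1) unfolding filterlim_def Limsup_def le_filter_def by (intro INF_superset_mono) auto
  finally show ?thesis .
qed

lemma Liminf_le_if_subsequence:
  fixes f :: "'b \<Rightarrow> ereal"
  assumes "filterlim x F sequentially" "(\<lambda>n. f (x n)) \<longlonglongrightarrow> c"
  shows "Liminf F f \<le> c"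
proof -
  have "Liminf F f \<le> Liminf (filtermap x sequentially) f"
    using assms(1) unfolding filterlim_def Liminf_def le_filter_def by (intro SUP_subset_mono) auto
  also have "\<dots> \<le> Liminf sequentially (\<lambda>n. f (x n))"
    by (rule Liminf_filtermap_le)
  also have "\<dots> = c"
    using lim_imp_Liminf[OF _ assms(2)] by simp
  finally show ?thesis .
qed

text \<open>The number \<open>1 / ((k + 2) * k)\<close> absorbs the amplitude
  \<open>a \<le> k\<close> and the coefficient, at most \<open>k + 1\<close>, that arises when
  \<open>(k - p) * (1 + p)\<close> is differentiated.\<close>

locale oscillating_profile =
  fixes k :: nat and C1 C2 :: real and b b1 b2 :: "real \<Rightarrow> real" and s :: "nat \<Rightarrow> real"
  assumes k_ge_9: "9 \<le> k" and C1_nonneg: "0 \<le> C1" and C1_le_C2: "C1 \<le> C2"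
    and C2_ge: "2 * (real k - 1) \<le> C2" and C2_le: "C2 \<le> (real k - 1)\<^sup>2 / 4"
    and b_smooth: "times_differentiable n UNIV b"
    and b_deriv: "(b has_real_derivative b1 x) (at x)" and b1_deriv: "(b1 has_real_derivative b2 x) (at x)"
    and b_nonneg: "0 \<le> b x" and b_less: "b x < 1"
    and b1_bound: "\<bar>b1 x\<bar> \<le> 1 / ((real k + 2) * k) * (1 - b x)"
    and b2_bound: "\<bar>b2 x\<bar> \<le> 1 / ((real k + 2) * k) * (1 - b x)"
    and b1_tendsto: "(b1 \<longlongrightarrow> 0) at_top"
    and at_s: "b (s n) = 0" "b1 (s n) = 0" and at_dip: "b (3 / 2 * s n) = 1 - 1 / (real n + 2)"
    and plateau: "2 * s n \<le> x \<Longrightarrow> x \<le> s (Suc n) \<Longrightarrow> b x = 0"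
    and s_ge: "real n \<le> s n" and s_Suc: "s (Suc n) = 2 * s n + exp (4 * s n)"
begin

text \<open>\<open>m\<close> and \<open>m1\<close> are the distances from \<open>(k - 1) / 2\<close>
  to the roots of \<open>(k - p) * (1 + p) = C\<close> for \<open>C2\<close> and \<open>C1\<close>.
  So \<open>b = 0\<close> puts \<open>p\<close> at the root for \<open>C2\<close>, and
  \<open>b = 1\<close> would put it at the root for \<open>C1\<close>.\<close>

definition "m = sqrt ((real k + 1)\<^sup>2 / 4 - C2)"
definition "m1 = sqrt ((real k + 1)\<^sup>2 / 4 - C1)"
definition "a = m1 - m"
definition "p x = (real k - 1) / 2 - m - a * b x"
definition "psi x = (real k - p x) * (1 + p x) + a * b1 x"

lemma m_square_eq: "m\<^sup>2 = (real k + 1)\<^sup>2 / 4 - C2" "real k \<le> m\<^sup>2"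
proof -
  have "(real k + 1)\<^sup>2 / 4 - (real k - 1)\<^sup>2 / 4 = k"
    by (simp add: power2_eq_square field_simps)
  then have *: "real k \<le> (real k + 1)\<^sup>2 / 4 - C2"
    using C2_le by simp
  then show "m\<^sup>2 = (real k + 1)\<^sup>2 / 4 - C2"
    unfolding m_def by (intro real_sqrt_pow2) simp
  with * show "real k \<le> m\<^sup>2"
    by simp
qed

text \<open>The lower bound on \<open>C2\<close> is \<open>m \<le> (k - 3) / 2\<close> after
  completing a square, and this means \<open>p \<ge> 1\<close> at rest. The dimension enters through
  \<open>m\<^sup>2 \<ge> k \<ge> 9\<close>.\<close>

lemma m_bounds: "3 \<le> m" "m \<le> (real k - 3) / 2"
proof -
  have "0 \<le> m"
    unfolding m_def using m_square_eq by (metis real_sqrt_ge_zero zero_le_power2)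
  have "3\<^sup>2 \<le> m\<^sup>2"
    using m_square_eq(2) k_ge_9 by simp
  then show "3 \<le> m"
    using \<open>0 \<le> m\<close> by (rule power2_le_imp_le)
  have "m\<^sup>2 \<le> ((real k - 3) / 2)\<^sup>2"
    unfolding m_square_eq(1) using C2_ge by (simp add: power2_eq_square field_simps)
  then show "m \<le> (real k - 3) / 2"
    by (rule power2_le_imp_le) (use k_ge_9 in simp)
qed

lemma m1_square: "m1\<^sup>2 = (real k + 1)\<^sup>2 / 4 - C1"
  unfolding m1_def using m_square_eq C1_le_C2 by (intro real_sqrt_pow2) (smt (verit) zero_le_power2)

lemma a_bounds: "0 \<le> a" "a \<le> k" "a \<le> (real k + 1) / 2 - m"
proof -
  show "0 \<le> a"
    unfolding a_def m_def m1_def using C1_le_C2 by simp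
  have "m1 \<le> sqrt (((real k + 1) / 2)\<^sup>2)"
    unfolding m1_def using C1_nonneg by (simp add: power_divide)
  then show "a \<le> (real k + 1) / 2 - m"
    by (simp add: a_def)
  then show "a \<le> k"
    using m_bounds(1) k_ge_9 by (simp add: field_simps)
qed

lemma p_le: "p x \<le> (real k - 1) / 2 - m"
  using a_bounds(1) b_nonneg[of x] by (simp add: p_def)

text \<open>\<open>1 + p\<close> is \<open>q - a * b\<close>, where \<open>a \<le> q\<close>
  reflects \<open>C1 \<ge> 0\<close> and \<open>q \<ge> 2\<close> the lower bound on
  \<open>C2\<close>; so it is at least \<open>q * (1 - b)\<close>.\<close>

lemma one_plus_p_ge: "2 * (1 - b x) \<le> 1 + p x"
proof -
  define q where "q = (real k + 1) / 2 - m"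
  have "a \<le> q" "2 \<le> q"
    using a_bounds(3) m_bounds(2) by (simp_all add: q_def field_simps)
  then have "a * b x \<le> q * b x" "2 * (1 - b x) \<le> q * (1 - b x)"
    using b_nonneg[of x] b_less[of x] by (intro mult_right_mono; simp)+
  moreover have "1 + p x = q - a * b x"
    by (simp add: p_def q_def field_simps)
  ultimately show ?thesis
    by (simp add: right_diff_distrib)
qed

lemma p_ge: "-1 \<le> p x"
  using one_plus_p_ge[of x] b_less[of x] by simp

lemma k_minus_p_ge: "1 \<le> real k - p x"
  using p_le[of x] m_bounds(1) k_ge_9 by (simp add: field_simps)

lemma p_deriv: "(p has_real_derivative - a * b1 x) (at x)"
  unfolding p_def[abs_def] using DERIV_diff[OF DERIV_const DERIV_cmult[OF b_deriv[of x]]] by simp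

lemma p_smooth: "times_differentiable n S p"
proof (rule times_differentiable_subset)
  show "times_differentiable n UNIV p"
    unfolding p_def[abs_def]
    by (intro times_differentiable_diff times_differentiable_mult times_differentiable_const b_smooth)
qed simp

lemma continuous_on_p: "continuous_on S p"
  by (intro continuous_at_imp_continuous_on ballI DERIV_isCont[OF p_deriv])

lemma a_b_bounds:
  "\<bar>a * b1 x\<bar> * (real k + 2) \<le> 1 - b x" "\<bar>a * b2 x\<bar> * (real k + 2) \<le> 1 - b x"
proof -
  have "\<bar>a * y\<bar> * (real k + 2) \<le> 1 - b x" if "\<bar>y\<bar> \<le> 1 / ((real k + 2) * k) * (1 - b x)" for y
  proof -
    have "\<bar>a * y\<bar> \<le> k * (1 / ((real k + 2) * k) * (1 - b x))"
      unfolding abs_mult using a_bounds that by (intro mult_mono) auto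
    also have "\<dots> = (1 - b x) / (real k + 2)"
      using k_ge_9 by simp
    finally show ?thesis
      by (simp add: pos_le_divide_eq)
  qed
  then show "\<bar>a * b1 x\<bar> * (real k + 2) \<le> 1 - b x" "\<bar>a * b2 x\<bar> * (real k + 2) \<le> 1 - b x"
    using b1_bound b2_bound by blast+
qed

text \<open>The main term is at least \<open>2 * (1 - b x)\<close> and the perturbation at most half
  of that, so \<open>f'\<close> stays positive even for \<open>C1 = 0\<close>.\<close>

lemma psi_ge: "1 - b x \<le> psi x"
proof -
  have "\<bar>a * b1 x\<bar> * 1 \<le> \<bar>a * b1 x\<bar> * (real k + 2)"
    by (intro mult_left_mono) auto
  then have 1: "\<bar>a * b1 x\<bar> \<le> 1 - b x"
    using a_b_bounds(1)[of x] by simp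
  have "1 * (2 * (1 - b x)) \<le> (real k - p x) * (1 + p x)"
    using k_minus_p_ge[of x] one_plus_p_ge[of x] b_less[of x] by (intro mult_mono) auto
  with 1 show ?thesis
    by (simp add: psi_def)
qed

lemma psi_pos: "0 < psi x"
  using psi_ge[of x] b_less[of x] by simp

definition "psi1 x = (real k - 1 - 2 * p x) * (- a * b1 x) + a * b2 x"

lemma psi_deriv: "(psi has_real_derivative psi1 x) (at x)"
proof -
  have "((\<lambda>x. (real k - p x) * (1 + p x) + a * b1 x) has_real_derivative
      (0 - - a * b1 x) * (1 + p x) + (0 + - a * b1 x) * (real k - p x) + a * b2 x) (at x)"
    by (intro DERIV_add DERIV_mult DERIV_diff DERIV_const DERIV_cmult p_deriv b1_deriv)
  then show ?thesis
    unfolding psi_def[abs_def] by (rule DERIV_cong) (simp add: psi1_def algebra_simps)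
qed

text \<open>This is the convexity of \<open>f\<close>: the derivative of
  \<open>psi (- ln r) / r\<^sup>2\<close> is \<open>- (psi1 + 2 * psi) / r ^ 3\<close>, taken at
  \<open>- ln r\<close>. The bound \<open>p \<ge> -1\<close> keeps \<open>k - 1 - 2 * p\<close> at
  most \<open>k + 1\<close>.\<close>

lemma psi1_ge: "0 \<le> psi1 x + 2 * psi x"
proof -
  have "\<bar>(real k - 1 - 2 * p x) * (- a * b1 x)\<bar> \<le> (real k + 1) * \<bar>a * b1 x\<bar>"
    unfolding abs_mult[of "real k - 1 - 2 * p x"]
  proof (intro mult_mono)
    show "\<bar>real k - 1 - 2 * p x\<bar> \<le> real k + 1"
      using p_ge[of x] p_le[of x] m_bounds(1) by (simp add: field_simps)
  qed auto
  also have "\<dots> \<le> (real k + 2) * \<bar>a * b1 x\<bar>"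
    by (intro mult_right_mono) auto
  also have "\<dots> \<le> 1 - b x"
    using a_b_bounds(1)[of x] by (simp add: mult.commute)
  finally have 1: "\<bar>(real k - 1 - 2 * p x) * (- a * b1 x)\<bar> \<le> 1 - b x" .
  have "\<bar>a * b2 x\<bar> * 1 \<le> \<bar>a * b2 x\<bar> * (real k + 2)"
    by (intro mult_left_mono) auto
  then have 2: "\<bar>a * b2 x\<bar> \<le> 1 - b x"
    using a_b_bounds(2)[of x] by simp
  have "\<bar>psi1 x\<bar> \<le> 2 * (1 - b x)"
    unfolding psi1_def using abs_triangle_ineq[of "(real k - 1 - 2 * p x) * (- a * b1 x)" "a * b2 x"] 1 2
    by simp
  then show ?thesis
    using psi_ge[of x] by simp
qed

text \<open>The integral of \<open>p\<close> from 0 to \<open>x\<close>. The base point -1 lies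
  below every \<open>- ln r\<close> with \<open>0 < r \<le> 2\<close>, as
  \<open>ln 2 < 1\<close>.\<close>

definition "I x = integral {-1..x} p - integral {-1..0} p"

lemma I_deriv: "-1 < x \<Longrightarrow> (I has_real_derivative p x) (at x)"
  using integral_has_real_derivative[OF continuous_on_p[of "{-1..x + 1}"], of x]
  unfolding I_def[abs_def] by (auto simp: at_within_Icc_at intro!: derivative_eq_intros)

lemma I_smooth: "times_differentiable n {-1<..} I"
proof (cases n)
  case (Suc j)
  show ?thesis
    unfolding Suc times_differentiable.simps using I_deriv p_smooth by (intro exI[of _ p]) auto
qed simp

section \<open>The profile as a function of the radius\<close>

definition "w r = exp (I (- ln r))"
definition "P r = p (- ln r)"
definition "P1 r = - a * b1 (- ln r)"
definition "U r = integral {r..2} w - integral {1..2} w"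

lemma minus_ln_greater: "0 < r \<Longrightarrow> r \<le> 2 \<Longrightarrow> -1 < - ln r" for r :: real
proof -
  assume "0 < r" "r \<le> 2"
  then have "ln r \<le> ln 2"
    by simp
  also have "\<dots> < 1"
    by (rule ln_2_less_1)
  finally show ?thesis
    by simp
qed

lemma minus_ln_deriv: "0 < r \<Longrightarrow> ((\<lambda>r. - ln r) has_real_derivative - (1 / r)) (at r)" for r :: real
  by (auto intro!: derivative_eq_intros)

lemma w_deriv_aux: "0 < r \<Longrightarrow> r \<le> 2 \<Longrightarrow> (w has_real_derivative - (P r * w r / r)) (at r)"
proof -
  assume r: "0 < r" "r \<le> 2"
  have "((\<lambda>r. exp (I (- ln r))) has_real_derivative exp (I (- ln r)) * (p (- ln r) * - (1 / r))) (at r)"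
    by (intro DERIV_fun_exp DERIV_chain2[OF I_deriv] minus_ln_deriv minus_ln_greater r)
  then show ?thesis
    unfolding w_def[abs_def] P_def by (rule DERIV_cong) simp
qed

lemma w_positive: "0 < w r"
  by (simp add: w_def)

lemma continuous_on_w: "0 < c \<Longrightarrow> continuous_on {c..2} w"
  by (intro continuous_at_imp_continuous_on ballI DERIV_isCont[OF w_deriv_aux]) auto

lemma P_deriv_aux: "0 < r \<Longrightarrow> (P has_real_derivative - (P1 r / r)) (at r)"
  unfolding P_def[abs_def] P1_def
  by (rule DERIV_cong[OF DERIV_chain2[OF p_deriv minus_ln_deriv]]) auto

lemma U_deriv_aux: "0 < r \<Longrightarrow> r < 2 \<Longrightarrow> (U has_real_derivative - w r) (at r)"
  using integral_has_real_derivative'[OF continuous_on_w[of "r / 2"], of r]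
  unfolding U_def[abs_def] by (auto simp: at_within_Icc_at intro!: derivative_eq_intros)

lemma continuous_on_U_aux: "0 < c \<Longrightarrow> continuous_on {c..2} U"
  unfolding U_def[abs_def]
  by (intro continuous_on_diff continuous_on_const indefinite_integral_continuous_1'
      integrable_continuous_interval continuous_on_w)

lemma U_strict_antimono: "0 < r \<Longrightarrow> r < t \<Longrightarrow> t \<le> 2 \<Longrightarrow> U t < U r"
proof (rule DERIV_neg_imp_decreasing_open[of r t U])
  assume r: "0 < r" "r < t" "t \<le> 2"
  show "\<exists>y. (U has_real_derivative y) (at x) \<and> y < 0" if "r < x" "x < t" for x
    using U_deriv_aux[of x] w_positive[of x] that r by (intro exI[of _ "- w x"]) auto
  show "continuous_on {r..t} U"
    by (rule continuous_on_subset[OF continuous_on_U_aux[OF r(1)]]) (use r in auto)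
qed

lemma U_at_1: "U 1 = 0"
  by (simp add: U_def)

text \<open>\<open>I x - x\<close> does not decrease on a plateau, so \<open>U\<close> gains at least \<open>1\<close> there.\<close>

lemma U_exp_deriv: "0 \<le> x \<Longrightarrow> ((\<lambda>x. U (exp (- x))) has_real_derivative exp (I x - x)) (at x)"
proof -
  assume x: "0 \<le> x"
  have "exp (- x) < 2"
    by (rule le_less_trans[of _ 1]) (use x in simp_all)
  moreover have "((\<lambda>x. exp (- x)) has_real_derivative exp (- x) * -1) (at x)"
    by (auto intro!: derivative_eq_intros)
  ultimately have "((\<lambda>x. U (exp (- x))) has_real_derivative - w (exp (- x)) * (exp (- x) * -1)) (at x)"
    by (intro DERIV_chain2[OF U_deriv_aux]) simp_all
  then show ?thesis
    by (rule DERIV_cong) (simp add: w_def exp_diff divide_inverse flip: exp_minus)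
qed

lemma I_minus_ge: "0 \<le> x \<Longrightarrow> - (2 * x) \<le> I x - x"
proof -
  assume x: "0 \<le> x"
  have "I 0 + 0 \<le> I x + x"
  proof (rule DERIV_nonneg_imp_nondecreasing[of 0 x "\<lambda>x. I x + x", OF x])
    fix y :: real assume "0 \<le> y"
    then show "\<exists>d. ((\<lambda>x. I x + x) has_real_derivative d) (at y) \<and> 0 \<le> d"
      using p_ge[of y] by (intro exI[of _ "p y + 1"] conjI DERIV_add I_deriv DERIV_ident) auto
  qed
  then show ?thesis
    by (simp add: I_def)
qed

lemma U_at_s: "real n \<le> U (exp (- s n))"
proof (induction n)
  case 0
  show ?case
    using s_ge[of 0] U_strict_antimono[of "exp (- s 0)" 1] U_at_1 by (cases "s 0 = 0") auto
next
  case (Suc n)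
  have s: "0 \<le> s n" "2 * s n \<le> s (Suc n)"
    using s_ge[of n] s_Suc[of n] by auto
  have mono: "U (exp (- x)) \<le> U (exp (- y))" if "0 \<le> x" "x \<le> y" for x y
  proof (cases "x = y")
    case False
    have "exp (- x) \<le> 2"
      by (rule order_trans[of _ 1]) (use that in simp_all)
    with False that show ?thesis
      using U_strict_antimono[of "exp (- y)" "exp (- x)"] by simp
  qed simp
  \<comment> \<open>On the plateau the slope of \<open>U (exp (- x))\<close> is at least
    \<open>exp (- (4 * s n))\<close>: the exponent \<open>I x - x\<close> starts at no less than
    \<open>- 2 * (2 * s n)\<close> and does not decrease, since \<open>p \<ge> 1\<close> there. The
    recursion for \<open>s\<close> makes the plateau \<open>exp (4 * s n)\<close> long.\<close>
  have "U (exp (- (2 * s n))) - exp (- (4 * s n)) * (2 * s n) \<le> U (exp (- s (Suc n))) - exp (- (4 * s n)) * s (Suc n)"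
  proof (rule DERIV_nonneg_imp_nondecreasing[of "2 * s n" "s (Suc n)" "\<lambda>x. U (exp (- x)) - exp (- (4 * s n)) * x", OF s(2)])
    fix x assume x: "2 * s n \<le> x" "x \<le> s (Suc n)"
    have "I (2 * s n) - 2 * s n \<le> I x - x"
    proof (rule DERIV_nonneg_imp_nondecreasing[of "2 * s n" x "\<lambda>x. I x - x", OF x(1)])
      fix y assume y: "2 * s n \<le> y" "y \<le> x"
      then have "1 \<le> p y"
        using plateau[of n y] x m_bounds(2) by (simp add: p_def field_simps)
      then show "\<exists>d. ((\<lambda>x. I x - x) has_real_derivative d) (at y) \<and> 0 \<le> d"
        using y s by (intro exI[of _ "p y - 1"] conjI DERIV_diff I_deriv DERIV_ident) auto
    qed
    then have "exp (- (4 * s n)) \<le> exp (I x - x)"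
      using I_minus_ge[of "2 * s n"] s by simp
    then show "\<exists>d. ((\<lambda>x. U (exp (- x)) - exp (- (4 * s n)) * x) has_real_derivative d) (at x) \<and> 0 \<le> d"
      using x s DERIV_cmult_Id[of "exp (- (4 * s n))" x UNIV]
      by (intro exI[of _ "exp (I x - x) - exp (- (4 * s n))"] conjI DERIV_diff U_exp_deriv) auto
  qed
  moreover have "exp (- (4 * s n)) * s (Suc n) = exp (- (4 * s n)) * (2 * s n) + 1"
    by (simp add: s_Suc algebra_simps flip: exp_add)
  ultimately have "U (exp (- (2 * s n))) + 1 \<le> U (exp (- s (Suc n)))"
    by simp
  then show ?case
    using Suc mono[of "s n" "2 * s n"] s by simp
qed

lemma U_filterlim: "filterlim U at_top (at_right 0)"
  unfolding filterlim_at_top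
proof
  fix Z :: real
  obtain n where n: "Z \<le> real n"
    using real_arch_simple by blast
  have "Z \<le> U r" if "0 < r" "r < exp (- s n)" for r
  proof -
    have "exp (- s n) \<le> 2"
      by (rule order_trans[of _ 1]) (use s_ge[of n] in simp_all)
    with that have "U (exp (- s n)) < U r"
      by (intro U_strict_antimono)
    then show ?thesis
      using U_at_s[of n] n by simp
  qed
  then show "\<forall>\<^sub>F r in at_right 0. Z \<le> U r"
    by (auto simp: eventually_at_right_field intro!: exI[of _ "exp (- s n)"])
qed

section \<open>The nonlinearity recovered from the profile\<close>

definition "A = U 2"
definition "R = the_inv_into {0<..<2} U"
text \<open>\<open>g\<close> and \<open>v\<close> are the nonlinearity and its derivative expressed
  through the radius; \<open>R\<close>, the inverse of the profile, turns them into functions of the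
  value of the solution.\<close>

definition "g r = w r / r * (k - P r)"
definition "v r = psi (- ln r) / r\<^sup>2"
definition "f t = g (R t)"
definition "f1 t = v (R t)"

lemma A_negative: "A < 0"
  using U_strict_antimono[of 1 2] U_at_1 by (simp add: A_def)

lemma U_inj: "inj_on U {0<..<2}"
proof (rule inj_onI)
  fix x y assume "x \<in> {0<..<2}" "y \<in> {0<..<2}" "U x = U y"
  then show "x = y"
    using U_strict_antimono[of x y] U_strict_antimono[of y x] by (cases x y rule: linorder_cases) auto
qed

lemma R_U: "0 < r \<Longrightarrow> r < 2 \<Longrightarrow> R (U r) = r"
  unfolding R_def by (intro the_inv_into_f_f U_inj) simp

lemma R_props:
  assumes "A < t"
  shows "0 < R t" "R t < 2" "U (R t) = t"
proof -
  have "\<forall>\<^sub>F r in at_right 0. t < U r"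
    using U_filterlim by (auto simp: filterlim_at_top_dense)
  moreover have "\<forall>\<^sub>F r::real in at_right 0. 0 < r \<and> r < 2"
    by (auto simp: eventually_at_right_field intro!: exI[of _ 2])
  ultimately have "\<forall>\<^sub>F r in at_right 0. t < U r \<and> 0 < r \<and> r < 2"
    by eventually_elim auto
  then obtain r where r: "t < U r" "0 < r" "r < 2"
    using eventually_happens'[OF trivial_limit_at_right_real] by blast
  have "\<exists>x. r \<le> x \<and> x \<le> 2 \<and> U x = t"
    by (rule IVT2') (use r assms continuous_on_U_aux in \<open>auto simp: A_def\<close>)
  then obtain x where x: "r \<le> x" "x \<le> 2" "U x = t"
    by blast
  then have "x \<noteq> 2"
    using assms by (auto simp: A_def)
  with x r R_U[of x] show "0 < R t" "R t < 2" "U (R t) = t"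
    by auto
qed

lemma U_greater_A: "0 < r \<Longrightarrow> r < 2 \<Longrightarrow> A < U r"
  unfolding A_def by (intro U_strict_antimono) auto

lemma R_deriv: "A < t \<Longrightarrow> (R has_real_derivative - (1 / w (R t))) (at t)"
proof -
  assume t: "A < t"
  have "(R has_real_derivative inverse (- w (R t))) (at t)"
  proof (rule has_field_derivative_inverse_strong_x[where g = R and f = U and S = "{0<..<2}"])
    show "(U has_real_derivative - w (R t)) (at (R t))"
      by (intro U_deriv_aux R_props t)
    show "continuous_on {0<..<2} U"
      by (intro continuous_at_imp_continuous_on ballI DERIV_isCont[OF U_deriv_aux]) auto
  qed (use R_props[OF t] R_U w_positive[of "R t"] in auto)
  then show ?thesis
    by (simp add: inverse_eq_divide)
qed

lemma R_antimono: "A < t \<Longrightarrow> t \<le> t' \<Longrightarrow> R t' \<le> R t"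
  using R_props[of t] R_props[of t'] U_strict_antimono[of "R t" "R t'"] by force

lemma minus_ln_smooth: "times_differentiable n {0<..<2} (\<lambda>r. - ln r)"
  by (intro times_differentiable_minus times_differentiable_subset[OF times_differentiable_ln]) auto

lemma w_smooth: "times_differentiable n {0<..<2} w"
  unfolding w_def[abs_def]
proof (rule times_differentiable_compose[OF times_differentiable_exp[of _ UNIV]])
  show "times_differentiable n {0<..<2} (\<lambda>r. I (- ln r))"
    by (rule times_differentiable_compose[OF I_smooth minus_ln_smooth]) (use minus_ln_greater in auto)
qed simp

lemma g_smooth: "times_differentiable n {0<..<2} g"
proof -
  have "times_differentiable n {0<..<2} P"
    unfolding P_def[abs_def]
    by (rule times_differentiable_compose[OF p_smooth[of _ UNIV] minus_ln_smooth]) simp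
  then show ?thesis
    unfolding g_def[abs_def]
    by (intro times_differentiable_mult times_differentiable_divide times_differentiable_diff
        times_differentiable_const times_differentiable_ident w_smooth) auto
qed

text \<open>Bootstrapping: \<open>R\<close> solves \<open>R' = - 1 / w (R)\<close>, so
  \<open>n\<close> derivatives of \<open>R\<close> yield \<open>n\<close> derivatives of
  \<open>R'\<close>.\<close>

lemma R_smooth: "times_differentiable n {A<..} R"
proof (induction n)
  case (Suc n)
  have "times_differentiable n {A<..} (\<lambda>t. - (1 / w (R t)))"
  proof (rule times_differentiable_compose[OF _ Suc])
    show "times_differentiable n {0<..<2} (\<lambda>r. - (1 / w r))"
      using w_positive
      by (intro times_differentiable_minus times_differentiable_divide times_differentiable_const w_smooth)
         (auto simp: less_le)
  qed (use R_props in auto)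
  then show ?case
    unfolding times_differentiable.simps using R_deriv by (intro exI[of _ "\<lambda>t. - (1 / w (R t))"]) auto
qed simp

lemma f_smooth: "times_differentiable n {A<..} f"
  unfolding f_def[abs_def] by (rule times_differentiable_compose[OF g_smooth R_smooth]) (use R_props in auto)

lemma g_deriv: "0 < r \<Longrightarrow> r < 2 \<Longrightarrow> (g has_real_derivative - (w r * v r)) (at r)"
proof -
  assume r: "0 < r" "r < 2"
  have "((\<lambda>r. w r / r * (real k - P r)) has_real_derivative
      (- (P r * w r / r) * r - w r * 1) / (r * r) * (real k - P r) + (0 - - (P1 r / r)) * (w r / r)) (at r)"
    using r by (intro DERIV_mult DERIV_divide DERIV_diff DERIV_const DERIV_ident w_deriv_aux P_deriv_aux) auto
  then show ?thesis
    unfolding g_def[abs_def]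
  proof (rule DERIV_cong)
    have v: "v r = ((real k - P r) * (1 + P r) - P1 r) / r\<^sup>2"
      by (simp add: v_def psi_def P_def P1_def)
    show "(- (P r * w r / r) * r - w r * 1) / (r * r) * (real k - P r) + (0 - - (P1 r / r)) * (w r / r) = - (w r * v r)"
      unfolding v using r by (simp add: field_simps power2_eq_square)
  qed
qed

lemma f_deriv_aux: "A < t \<Longrightarrow> (f has_real_derivative f1 t) (at t)"
proof -
  assume t: "A < t"
  have "((\<lambda>t. g (R t)) has_real_derivative - (w (R t) * v (R t)) * - (1 / w (R t))) (at t)"
    by (intro DERIV_chain2[OF g_deriv] R_deriv R_props t)
  then show ?thesis
    unfolding f_def[abs_def] f1_def by (rule DERIV_cong) (use w_positive[of "R t"] in simp)
qed

lemma v_antimono: "0 < r \<Longrightarrow> r \<le> t \<Longrightarrow> v t \<le> v r"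
proof (rule DERIV_nonpos_imp_nonincreasing[of r t v])
  assume r: "0 < r"
  fix x assume "r \<le> x"
  then have x: "0 < x"
    using r by simp
  have "((\<lambda>r. psi (- ln r) / r\<^sup>2) has_real_derivative
      (psi1 (- ln x) * - (1 / x) * x\<^sup>2 - psi (- ln x) * (2 * x)) / (x\<^sup>2 * x\<^sup>2)) (at x)"
    using x DERIV_pow[of 2 x] by (intro DERIV_divide DERIV_chain2[OF psi_deriv minus_ln_deriv]) auto
  moreover have "(psi1 (- ln x) * - (1 / x) * x\<^sup>2 - psi (- ln x) * (2 * x)) / (x\<^sup>2 * x\<^sup>2) =
      - ((psi1 (- ln x) + 2 * psi (- ln x)) / (x * x\<^sup>2))"
    using x by (simp add: field_simps power2_eq_square)
  moreover have "0 \<le> (psi1 (- ln x) + 2 * psi (- ln x)) / (x * x\<^sup>2)"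
    using x psi1_ge by (intro divide_nonneg_nonneg) auto
  ultimately show "\<exists>y. (v has_real_derivative y) (at x) \<and> y \<le> 0"
    unfolding v_def[abs_def] by auto
qed

lemma f1_continuous: "continuous_on {A<..} f1"
proof -
  have "continuous_on {A<..} (deriv f)"
    by (rule times_differentiable_imp_continuous_on[of 0])
       (rule times_differentiable_deriv(1)[OF open_greaterThan f_smooth])
  moreover have "deriv f t = f1 t" if "A < t" for t
    by (rule DERIV_imp_deriv[OF f_deriv_aux[OF that]])
  ultimately show ?thesis
    by (subst continuous_on_cong[OF refl, of _ f1 "deriv f"]) auto
qed

sublocale singular_profile k f f1 A U w P P1 m
proof
  show "0 < k" "A < 0" "3 \<le> m" "real k \<le> m\<^sup>2" "U 1 = 0" "continuous_on {A<..} f1" "filterlim U at_top (at_right 0)"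
    using k_ge_9 A_negative m_bounds m_square_eq U_at_1 f1_continuous U_filterlim by auto
  show "w 1 = 1"
    by (simp add: w_def I_def)
  fix t u :: real assume t: "A < t"
  show "(f has_real_derivative f1 t) (at t)"
    by (rule f_deriv_aux[OF t])
  show "t \<le> u \<Longrightarrow> f1 t \<le> f1 u"
    unfolding f1_def using R_props[of u] R_antimono[OF t, of u] t by (intro v_antimono) auto
  show "0 \<le> f1 t"
    unfolding f1_def v_def using psi_pos[of "- ln (R t)"] by simp
  show "0 < f t"
    unfolding f_def g_def P_def using R_props[OF t] w_positive[of "R t"] k_minus_p_ge[of "- ln (R t)"] by simp
next
  fix r :: real assume r: "0 < r"
  show "-1 \<le> P r" "P r \<le> (real k - 1) / 2 - m"
    using p_ge p_le by (auto simp: P_def)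
  show "(P has_real_derivative - (P1 r / r)) (at r)" "0 < w r"
    using P_deriv_aux[OF r] w_positive by auto
  assume "r < 2"
  then show "(U has_real_derivative - w r) (at r)" "(w has_real_derivative - (P r * w r / r)) (at r)"
    using U_deriv_aux w_deriv_aux r by auto
next
  fix r :: real assume "0 < r" "r \<le> 1"
  then have "R (U r) = r"
    by (intro R_U) auto
  then show "f (U r) = w r / r * (real k - P r)"
    "f1 (U r) = ((real k - P r) * (1 + P r) - P1 r) / r\<^sup>2"
    by (simp_all add: f_def g_def f1_def v_def psi_def P_def P1_def)
qed

section \<open>Lower and upper limits at the origin\<close>

lemma r_square_deriv_f: "0 < r \<Longrightarrow> r < 1 \<Longrightarrow> r\<^sup>2 * deriv f (U r) = psi (- ln r)"
  using DERIV_imp_deriv[OF f_deriv_aux[OF U_greater_A[of r]]] R_U[of r] by (simp add: f1_def v_def)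

text \<open>Completing the square around \<open>p = (k - 1) / 2\<close>. The square of
  \<open>m + a * b\<close> lies between \<open>m\<^sup>2\<close> and \<open>m1\<^sup>2\<close>,
  which correspond to \<open>C2\<close> and \<open>C1\<close>.\<close>

lemma psi_eq: "psi x = (real k + 1)\<^sup>2 / 4 - (m + a * b x)\<^sup>2 + a * b1 x"
  by (simp add: psi_def p_def power2_eq_square field_simps)

lemma psi_bounds: "C1 + a * b1 x \<le> psi x" "psi x \<le> C2 + a * b1 x"
proof -
  have "0 \<le> a * b x" "a * b x \<le> a * 1"
    using a_bounds(1) b_nonneg[of x] b_less[of x]
    by (simp, intro mult_left_mono, simp_all)
  then have "m\<^sup>2 \<le> (m + a * b x)\<^sup>2" "(m + a * b x)\<^sup>2 \<le> m1\<^sup>2"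
    using m_bounds(1) by (auto intro!: power_mono simp: a_def)
  then show "C1 + a * b1 x \<le> psi x" "psi x \<le> C2 + a * b1 x"
    unfolding psi_eq m_square_eq(1) m1_square by auto
qed

lemma filterlim_minus_ln: "filterlim (\<lambda>r::real. - ln r) at_top (at_right 0)"
  using ln_at_0 by (simp add: filterlim_uminus_at_top)

lemma filterlim_exp_minus:
  assumes "filterlim x at_top sequentially"
  shows "filterlim (\<lambda>n. exp (- x n :: real)) (at_right 0) sequentially"
  unfolding filterlim_at
proof (intro conjI always_eventually allI)
  have "filterlim (\<lambda>n. - x n) at_bot sequentially"
    using assms by (simp add: filterlim_uminus_at_top)
  then show "(\<lambda>n. exp (- x n)) \<longlonglongrightarrow> 0"
    by (rule filterlim_compose[OF exp_at_bot])
qed simp_all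

lemma s_at_top: "filterlim s at_top sequentially"
  by (rule filterlim_at_top_mono[OF filterlim_real_sequentially]) (use s_ge in simp)

lemma b1_seq_tendsto:
  assumes "filterlim x at_top sequentially"
  shows "(\<lambda>n. a * b1 (x n)) \<longlonglongrightarrow> 0"
  using tendsto_mult[OF tendsto_const filterlim_compose[OF b1_tendsto assms], of a] by simp

lemma eventually_r_square_deriv:
  "\<forall>\<^sub>F r in at_right 0. ereal (r\<^sup>2 * deriv f (U r)) = ereal (psi (- ln r))"
proof -
  have "\<forall>\<^sub>F r::real in at_right 0. 0 < r \<and> r < 1"
    by (rule eventually_in_unit_interval)
  then show ?thesis
    by eventually_elim (simp add: r_square_deriv_f)
qed

lemma perturbation_tendsto: "((\<lambda>r. ereal (c + a * b1 (- ln r))) \<longlongrightarrow> ereal c) (at_right 0)"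
proof (intro tendsto_ereal)
  have "((\<lambda>r. c + a * b1 (- ln r)) \<longlongrightarrow> c + a * 0) (at_right 0)"
    by (intro tendsto_intros filterlim_compose[OF b1_tendsto filterlim_minus_ln])
  then show "((\<lambda>r. c + a * b1 (- ln r)) \<longlongrightarrow> c) (at_right 0)"
    by simp
qed

lemma Limsup_r_square_deriv: "Limsup (at_right 0) (\<lambda>r. ereal (r\<^sup>2 * deriv f (U r))) = ereal C2"
  unfolding Limsup_eq[OF eventually_r_square_deriv]
proof (rule antisym)
  have "Limsup (at_right 0) (\<lambda>r. ereal (psi (- ln r))) \<le> Limsup (at_right 0) (\<lambda>r. ereal (C2 + a * b1 (- ln r)))"
    by (intro Limsup_mono always_eventually) (simp add: psi_bounds)
  also have "\<dots> = ereal C2"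
    by (rule lim_imp_Limsup[OF trivial_limit_at_right_real perturbation_tendsto])
  finally show "Limsup (at_right 0) (\<lambda>r. ereal (psi (- ln r))) \<le> ereal C2" .
  \<comment> \<open>At the start of a dip both \<open>b\<close> and \<open>b1\<close> vanish, so the
    upper value is attained exactly.\<close>
  have "psi (s n) = C2" for n
    using m_square_eq(1) by (simp add: psi_eq at_s)
  then have "(\<lambda>n. ereal (psi (- ln (exp (- s n))))) \<longlonglongrightarrow> ereal C2"
    by simp
  then show "ereal C2 \<le> Limsup (at_right 0) (\<lambda>r. ereal (psi (- ln r)))"
    by (rule Limsup_ge_if_subsequence[OF filterlim_exp_minus[OF s_at_top]])
qed

lemma Liminf_r_square_deriv: "Liminf (at_right 0) (\<lambda>r. ereal (r\<^sup>2 * deriv f (U r))) = ereal C1"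
  unfolding Liminf_eq[OF eventually_r_square_deriv]
proof (rule antisym)
  have "ereal C1 = Liminf (at_right 0) (\<lambda>r. ereal (C1 + a * b1 (- ln r)))"
    by (rule lim_imp_Liminf[OF trivial_limit_at_right_real perturbation_tendsto, symmetric])
  also have "\<dots> \<le> Liminf (at_right 0) (\<lambda>r. ereal (psi (- ln r)))"
    by (intro Liminf_mono always_eventually) (simp add: psi_bounds)
  finally show "ereal C1 \<le> Liminf (at_right 0) (\<lambda>r. ereal (psi (- ln r)))" .
  \<comment> \<open>The peaks of the dips. There \<open>b\<close> is only close to 1, so the lower
    value appears as a limit along this sequence.\<close>
  define x where "x n = 3 / 2 * s n" for n
  have x: "filterlim x at_top sequentially"
    unfolding x_def by (intro filterlim_tendsto_pos_mult_at_top[OF tendsto_const _ s_at_top]) simp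
  have "(\<lambda>n. 1 - 1 / (real n + 2)) \<longlonglongrightarrow> 1 - 0"
    by (intro tendsto_diff tendsto_const tendsto_divide_0[OF tendsto_const]
        filterlim_at_top_imp_at_infinity filterlim_tendsto_add_at_top[OF tendsto_const filterlim_real_sequentially, of 2, simplified add.commute[of 2]])
  then have "(\<lambda>n. b (x n)) \<longlonglongrightarrow> 1"
    unfolding x_def at_dip by simp
  then have "(\<lambda>n. (real k + 1)\<^sup>2 / 4 - (m + a * b (x n))\<^sup>2 + a * b1 (x n)) \<longlonglongrightarrow>
      (real k + 1)\<^sup>2 / 4 - (m + a * 1)\<^sup>2 + 0"
    by (intro tendsto_intros b1_seq_tendsto x)
  then have "(\<lambda>n. psi (x n)) \<longlonglongrightarrow> C1"
    using m1_square by (simp add: psi_eq a_def)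
  then have "(\<lambda>n. ereal (psi (- ln (exp (- x n))))) \<longlonglongrightarrow> ereal C1"
    by simp
  then show "Liminf (at_right 0) (\<lambda>r. ereal (psi (- ln r))) \<le> ereal C1"
    by (rule Liminf_le_if_subsequence[OF filterlim_exp_minus[OF x]])
qed

text \<open>By convexity it suffices that \<open>f1\<close> is unbounded; at the values of
  \<open>U\<close> where dips start it equals \<open>C2 * exp (2 * s n)\<close>.\<close>

lemma superlinear_f: "filterlim (\<lambda>t. f t / t) at_top at_top"
  unfolding filterlim_at_top
proof
  fix Z :: real
  obtain n where n: "Z + 1 \<le> real n"
    using real_arch_simple by blast
  define t0 where "t0 = U (exp (- s n))"
  have s0: "0 \<le> s n"
    using s_ge[of n] by simp
  have e: "0 < exp (- s n)" "exp (- s n) < 2"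
    by simp (rule le_less_trans[of _ 1], use s0 in simp_all)
  have t0: "0 \<le> t0"
    using U_at_s[of n] by (simp add: t0_def)
  have "f1 t0 = C2 / (exp (- s n))\<^sup>2"
  proof -
    have "R t0 = exp (- s n)"
      unfolding t0_def using e by (intro R_U) simp_all
    then show ?thesis
      using m_square_eq(1) by (simp add: f1_def v_def psi_eq at_s)
  qed
  also have "\<dots> = C2 * exp (2 * s n)"
    by (simp add: exp_minus field_simps flip: exp_double)
  also have "\<dots> \<ge> 1 * (2 * s n)"
  proof (intro mult_mono)
    show "1 \<le> C2"
      using C2_ge k_ge_9 by simp
    have "1 + 2 * s n \<le> exp (2 * s n)"
      by (rule exp_ge_add_one_self)
    then show "2 * s n \<le> exp (2 * s n)"
      by linarith
  qed (use C2_ge k_ge_9 s0 in auto)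
  finally have f1: "Z + 1 \<le> f1 t0"
    using n s_ge[of n] by linarith
  \<comment> \<open>The tangent at \<open>t0\<close> has slope at least \<open>Z + 1\<close>; the
    surplus 1 absorbs the loss \<open>f1 t0 * t0\<close> for such \<open>t\<close>, and the other 1
    in the threshold keeps \<open>t\<close> positive.\<close>
  have "Z \<le> f t / t" if t: "1 + f1 t0 * t0 \<le> t" for t
  proof -
    have "0 \<le> f1 t0 * t0"
      using t0 A_negative by (intro mult_nonneg_nonneg f1_nonneg) auto
    then have "0 < t"
      using t by simp
    have "(Z + 1) * t \<le> f1 t0 * t"
      using f1 \<open>0 < t\<close> by (intro mult_right_mono) auto
    moreover have "f t0 + f1 t0 * (t - t0) \<le> f t" "0 < f t0"
      using t0 \<open>0 < t\<close> A_negative by (auto intro!: f_convex f_pos)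
    ultimately have "Z * t \<le> f t"
      using t by (simp add: algebra_simps)
    then show ?thesis
      using \<open>0 < t\<close> by (simp add: pos_le_divide_eq)
  qed
  then show "\<forall>\<^sub>F t in at_top. Z \<le> f t / t"
    unfolding eventually_at_top_linorder by blast
qed

end

lemma oscillating_profile_exists:
  assumes "9 \<le> k" "0 \<le> C1" "C1 \<le> C2" "2 * (real k - 1) \<le> C2" "C2 \<le> (real k - 1)\<^sup>2 / 4"
  obtains b b1 b2 s where "oscillating_profile k C1 C2 b b1 b2 s"
proof -
  have "0 < 1 / ((real k + 2) * k)"
    using assms(1) by simp
  then obtain b b1 b2 and s :: "nat \<Rightarrow> real" where
    "\<And>n. times_differentiable n UNIV b"
    "\<And>x. (b has_real_derivative b1 x) (at x)" "\<And>x. (b1 has_real_derivative b2 x) (at x)"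
    "\<And>x. 0 \<le> b x" "\<And>x. b x < 1"
    "\<And>x. \<bar>b1 x\<bar> \<le> 1 / ((real k + 2) * k) * (1 - b x)" "\<And>x. \<bar>b2 x\<bar> \<le> 1 / ((real k + 2) * k) * (1 - b x)"
    "(b1 \<longlongrightarrow> 0) at_top"
    "\<And>n. b (s n) = 0 \<and> b1 (s n) = 0" "\<And>n. b (3 / 2 * s n) = 1 - 1 / (real n + 2)"
    "\<And>n x. 2 * s n \<le> x \<Longrightarrow> x \<le> s (Suc n) \<Longrightarrow> b x = 0"
    "\<And>n. real n \<le> s n" "\<And>n. s (Suc n) = 2 * s n + exp (4 * s n)"
    by (rule sparse_dips) (rule that)
  with assms have "oscillating_profile k C1 C2 b b1 b2 s"
    unfolding oscillating_profile_def by simp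
  then show thesis
    by (rule that)
qed

theorem theorem1p3:
  fixes C1 C2 :: real
  assumes "CARD('n::finite) \<ge> 10"
    and "0 \<le> C1" and "C1 \<le> C2"
    and "2 * (real CARD('n) - 2) \<le> C2" and "C2 \<le> (real CARD('n) - 2)^2 / 4"
  shows "\<exists>f :: real \<Rightarrow> real.
    smooth_on_nonneg f \<and> mono_on {0..} f \<and> convex_on {0..} f \<and> f 0 > 0 \<and>
    filterlim (\<lambda>t. f t / t) at_top at_top \<and>
    extremal_parameter (ball (0 :: real ^ 'n) 1) f 1 \<and>
    (\<exists>(ustar :: real ^ 'n \<Rightarrow> ereal) (U :: real \<Rightarrow> real).
       extremal_solution (ball 0 1) f ustar \<and>
       ess_unbounded_on (ball 0 1) ustar \<and>
       (\<forall>x \<in> ball 0 1 - {0}. ustar x = ereal (U (norm x))) \<and>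
       Liminf (at_right 0) (\<lambda>r. ereal (r^2 * deriv f (U r))) = ereal C1 \<and>
       Limsup (at_right 0) (\<lambda>r. ereal (r^2 * deriv f (U r))) = ereal C2)"
proof -
  define k where "k = CARD('n) - 1"
  have k: "9 \<le> k" "CARD('n) = Suc k"
    using assms(1) by (auto simp: k_def)
  have dim: "DIM(real ^ 'n) = Suc k"
    using k(2) by simp
  have C2: "2 * (real k - 1) \<le> C2" "C2 \<le> (real k - 1)\<^sup>2 / 4"
    using assms(4,5) unfolding k(2) by simp_all
  obtain b b1 b2 s where "oscillating_profile k C1 C2 b b1 b2 s"
    using oscillating_profile_exists[OF k(1) assms(2,3) C2] by blast
  then interpret oscillating_profile k C1 C2 b b1 b2 s .
  have "mono_on {0..} f"
    using f_mono by (intro mono_onI) simp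
  moreover have "convex_on {0..} f"
  proof (rule convex_on_realI[where f' = f1])
    show "(f has_real_derivative f1 t) (at t)" if "t \<in> {0..}" for t
      using that A_negative by (intro f_has_derivative) auto
    show "f1 t \<le> f1 u" if "t \<in> {0..}" "t \<le> u" for t u
      using that A_negative by (intro f1_mono) auto
  qed simp
  ultimately show ?thesis
    using smooth_on_nonneg_if_times_differentiable[OF A_negative f_smooth] f_pos[OF A_negative] superlinear_f
      extremal_parameter_1[OF dim] extremal_solution_singular[OF dim] ess_unbounded_singular[OF dim]
      Liminf_r_square_deriv Limsup_r_square_deriv
    by (intro exI[of _ f] conjI exI[of _ "singular_solution :: real ^ 'n \<Rightarrow> ereal"] exI[of _ U])
       (auto simp: singular_solution_def)
qed

end
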